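(* Let $\mathcal{V}$ be a non-octonion symmetric cone of rank $r>2$ in a Euclidean simple Jordan algebra $\mathbb{E}$. Let $X$ and $Y$ be independent random variables valued in $\mathcal{V}$ whose distributions have strictly positive and continuous densities on $\mathcal{V}$ with respect to Lebesgue measure. Set $V=X+Y$ and $U=\mathbb{P}\left((X+Y)^{-1/2}\right)X$. If $U$ and $V$ are independent, then there exist $\mathbf{a}\in\mathcal{V}$ and $p_1,p_2>\dim\mathcal{V}/r-1$ such that $X\sim\gamma_{p_1,\mathbf{a}}$ and $Y\sim\gamma_{p_2,\mathbf{a}}$, where $\gamma_{p,\mathbf{a}}$ denotes the Wishart distribution with parameters $p$ and $\mathbf{a}$.
   Context: A Euclidean Jordan algebra is a finite-dimensional Euclidean space $\mathbb{E}$ with scalar product $\langle\cdot,\cdot\rangle$, a bilinear product $(\mathbf{x},\mathbf{y})\mapsto\mathbf{x}\mathbf{y}$ and a neutral element $\mathbf{e}$ such that $\mathbf{x}\mathbf{y}=\mathbf{y}\mathbf{x}$, $\mathbf{x}(\mathbf{x}^2\mathbf{y})=\mathbf{x}^2(\mathbf{x}\mathbf{y})$, $\mathbf{x}\mathbf{e}=\mathbf{x}$ and $\langle\mathbf{x},\mathbf{y}\mathbf{z}\rangle=\langle\mathbf{x}\mathbf{y},\mathbf{z}\rangle$. It is simple if it is not a Cartesian product of two Euclidean Jordan algebras of positive dimension. Throughout, $\mathbb{E}$ is simple, and "symmetric cone" means the interior $\mathcal{V}$ of the set of squares $\{\mathbf{y}^2:\mathbf{y}\in\mathbb{E}\}$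 (i.e. an irreducible symmetric cone); $\dim\mathcal{V}=\dim\mathbb{E}$. With $\mathbb{L}(\mathbf{x})\mathbf{y}=\mathbf{x}\mathbf{y}$, the quadratic representation is $\mathbb{P}(\mathbf{x})=2\mathbb{L}(\mathbf{x})^2-\mathbb{L}(\mathbf{x}^2)$. A primitive idempotent is $\mathbf{c}\neq 0$ with $\mathbf{c}\mathbf{c}=\mathbf{c}$ that is not a sum of two non-null idempotents. A complete system of primitive orthogonal idempotents is a set $\{\mathbf{c}_1,\dots,\mathbf{c}_r\}$ of primitive idempotents with $\sum_i\mathbf{c}_i=\mathbf{e}$ and $\mathbf{c}_i\mathbf{c}_j=\delta_{ij}\mathbf{c}_i$; its size $r$ is a constant, the rank of $\mathbb{E}$ (and of $\mathcal{V}$). Every $\mathbf{x}\in\mathbb{E}$ can be written $\mathbf{x}=\sum_{i=1}^r\lambda_i\mathbf{c}_i$ for such a system, with real eigenvalues $\lambda_i$; $\mathrm{tr}(\mathbf{x})=\sum_i\lambda_i$ and $\det(\mathbf{x})=\prod_i\lambda_i$. One has $\mathbf{x}\in\mathcal{V}$ iff all $\lambda_i>0$, and then $\mathbf{x}^{-1/2}=\sum_i\lambda_i^{-1/2}\mathbf{c}_i$. The scalar product is normalized as $\langle\mathbf{x},\mathbf{y}\rangle=\mathrm{tr}(\mathbf{x}\mathbf{y})$, and Lebesgue measure $d\mathbf{y}$ is that of the Euclidean space $\mathbb{E}$. Up to isomorphism the Euclidean simple Jordan algebras are $S_r(\mathbb{R})$ ($r\ge1$), $S_r(\mathbb{C})$,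 $S_r(\mathbb{H})$ ($r\ge2$), $S_3(\mathbb{O})$ (Hermitian $r\times r$ matrices over $\mathbb{R}$, the complexes, quaternions, octonions, with product $\mathbf{x}\mathbf{y}=\frac12(\mathbf{x}\cdot\mathbf{y}+\mathbf{y}\cdot\mathbf{x})$, where $\cdot$ is the matrix product), and the rank-2 algebras $\mathbb{R}^{n+1}$, $n\ge2$, with product $(x_0,\dots,x_n)(y_0,\dots,y_n)=(\sum_{i=0}^n x_iy_i,\,x_0y_1+y_0x_1,\dots,x_0y_n+y_0x_n)$. "Non-octonion" means that $\mathbb{E}$ is not isomorphic to $S_3(\mathbb{O})$. For $\mathbf{a}\in\mathcal{V}$ and $p>\dim\mathcal{V}/r-1$, the Wishart distribution $\gamma_{p,\mathbf{a}}$ is the probability measure with density $$\gamma_{p,\mathbf{a}}(d\mathbf{y})=\frac{(\det\mathbf{a})^p}{\Gamma_{\mathcal{V}}(p)}(\det\mathbf{y})^{p-\dim\mathcal{V}/r}\exp(-\langle\mathbf{a},\mathbf{y}\rangle)\,I_{\mathcal{V}}(\mathbf{y})\,d\mathbf{y},$$ where $I_{\mathcal{V}}$ is the indicator function of $\mathcal{V}$ and $\Gamma_{\mathcal{V}}(p)=\int_{\mathcal{V}}e^{-\mathrm{tr}(\mathbf{y})}(\det\mathbf{y})^{p-\dim\mathcal{V}/r}\,d\mathbf{y}$ is the Gamma function of the cone. *)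

theory Defs
  imports "HOL-Probability.Probability"
begin

section \<open>Euclidean Jordan algebras\<close>

text \<open>
  The algebra lives on a subspace \<open>S\<close> of a Euclidean space, with the inner product of that
  space; the carrier is needed only for the factors of a Cartesian product, and the algebras
  we are interested in have carrier \<^term>\<open>UNIV\<close>. Linearity in the second argument follows
  from commutativity.
\<close>

locale euclidean_jordan_algebra =
  fixes S :: "'a::euclidean_space set" and m :: "'a \<Rightarrow> 'a \<Rightarrow> 'a" and e :: 'a
  assumes carrier_subspace: "subspace S"
    and mult_closed: "\<lbrakk>x \<in> S; y \<in> S\<rbrakk> \<Longrightarrow> m x y \<in> S"
    and unit_closed: "e \<in> S"
    and add_left: "\<lbrakk>x \<in> S; y \<in> S; z \<in> S\<rbrakk> \<Longrightarrow> m (x + y) z = m x z + m y z"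
    and scale_left: "\<lbrakk>x \<in> S; y \<in> S\<rbrakk> \<Longrightarrow> m (k *\<^sub>R x) y = k *\<^sub>R m x y"
    and commute: "\<lbrakk>x \<in> S; y \<in> S\<rbrakk> \<Longrightarrow> m x y = m y x"
    and jordan_identity: "\<lbrakk>x \<in> S; y \<in> S\<rbrakk> \<Longrightarrow> m x (m (m x x) y) = m (m x x) (m x y)"
    and unit_right: "x \<in> S \<Longrightarrow> m x e = x"
    and inner_assoc: "\<lbrakk>x \<in> S; y \<in> S; z \<in> S\<rbrakk> \<Longrightarrow> inner x (m y z) = inner (m x y) z"

definition algebra_iso ::
  "'a::real_vector set \<Rightarrow> ('a \<Rightarrow> 'a \<Rightarrow> 'a) \<Rightarrow> 'b::real_vector set \<Rightarrow> ('b \<Rightarrow> 'b \<Rightarrow> 'b) \<Rightarrow> ('a \<Rightarrow> 'b) \<Rightarrow> bool"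
  where "algebra_iso S m T n \<phi> \<longleftrightarrow>
    linear \<phi> \<and> bij_betw \<phi> S T \<and> (\<forall>x\<in>S. \<forall>y\<in>S. \<phi> (m x y) = n (\<phi> x) (\<phi> y))"

text \<open>
  Up to an isometric isomorphism, the factors of a Cartesian product decomposition can be placed
  on subspaces of the given space, since their dimension does not exceed its dimension.
\<close>

definition simple_euclidean_jordan_algebra ::
  "('a::euclidean_space \<Rightarrow> 'a \<Rightarrow> 'a) \<Rightarrow> 'a \<Rightarrow> bool"
  where "simple_euclidean_jordan_algebra m e \<longleftrightarrow>
    euclidean_jordan_algebra UNIV m e \<and>
    \<not> (\<exists>(A :: 'a set) (B :: 'a set) mA mB eA eB \<phi>.
        euclidean_jordan_algebra A mA eA \<and> dim A > 0 \<and>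
        euclidean_jordan_algebra B mB eB \<and> dim B > 0 \<and>
        algebra_iso UNIV m (A \<times> B) (\<lambda>(a, b) (a', b'). (mA a a', mB b b')) \<phi>)"

definition symmetric_cone :: "('a::euclidean_space \<Rightarrow> 'a \<Rightarrow> 'a) \<Rightarrow> 'a set"
  where "symmetric_cone m = interior (range (\<lambda>y. m y y))"

definition quadratic_rep :: "('a::real_vector \<Rightarrow> 'a \<Rightarrow> 'a) \<Rightarrow> 'a \<Rightarrow> 'a \<Rightarrow> 'a"
  where "quadratic_rep m x y = 2 *\<^sub>R m x (m x y) - m (m x x) y"

section \<open>Spectral notions\<close>

definition primitive_idempotent :: "('a::real_vector \<Rightarrow> 'a \<Rightarrow> 'a) \<Rightarrow> 'a \<Rightarrow> bool"
  where "primitive_idempotent m c \<longleftrightarrow> c \<noteq> 0 \<and> m c c = c \<and>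
    \<not> (\<exists>a b. a \<noteq> 0 \<and> m a a = a \<and> b \<noteq> 0 \<and> m b b = b \<and> c = a + b)"

definition complete_system :: "('a::real_vector \<Rightarrow> 'a \<Rightarrow> 'a) \<Rightarrow> 'a \<Rightarrow> 'a set \<Rightarrow> bool"
  where "complete_system m e C \<longleftrightarrow> finite C \<and> (\<forall>c\<in>C. primitive_idempotent m c) \<and>
    (\<Sum>c\<in>C. c) = e \<and> (\<forall>c\<in>C. \<forall>d\<in>C. m c d = (if c = d then c else 0))"

definition spectral_decomposition ::
  "('a::real_vector \<Rightarrow> 'a \<Rightarrow> 'a) \<Rightarrow> 'a \<Rightarrow> 'a \<Rightarrow> 'a set \<Rightarrow> ('a \<Rightarrow> real) \<Rightarrow> bool"
  where "spectral_decomposition m e x C eig \<longleftrightarrow>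
    complete_system m e C \<and> x = (\<Sum>c\<in>C. eig c *\<^sub>R c)"

text \<open>
  In a Euclidean Jordan algebra every element has a spectral decomposition, and the quantities
  below do not depend on its choice (for the last one, when \<open>x\<close> is in the symmetric cone,
  i.e. when all eigenvalues are positive).
\<close>

definition jordan_rank :: "('a::real_vector \<Rightarrow> 'a \<Rightarrow> 'a) \<Rightarrow> 'a \<Rightarrow> nat"
  where "jordan_rank m e = (THE r. \<exists>C. complete_system m e C \<and> r = card C)"

definition jordan_trace :: "('a::real_vector \<Rightarrow> 'a \<Rightarrow> 'a) \<Rightarrow> 'a \<Rightarrow> 'a \<Rightarrow> real"
  where "jordan_trace m e x =
    (THE t. \<exists>C eig. spectral_decomposition m e x C eig \<and> t = (\<Sum>c\<in>C. eig c))"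

definition jordan_det :: "('a::real_vector \<Rightarrow> 'a \<Rightarrow> 'a) \<Rightarrow> 'a \<Rightarrow> 'a \<Rightarrow> real"
  where "jordan_det m e x =
    (THE d. \<exists>C eig. spectral_decomposition m e x C eig \<and> d = (\<Prod>c\<in>C. eig c))"

definition inv_sqrt :: "('a::real_vector \<Rightarrow> 'a \<Rightarrow> 'a) \<Rightarrow> 'a \<Rightarrow> 'a \<Rightarrow> 'a"
  where "inv_sqrt m e x =
    (THE y. \<exists>C eig. spectral_decomposition m e x C eig \<and> y = (\<Sum>c\<in>C. (eig c powr (-1/2)) *\<^sub>R c))"

section \<open>The octonionic algebra \<open>S\<^sub>3(\<bbbO>)\<close>\<close>

text \<open>Quaternions and octonions are obtained from \<^typ>\<open>complex\<close> by Cayley--Dickson doubling.\<close>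

type_synonym quat = "complex \<times> complex"
type_synonym oct = "quat \<times> quat"

definition quat_mult :: "quat \<Rightarrow> quat \<Rightarrow> quat"
  where "quat_mult = (\<lambda>(a, b) (c, d). (a * c - cnj d * b, d * a + b * cnj c))"

definition quat_cnj :: "quat \<Rightarrow> quat"
  where "quat_cnj = (\<lambda>(a, b). (cnj a, - b))"

definition oct_mult :: "oct \<Rightarrow> oct \<Rightarrow> oct"
  where "oct_mult = (\<lambda>(a, b) (c, d).
    (quat_mult a c - quat_mult (quat_cnj d) b, quat_mult d a + quat_mult b (quat_cnj c)))"

definition oct_cnj :: "oct \<Rightarrow> oct"
  where "oct_cnj = (\<lambda>(a, b). (quat_cnj a, - b))"

definition oct_matrix_mult :: "oct^3^3 \<Rightarrow> oct^3^3 \<Rightarrow> oct^3^3"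
  where "oct_matrix_mult A B = (\<chi> i j. \<Sum>k\<in>UNIV. oct_mult (A $ i $ k) (B $ k $ j))"

definition albert_carrier :: "(oct^3^3) set"
  where "albert_carrier = {A. \<forall>i j. A $ i $ j = oct_cnj (A $ j $ i)}"

definition albert_mult :: "oct^3^3 \<Rightarrow> oct^3^3 \<Rightarrow> oct^3^3"
  where "albert_mult A B = (1/2) *\<^sub>R (oct_matrix_mult A B + oct_matrix_mult B A)"

definition non_octonion :: "('a::euclidean_space \<Rightarrow> 'a \<Rightarrow> 'a) \<Rightarrow> bool"
  where "non_octonion m \<longleftrightarrow> \<not> (\<exists>\<phi>. algebra_iso UNIV m albert_carrier albert_mult \<phi>)"

section \<open>Wishart distributions\<close>

definition cone_gamma :: "('a::euclidean_space \<Rightarrow> 'a \<Rightarrow> 'a) \<Rightarrow> 'a \<Rightarrow> real \<Rightarrow> real"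
  where "cone_gamma m e p =
    (LINT y:symmetric_cone m|lborel.
      exp (- jordan_trace m e y) * jordan_det m e y powr (p - DIM('a) / jordan_rank m e))"

definition wishart :: "('a::euclidean_space \<Rightarrow> 'a \<Rightarrow> 'a) \<Rightarrow> 'a \<Rightarrow> real \<Rightarrow> 'a \<Rightarrow> 'a measure"
  where "wishart m e p a = density lborel (\<lambda>y. ennreal (
    jordan_det m e a powr p / cone_gamma m e p *
    jordan_det m e y powr (p - DIM('a) / jordan_rank m e) *
    exp (- inner a y) * indicator (symmetric_cone m) y))"

end

theory Submission
  imports Defs
begin

text \<open>
  On the product of the order interval \<open>D = {u. 0 < u < e}\<close> and the cone, the pair \<open>(U, V)\<close> has the
  density \<open>J(v) f(P(w) u) g(P(w) (e - u))\<close>, where \<open>w\<close> is the square root of \<open>v\<close>. Independence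
  turns this into a cross identity in which \<open>J\<close> cancels, i.e. a functional equation of Olkin--Baker type
  for \<open>a = ln f\<close> and \<open>b = ln g\<close>. Scaling \<open>w\<close> gives a Pexider equation for
  \<open>x \<mapsto> a(s x) - a(x)\<close>, so that after subtracting one linear functional from both functions they are
  logarithmically homogeneous. Letting \<open>u \<rightarrow> 0\<close> then yields \<open>a(P(w) x) = a(x) + a(w\<^sup>2)\<close>
  up to constants.

  A continuous solution of this last equation is a multiple of \<open>ln det\<close>: \<open>\<lambda>x. a(exp x)\<close> is
  homogeneous, and comparing first-order terms of \<open>P(exp(t x / 2)) exp(t y)\<close> at \<open>t = 0\<close> shows that
  it is additive, hence of the form \<open>inner B\<close>. Comparing first-order terms at \<open>e + 3 c\<close> for an idempotent
  \<open>c\<close> gives \<open>c (c B) = c B\<close>, so every primitive idempotent is an eigenvector of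
  multiplication by \<open>B\<close>, and simplicity forces \<open>B\<close> to be a multiple of \<open>e\<close>. Applied to the
  volume of order intervals the same result shows that \<open>det\<close> is multiplicative and that \<open>P(w)\<close>
  scales Lebesgue measure by \<open>det(w\<^sup>2)\<close> to the power \<open>dim / r\<close>. Finally, \<open>det\<close> is
  affine along lines in the direction of a primitive idempotent, so integrability of the densities gives
  the constraints on the parameters.
\<close>

text \<open>Since P(w) e = w^2, the pair (U, V) is inverted by X = P(w) U and Y = P(w) (e - U),
  where w^2 = V. Multiplying w by sqrt s multiplies X and Y by s and leaves U fixed, which is where
  the Pexider equation comes from. The densities are only continuous, so the functional equation
  cannot be differentiated. First-order terms are compared at e along curves k(t): homogeneity
  rewrites a(k(t)) / t as a(exp(ln k(t) / t)), and ln k(t) / t converges to the tangent vector. As u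
  tends to 0, b is evaluated near w^2 and near e only, so continuity disposes of it, while
  logarithmic homogeneity controls a near 0. The 3 in e + 3 c arises from (e + c)^2 = e + 3 c. The
  determinant is defined through eigenvalues, so its behaviour under P(w) is invisible in the
  definition. The volume of the order interval below v, in contrast, transforms correctly under
  every linear automorphism of the cone and stands in for it.\<close>

locale jordan =
  fixes m :: "'a::euclidean_space \<Rightarrow> 'a \<Rightarrow> 'a"  (infixl "\<odot>" 70) and e :: 'a
  assumes eja: "euclidean_jordan_algebra UNIV m e"
begin

section \<open>The polarised Jordan identity and the Peirce calculus of one idempotent\<close>

lemma add_l: "(x + y) \<odot> z = x \<odot> z + y \<odot> z"
  and scale_l: "(k *\<^sub>R x) \<odot> y = k *\<^sub>R (x \<odot> y)"
  and comm: "x \<odot> y = y \<odot> x"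
  and jordan_id: "x \<odot> ((x \<odot> x) \<odot> y) = (x \<odot> x) \<odot> (x \<odot> y)"
  and unit_r [simp]: "x \<odot> e = x"
  and inner_mult: "inner x (y \<odot> z) = inner (x \<odot> y) z"
proof -
  interpret euclidean_jordan_algebra UNIV m e by (rule eja)
  show "(x + y) \<odot> z = x \<odot> z + y \<odot> z" by (rule add_left) simp_all
  show "(k *\<^sub>R x) \<odot> y = k *\<^sub>R (x \<odot> y)" by (rule scale_left) simp_all
  show "x \<odot> y = y \<odot> x" by (rule commute) simp_all
  show "x \<odot> ((x \<odot> x) \<odot> y) = (x \<odot> x) \<odot> (x \<odot> y)" by (rule jordan_identity) simp_all
  show "x \<odot> e = x" by (rule unit_right) simp
  show "inner x (y \<odot> z) = inner (x \<odot> y) z" by (rule inner_assoc) simp_all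
qed

lemma unit_l [simp]: "e \<odot> x = x"
  using comm[of e x] by simp

lemma add_r: "z \<odot> (x + y) = z \<odot> x + z \<odot> y"
  by (simp add: comm[of z] add_l)

lemma scale_r: "y \<odot> (k *\<^sub>R x) = k *\<^sub>R (y \<odot> x)"
  by (simp add: comm[of y] scale_l)

lemma linear_mult: "linear ((\<odot>) x)"
  by (rule linearI) (simp_all add: add_r scale_r)

lemma bounded_bilinear_mult: "bounded_bilinear (\<odot>)"
  unfolding bilinear_conv_bounded_bilinear[symmetric] bilinear_def
  by (auto intro!: linearI simp: add_r scale_r add_l scale_l)

lemmas mult_cont [continuous_intros] = bounded_bilinear.continuous_on[OF bounded_bilinear_mult]
lemmas zero_l [simp] = bounded_bilinear.zero_left[OF bounded_bilinear_mult]
lemmas zero_r [simp] = bounded_bilinear.zero_right[OF bounded_bilinear_mult]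
lemmas minus_l = bounded_bilinear.minus_left[OF bounded_bilinear_mult]
lemmas minus_r = bounded_bilinear.minus_right[OF bounded_bilinear_mult]
lemmas diff_l = bounded_bilinear.diff_left[OF bounded_bilinear_mult]
lemmas diff_r = bounded_bilinear.diff_right[OF bounded_bilinear_mult]
lemmas sum_l = bounded_bilinear.sum_left[OF bounded_bilinear_mult]
lemmas sum_r = bounded_bilinear.sum_right[OF bounded_bilinear_mult]
lemmas bilin = add_l add_r scale_l scale_r minus_l minus_r diff_l diff_r

lemma inner_mult': "inner (y \<odot> x) z = inner x (y \<odot> z)"
  using inner_mult[of x y z] by (simp add: comm)

lemma inner_mult_e: "inner (x \<odot> y) e = inner x y" "inner e (x \<odot> y) = inner x y"
  using inner_mult[of x y e] by (simp_all add: inner_commute)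

text \<open>The part odd in c of the Jordan identity at a + c and a - c; its term cubic in c is the
  Jordan identity of c itself. Pairing with basis vectors leaves real equations for linear
  arithmetic.\<close>

lemma polarised_square:
  "2 *\<^sub>R (a \<odot> ((a \<odot> c) \<odot> y)) + c \<odot> ((a \<odot> a) \<odot> y)
    = 2 *\<^sub>R ((a \<odot> c) \<odot> (a \<odot> y)) + (a \<odot> a) \<odot> (c \<odot> y)"
proof (rule euclidean_eqI)
  fix i :: 'a
  have J: "inner (x \<odot> ((x \<odot> x) \<odot> y)) i = inner ((x \<odot> x) \<odot> (x \<odot> y)) i" for x
    by (simp add: jordan_id)
  have eqs: "c \<odot> a = a \<odot> c"
    by (rule comm)
  show "inner (2 *\<^sub>R (a \<odot> ((a \<odot> c) \<odot> y)) + c \<odot> ((a \<odot> a) \<odot> y)) i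
    = inner (2 *\<^sub>R ((a \<odot> c) \<odot> (a \<odot> y)) + (a \<odot> a) \<odot> (c \<odot> y)) i"
    using J[of "a + c"] J[of "a - c"] J[of c]
    unfolding bilin inner_add_left inner_diff_left inner_scaleR_left eqs by linarith
qed

text \<open>Linearises \<open>polarised_square\<close> in a: its instances at a + b, a and b leave
  the part bilinear in a and b.\<close>

lemma polarised:
  "a \<odot> ((b \<odot> c) \<odot> y) + b \<odot> ((c \<odot> a) \<odot> y) + c \<odot> ((a \<odot> b) \<odot> y)
    = (b \<odot> c) \<odot> (a \<odot> y) + (c \<odot> a) \<odot> (b \<odot> y) + (a \<odot> b) \<odot> (c \<odot> y)"
proof (rule euclidean_eqI)
  fix i :: 'a
  note J = arg_cong[OF polarised_square, of "\<lambda>v. inner v i"]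
  have eqs: "c \<odot> a = a \<odot> c" "b \<odot> a = a \<odot> b"
    by (rule comm)+
  show "inner (a \<odot> ((b \<odot> c) \<odot> y) + b \<odot> ((c \<odot> a) \<odot> y) + c \<odot> ((a \<odot> b) \<odot> y)) i
    = inner ((b \<odot> c) \<odot> (a \<odot> y) + (c \<odot> a) \<odot> (b \<odot> y) + (a \<odot> b) \<odot> (c \<odot> y)) i"
    using J[of "a + b" c y] J[of a c y] J[of b c y]
    unfolding bilin inner_add_left inner_scaleR_left eqs distrib_left by linarith
qed

text \<open>Read as operators on c, this expresses multiplication by a triple product through
  multiplications by its factors and by products of two of them. Both the commuting of powers and
  the Peirce eigenvalues come from it.\<close>

lemma mult_op:
  "((a \<odot> b) \<odot> y) \<odot> c = (a \<odot> y) \<odot> (b \<odot> c) + (b \<odot> y) \<odot> (a \<odot> c) + (a \<odot> b) \<odot> (y \<odot> c)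
     - a \<odot> (y \<odot> (b \<odot> c)) - b \<odot> (y \<odot> (a \<odot> c))"
  using polarised[of a b c y] by (simp add: comm algebra_simps)

definition idem :: "'a \<Rightarrow> bool" where "idem c \<longleftrightarrow> c \<odot> c = c"

text \<open>With all entries equal to c, \<open>mult_op\<close> says 2 L^3 - 3 L^2 + L = 0 for the
  multiplication L by c, so its eigenvalues lie in {0, 1/2, 1}.\<close>

lemma idem_cubic:
  assumes "idem c"
  shows "c \<odot> (c \<odot> (c \<odot> z)) = (3/2) *\<^sub>R (c \<odot> (c \<odot> z)) - (1/2) *\<^sub>R (c \<odot> z)"
proof (rule euclidean_eqI)
  fix i :: 'a
  show "inner (c \<odot> (c \<odot> (c \<odot> z))) i = inner ((3/2) *\<^sub>R (c \<odot> (c \<odot> z)) - (1/2) *\<^sub>R (c \<odot> z)) i"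
    using arg_cong[OF mult_op[of c c c z], of "\<lambda>v. inner v i"] assms unfolding idem_def
    by (simp add: inner_add_left inner_diff_left) (simp add: field_simps)
qed

text \<open>A sum of squares for multiplication by c: t = (2 t^2 - t)^2 + 8 (t - t^2)^2 holds at t =
  0, 1/2 and 1. It gives positivity without splitting y into Peirce components, and its zero case
  forces c y = 0.\<close>

lemma inner_idem:
  assumes "idem c"
  shows "inner (c \<odot> y) y = (norm (2 *\<^sub>R (c \<odot> (c \<odot> y)) - c \<odot> y))\<^sup>2
     + 8 * (norm (c \<odot> y - c \<odot> (c \<odot> y)))\<^sup>2"
proof -
  define p where "p = inner (c \<odot> y) y"
  define q where "q = inner (c \<odot> y) (c \<odot> y)"
  have 1: "inner (c \<odot> (c \<odot> y)) y = q" by (simp add: q_def inner_mult')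
  have c3: "inner (c \<odot> (c \<odot> (c \<odot> y))) y = 3/2 * q - 1/2 * p"
    by (subst idem_cubic[OF assms]) (simp add: inner_diff_left p_def 1)
  have c4: "inner (c \<odot> (c \<odot> (c \<odot> (c \<odot> y)))) y = 3/2 * (3/2*q - 1/2*p) - 1/2 * q"
    by (subst idem_cubic[OF assms]) (simp add: inner_diff_left c3 1)
  have a: "inner (c \<odot> (c \<odot> y)) (c \<odot> (c \<odot> y)) = 3/2 * (3/2*q - 1/2*p) - 1/2 * q"
    unfolding c4[symmetric] by (simp add: inner_mult')
  have b: "inner (c \<odot> (c \<odot> y)) (c \<odot> y) = 3/2 * q - 1/2 * p"
    unfolding c3[symmetric] by (simp add: inner_mult')
  show ?thesis unfolding power2_norm_eq_inner
    by (simp add: inner_diff_left inner_diff_right a b inner_commute[of "c \<odot> y" "c \<odot> (c \<odot> y)"]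
        p_def[symmetric] q_def[symmetric] field_simps)
qed

lemma inner_idem_nonneg: "idem c \<Longrightarrow> inner (c \<odot> y) y \<ge> 0"
  by (simp add: inner_idem)

lemma inner_idem_zero:
  assumes "idem c" "inner (c \<odot> y) y = 0" shows "c \<odot> y = 0"
proof -
  have "(norm (2 *\<^sub>R (c \<odot> (c \<odot> y)) - c \<odot> y))\<^sup>2 + 8 * (norm (c \<odot> y - c \<odot> (c \<odot> y)))\<^sup>2 = 0"
    using inner_idem[OF assms(1), of y] assms(2) by simp
  then have "(norm (2 *\<^sub>R (c \<odot> (c \<odot> y)) - c \<odot> y))\<^sup>2 = 0" "(norm (c \<odot> y - c \<odot> (c \<odot> y)))\<^sup>2 = 0"
    using zero_le_power2[of "norm (2 *\<^sub>R (c \<odot> (c \<odot> y)) - c \<odot> y)"]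
      zero_le_power2[of "norm (c \<odot> y - c \<odot> (c \<odot> y))"] by linarith+
  then have "2 *\<^sub>R (c \<odot> (c \<odot> y)) = c \<odot> y" "c \<odot> (c \<odot> y) = c \<odot> y" by auto
  then have "2 *\<^sub>R (c \<odot> y) = c \<odot> y" by simp
  then show ?thesis by (simp add: scaleR_2)
qed

lemma inner_idem_idem: "idem d \<Longrightarrow> inner (c \<odot> d) d = inner c d"
  unfolding idem_def by (simp add: inner_mult[symmetric])

lemma idem_inner_nonneg: "idem c \<Longrightarrow> idem d \<Longrightarrow> inner c d \<ge> 0"
  using inner_idem_nonneg[of c d] inner_idem_idem[of d c] by simp

lemma idem_orth: "idem c \<Longrightarrow> idem d \<Longrightarrow> inner c d = 0 \<Longrightarrow> c \<odot> d = 0"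
  using inner_idem_zero[of c d] inner_idem_idem[of d c] by simp

lemma inner_zero_if_mult_zero: "c \<odot> d = 0 \<Longrightarrow> inner c d = 0"
  using inner_mult_e(1)[of c d] by simp

lemma idem_norm: "idem c \<Longrightarrow> inner c e = inner c c"
  unfolding idem_def using inner_mult_e(1)[of c c] by simp

lemma idem_compl: "idem c \<Longrightarrow> idem (e - c)"
  unfolding idem_def by (simp add: bilin)

text \<open>In \<open>polarised\<close> at c, c, x the relation c x = x leaves 2 c (x z) + x (c z) =
  2 x (c z) + c (x z).\<close>

lemma peirce1_comm:
  assumes "idem c" "c \<odot> x = x" shows "c \<odot> (x \<odot> z) = x \<odot> (c \<odot> z)"
  using polarised[of c c x z] assms comm[of x c] unfolding idem_def by simp

lemma peirce0_comm:
  assumes "idem c" "c \<odot> x = 0" shows "c \<odot> (x \<odot> z) = x \<odot> (c \<odot> z)"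
  using polarised[of c c x z] assms comm[of x c] unfolding idem_def by simp

text \<open>Both commutation rules apply to the product: c (x y) = x (c y) = 0 and c (y x) = y (c x)
  = y x.\<close>

lemma peirce_10:
  assumes "idem c" "c \<odot> x = x" "c \<odot> y = 0" shows "x \<odot> y = 0"
proof -
  have "c \<odot> (x \<odot> y) = x \<odot> (c \<odot> y)" using peirce1_comm assms by blast
  moreover have "c \<odot> (y \<odot> x) = y \<odot> (c \<odot> x)" using peirce0_comm assms by blast
  ultimately show ?thesis using assms by (simp add: comm)
qed

lemma peirce_11:
  assumes "idem c" "c \<odot> x = x" "c \<odot> y = y" shows "c \<odot> (x \<odot> y) = x \<odot> y"
  using peirce1_comm[OF assms(1,2), of y] assms by simp

text \<open>The equation t^2 = t excludes exactly the eigenvalue 1/2, so the product of two half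
  elements has components for 0 and 1 only.\<close>

lemma peirce_hh:
  assumes "idem c" "c \<odot> x = (1/2) *\<^sub>R x" "c \<odot> y = (1/2) *\<^sub>R y"
  shows "c \<odot> (c \<odot> (x \<odot> y)) = c \<odot> (x \<odot> y)"
  using polarised[of c x y c] assms unfolding idem_def
  by (simp add: comm bilin)

text \<open>The polynomial 2 t^2 - t is 1 at 1 and vanishes at 0 and 1/2, so this element is the
  Peirce component of z for the eigenvalue 1; it equals P(c) z.\<close>

lemma idem_quad_in_peirce1:
  assumes "idem c"
  shows "c \<odot> (2 *\<^sub>R (c \<odot> (c \<odot> z)) - c \<odot> z) = 2 *\<^sub>R (c \<odot> (c \<odot> z)) - c \<odot> z"
  by (rule euclidean_eqI) (simp add: bilin idem_cubic[OF assms] inner_diff_left)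

lemma orth_idem_comm:
  assumes "idem c" "c \<odot> d = 0" shows "c \<odot> (d \<odot> z) = d \<odot> (c \<odot> z)"
  using peirce0_comm assms by blast

lemma orth_idem_add: "idem c \<Longrightarrow> idem d \<Longrightarrow> c \<odot> d = 0 \<Longrightarrow> idem (c + d)"
  unfolding idem_def by (simp add: bilin comm[of d c])

text \<open>The component of d z for the eigenvalue 1 of d is killed by c, so applying c leaves only
  the half component.\<close>

lemma orth_idem_half:
  assumes "idem c" "idem d" "c \<odot> d = 0"
  shows "d \<odot> (c \<odot> (d \<odot> z)) = (1/2) *\<^sub>R (c \<odot> (d \<odot> z))"
proof -
  have "c \<odot> (2 *\<^sub>R (d \<odot> (d \<odot> z)) - d \<odot> z) = 0"
    using peirce_10[OF assms(2) idem_quad_in_peirce1[OF assms(2)], of c z] assms(3)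
    by (simp add: comm)
  then have "2 *\<^sub>R (c \<odot> (d \<odot> (d \<odot> z))) = c \<odot> (d \<odot> z)"
    by (simp add: bilin)
  moreover have "c \<odot> (d \<odot> (d \<odot> z)) = d \<odot> (c \<odot> (d \<odot> z))"
    using orth_idem_comm[OF assms(1,3)] by blast
  ultimately have "2 *\<^sub>R (d \<odot> (c \<odot> (d \<odot> z))) = c \<odot> (d \<odot> z)" by simp
  then have "(1/2) *\<^sub>R (2 *\<^sub>R (d \<odot> (c \<odot> (d \<odot> z)))) = (1/2) *\<^sub>R (c \<odot> (d \<odot> z))" by simp
  then show ?thesis by simp
qed

end

section \<open>The spectral theorem, built on the maximum of a Rayleigh quotient\<close>

lemma self_adjoint_eigenvector:
  fixes T :: "'a::euclidean_space \<Rightarrow> 'a"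
  assumes T: "linear T" and W: "subspace W" and ne: "w \<in> W" "w \<noteq> 0"
    and inv: "\<And>y. y \<in> W \<Longrightarrow> T y \<in> W"
    and sa: "\<And>y z. inner (T y) z = inner y (T z)"
  obtains y l where "y \<in> W" "y \<noteq> 0" "T y = l *\<^sub>R y"
proof -
  define K where "K = sphere 0 1 \<inter> W"
  have "compact K" unfolding K_def
    by (intro compact_Int_closed compact_sphere closed_subspace W)
  moreover have "w /\<^sub>R norm w \<in> K" using ne W by (auto simp: K_def subspace_scale)
  then have "K \<noteq> {}" by blast
  moreover have "continuous_on K (\<lambda>y. inner (T y) y)"
    using linear_continuous_on[of T K] T by (intro continuous_intros) (simp add: linear_conv_bounded_linear)
  ultimately obtain y where y: "y \<in> K" and max: "\<And>z. z \<in> K \<Longrightarrow> inner (T z) z \<le> inner (T y) y"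
    using continuous_attains_sup[of K "\<lambda>y. inner (T y) y"] by blast
  define l where "l = inner (T y) y"
  \<comment> \<open>A quadratic form that is nonnegative on W and vanishes at the maximiser y.
    Moving from y a little along - s, with s = l y - T y as below, would make it negative unless s =
    0.\<close>
  define q where "q z = l * inner z z - inner (T z) z" for z
  have q: "q z \<ge> 0" if "z \<in> W" for z
  proof (cases "z = 0")
    case True then show ?thesis by (simp add: q_def)
  next
    case False
    then have "z /\<^sub>R norm z \<in> K" using that W by (auto simp: K_def subspace_scale)
    from max[OF this] have "inner (T z) z / (norm z)\<^sup>2 \<le> l"
      using T by (simp add: l_def linear_scale power2_eq_square divide_inverse mult_ac)
    then show ?thesis using False by (simp add: q_def divide_simps power2_norm_eq_inner)
  qed
  define s where "s = l *\<^sub>R y - T y"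
  have yW: "y \<in> W" and ny: "inner y y = 1" using y by (auto simp: K_def norm_eq_1)
  have sW: "s \<in> W" using yW W inv by (auto simp: s_def subspace_diff subspace_scale)
  have qy: "q y = 0" by (simp add: q_def l_def ny)
  define A where "A = inner s s"
  have exp: "q (y + t *\<^sub>R s) = 2 * t * A + t\<^sup>2 * q s" for t
  proof -
    have "q (y + t *\<^sub>R s) = q y + 2 * t * (l * inner y s - inner (T y) s) + t\<^sup>2 * q s"
      using sa[of s y] T unfolding q_def
      by (simp add: linear_add linear_scale inner_add_left inner_add_right power2_eq_square
          inner_commute algebra_simps)
    also have "l * inner y s - inner (T y) s = A"
      by (simp add: A_def s_def inner_diff_left)
    finally show ?thesis using qy by simp
  qed
  have "A = 0"
  proof (rule ccontr)
    assume "A \<noteq> 0"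
    then have A: "A > 0" by (simp add: A_def)
    have B: "q s \<ge> 0" using q sW by simp
    \<comment> \<open>The added 1 keeps the denominator positive when q s = 0.\<close>
    define t where "t = - A / (q s + 1)"
    have t: "t < 0" "t * (q s + 1) = - A" using A B by (simp_all add: t_def)
    have "0 \<le> q (y + t *\<^sub>R s)" by (intro q subspace_add[OF W] subspace_scale[OF W] yW sW)
    also have "\<dots> = t * (2 * A + t * (q s + 1) - t)" unfolding exp by (simp add: power2_eq_square algebra_simps)
    also have "\<dots> = t * (A - t)" unfolding t(2) by simp
    also have "\<dots> < 0" using t(1) A by (simp add: mult_neg_pos)
    finally show False by simp
  qed
  then have "s = 0" by (simp add: A_def)
  then have "T y = l *\<^sub>R y" by (simp add: s_def)
  moreover have "y \<noteq> 0" using ny by auto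
  ultimately show ?thesis using that yW by blast
qed

lemma ex_max_card:
  assumes "P C0" "\<And>C. P C \<Longrightarrow> card C \<le> n"
  shows "\<exists>C. P C \<and> (\<forall>D. P D \<longrightarrow> card D \<le> card C)"
  using ex_has_greatest_nat[of P C0 card "Suc n"] assms by (auto simp: less_Suc_eq_le)

context jordan begin

definition oper_comm :: "'a \<Rightarrow> 'a \<Rightarrow> bool"
  where "oper_comm a b \<longleftrightarrow> (\<forall>z. a \<odot> (b \<odot> z) = b \<odot> (a \<odot> z))"

lemma oper_comm_sym: "oper_comm a b \<Longrightarrow> oper_comm b a"
  by (simp add: oper_comm_def)

lemma subspace_oper_comm: "subspace {b. oper_comm a b}"
  unfolding subspace_def oper_comm_def by (auto simp: bilin)

text \<open>Powers start at an idempotent \<open>f\<close> instead of \<open>e\<close>: with \<open>f\<close> primitive, the spectral theorem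
  below shows that the Peirce space of \<open>f\<close> for the eigenvalue 1 is one-dimensional.\<close>

definition jpow :: "'a \<Rightarrow> 'a \<Rightarrow> nat \<Rightarrow> 'a"
  where "jpow f x n = ((\<odot>) x ^^ n) f"

lemma jpow_simps [simp]: "jpow f x 0 = f" "jpow f x (Suc n) = x \<odot> jpow f x n"
  by (simp_all add: jpow_def)

text \<open>A two-step recursion for multiplication by powers. An element commuting as an operator
  with f, x and x^2 therefore commutes with every power.\<close>

lemma jpow_op:
  "jpow f x (Suc (Suc n)) \<odot> z = (x \<odot> x) \<odot> (jpow f x n \<odot> z) + 2 *\<^sub>R (jpow f x (Suc n) \<odot> (x \<odot> z))
     - x \<odot> (x \<odot> (jpow f x n \<odot> z)) - jpow f x n \<odot> (x \<odot> (x \<odot> z))"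
proof -
  have "jpow f x (Suc (Suc n)) \<odot> z = ((x \<odot> jpow f x n) \<odot> x) \<odot> z"
    using comm[of x "x \<odot> jpow f x n"] by simp
  then show ?thesis
    using mult_op[of x "jpow f x n" x z] comm[of "jpow f x n" x] by (simp add: scaleR_2)
qed

lemma jpow_oper_comm:
  assumes "oper_comm k f" "oper_comm k x" "oper_comm k (x \<odot> x)"
    and "f \<odot> x = x"
  shows "oper_comm k (jpow f x n)"
proof -
  have "oper_comm k (jpow f x n) \<and> oper_comm k (jpow f x (Suc n))"
  proof (induction n)
    case 0 then show ?case using assms comm[of x f] by simp
  next
    case (Suc n)
    then have *: "k \<odot> (jpow f x n \<odot> z) = jpow f x n \<odot> (k \<odot> z)"
      "k \<odot> (jpow f x (Suc n) \<odot> z) = jpow f x (Suc n) \<odot> (k \<odot> z)"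
      "k \<odot> (x \<odot> z) = x \<odot> (k \<odot> z)" "k \<odot> ((x \<odot> x) \<odot> z) = (x \<odot> x) \<odot> (k \<odot> z)" for z
      using assms unfolding oper_comm_def by blast+
    have "oper_comm k (jpow f x (Suc (Suc n)))"
      unfolding oper_comm_def jpow_op bilin * by simp
    then show ?case using Suc by blast
  qed
  then show ?thesis by blast
qed

definition powers :: "'a \<Rightarrow> 'a \<Rightarrow> 'a set"
  where "powers f x = span (range (jpow f x))"

context
  fixes f x :: 'a
  assumes f: "idem f" and fx: "f \<odot> x = x"
begin

text \<open>A bootstrap: f, x and x^2 commute pairwise as operators, hence each of them with all
  powers, hence each power with all powers.\<close>

lemma jpow_comm: "oper_comm (jpow f x n) (jpow f x k)"
proof -
  have fx1: "oper_comm f x" using peirce1_comm[OF f fx] by (simp add: oper_comm_def)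
  have fx2: "oper_comm f (x \<odot> x)"
    using peirce1_comm[OF f peirce_11[OF f fx fx]] by (simp add: oper_comm_def)
  have xx: "oper_comm x (x \<odot> x)" by (simp add: oper_comm_def jordan_id)
  have refl: "oper_comm z z" for z by (simp add: oper_comm_def)
  have 1: "oper_comm f (jpow f x n)" for n
    by (intro jpow_oper_comm fx fx1 fx2 refl)
  have 2: "oper_comm x (jpow f x n)" for n
    by (intro jpow_oper_comm fx oper_comm_sym[OF fx1] xx refl)
  have 3: "oper_comm (x \<odot> x) (jpow f x n)" for n
    by (intro jpow_oper_comm fx oper_comm_sym[OF fx2] oper_comm_sym[OF xx] refl)
  show ?thesis by (intro jpow_oper_comm fx oper_comm_sym[OF 1] oper_comm_sym[OF 2] oper_comm_sym[OF 3])
qed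

lemma powers_comm: assumes "a \<in> powers f x" "b \<in> powers f x" shows "oper_comm a b"
proof -
  have 1: "oper_comm (jpow f x n) b" for n
    using span_subspace_induct[OF assms(2)[unfolded powers_def] subspace_oper_comm] jpow_comm by auto
  have "oper_comm b a"
    using span_subspace_induct[OF assms(1)[unfolded powers_def] subspace_oper_comm, of b] 1 oper_comm_sym
    by auto
  then show ?thesis by (rule oper_comm_sym)
qed

lemma subspace_powers: "subspace (powers f x)" by (simp add: powers_def)

lemma jpow_in: "jpow f x n \<in> powers f x" by (simp add: powers_def span_base)

lemma f_in: "f \<in> powers f x" using jpow_in[of 0] by simp

lemma x_in: "x \<in> powers f x" using jpow_in[of 1] fx comm[of x f] by simp

lemma f_mult: "a \<in> powers f x \<Longrightarrow> f \<odot> a = a"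
proof -
  assume a: "a \<in> powers f x"
  have "f \<odot> jpow f x n = jpow f x n" for n
  proof (induction n)
    case 0 then show ?case using f by (simp add: idem_def)
  next
    case (Suc n)
    then show ?case using peirce1_comm[OF f fx, of "jpow f x n"] by simp
  qed
  then have "range (jpow f x) \<subseteq> {a. f \<odot> a = a}" by auto
  moreover have "subspace {a. f \<odot> a = a}" unfolding subspace_def by (auto simp: bilin)
  ultimately show ?thesis using a span_minimal unfolding powers_def by blast
qed

lemma x_mult_in: assumes "a \<in> powers f x" shows "x \<odot> a \<in> powers f x"
proof -
  have "range (jpow f x) \<subseteq> {a. x \<odot> a \<in> powers f x}"
    using jpow_in[of "Suc n" for n] by auto
  moreover have "subspace {a. x \<odot> a \<in> powers f x}"
    using subspace_powers unfolding subspace_def by (auto simp: bilin)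
  ultimately show ?thesis using assms span_minimal unfolding powers_def by blast
qed

text \<open>Elements of the span commute as operators, so y (x x^n) = x (y x^n) and an eigenvector
  of x in the span is an eigenvector of every power. With a = y this makes y^2 a multiple of y,
  which is how idempotents are produced.\<close>

lemma powers_eigen:
  assumes "a \<in> powers f x" "y \<in> powers f x" "x \<odot> y = l *\<^sub>R y"
  shows "\<exists>s. a \<odot> y = s *\<^sub>R y"
proof -
  have "\<exists>s. jpow f x n \<odot> y = s *\<^sub>R y" for n
  proof (induction n)
    case 0 then show ?case using f_mult[OF assms(2)] by (auto intro: exI[of _ 1])
  next
    case (Suc n)
    then obtain s where s: "jpow f x n \<odot> y = s *\<^sub>R y" by blast
    have "y \<odot> (x \<odot> jpow f x n) = x \<odot> (y \<odot> jpow f x n)"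
      using powers_comm[OF assms(2) x_in] unfolding oper_comm_def by blast
    then have "jpow f x (Suc n) \<odot> y = (s * l) *\<^sub>R y"
      using s assms(3) comm[of y "jpow f x n"] comm[of y "x \<odot> jpow f x n"] by (simp add: scale_r)
    then show ?case by blast
  qed
  then have "range (jpow f x) \<subseteq> {a. \<exists>s. a \<odot> y = s *\<^sub>R y}" by auto
  moreover have "subspace {a. \<exists>s. a \<odot> y = s *\<^sub>R y}" unfolding subspace_def
  proof (intro conjI ballI allI)
    show "0 \<in> {a. \<exists>s. a \<odot> y = s *\<^sub>R y}" by (auto intro: exI[of _ 0])
    fix a b assume "a \<in> {a. \<exists>s. a \<odot> y = s *\<^sub>R y}" "b \<in> {a. \<exists>s. a \<odot> y = s *\<^sub>R y}"
    then obtain s t where "a \<odot> y = s *\<^sub>R y" "b \<odot> y = t *\<^sub>R y" by auto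
    then have "(a + b) \<odot> y = (s + t) *\<^sub>R y" by (simp add: bilin scaleR_add_left)
    then show "a + b \<in> {a. \<exists>s. a \<odot> y = s *\<^sub>R y}" by blast
  next
    fix k a assume "a \<in> {a. \<exists>s. a \<odot> y = s *\<^sub>R y}"
    then obtain s where "a \<odot> y = s *\<^sub>R y" by auto
    then have "(k *\<^sub>R a) \<odot> y = (k * s) *\<^sub>R y" by (simp add: bilin)
    then show "k *\<^sub>R a \<in> {a. \<exists>s. a \<odot> y = s *\<^sub>R y}" by blast
  qed
  ultimately show ?thesis using assms(1) span_minimal unfolding powers_def by blast
qed

end

abbreviation comb :: "('a \<Rightarrow> real) \<Rightarrow> 'a set \<Rightarrow> 'a"
  where "comb l C \<equiv> (\<Sum>c\<in>C. l c *\<^sub>R c)"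

definition orth_idems :: "'a set \<Rightarrow> bool"
  where "orth_idems C \<longleftrightarrow> finite C \<and> 0 \<notin> C \<and> (\<forall>c\<in>C. idem c) \<and> (\<forall>c\<in>C. \<forall>d\<in>C. c \<noteq> d \<longrightarrow> c \<odot> d = 0)"

lemma orth_idemsD:
  assumes "orth_idems C"
  shows "finite C" "0 \<notin> C" "c \<in> C \<Longrightarrow> idem c" "c \<in> C \<Longrightarrow> d \<in> C \<Longrightarrow> c \<noteq> d \<Longrightarrow> c \<odot> d = 0"
  using assms by (auto simp: orth_idems_def)

lemma orth_idems_card: assumes "orth_idems C" shows "card C \<le> DIM('a)"
proof -
  have "pairwise orthogonal C"
    using assms unfolding orth_idems_def pairwise_def orthogonal_def
    by (auto intro: inner_zero_if_mult_zero)
  then have "independent C"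
    using pairwise_orthogonal_independent assms orth_idemsD by blast
  then show ?thesis using independent_bound by blast
qed

lemma orth_idems_insert:
  assumes "orth_idems C" "idem a" "a \<noteq> 0" "\<And>d. d \<in> C \<Longrightarrow> a \<odot> d = 0"
  shows "orth_idems (insert a C)" "a \<notin> C"
proof -
  show "orth_idems (insert a C)" using assms comm unfolding orth_idems_def
    by (metis (no_types, lifting) finite_insert insertE)
  show "a \<notin> C" using assms by (auto simp: idem_def)
qed

lemma orth_idems_mult_sum:
  assumes "orth_idems C" "c \<in> C"
  shows "c \<odot> (comb l C) = l c *\<^sub>R c"
proof -
  have "c \<odot> (comb l C) = (\<Sum>d\<in>C. if d = c then l c *\<^sub>R c else 0)"
    unfolding sum_r using assms orth_idemsD[OF assms(1)] 
    by (intro sum.cong) (auto simp: scale_r idem_def)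
  then show ?thesis using assms orth_idemsD(1)[OF assms(1)] by simp
qed

lemma orth_idems_mult_sum1:
  assumes "orth_idems C" "c \<in> C" shows "c \<odot> \<Sum>C = c"
  using orth_idems_mult_sum[OF assms, of "\<lambda>_. 1"] by simp

text \<open>Take a largest orthogonal family of idempotents in the span of the powers that are
  eigenvectors of x. If the remainder g of f were nonzero, x would have an eigenvector y in the part
  fixed by g, and y^2 = s y would make y / s a further member.\<close>

lemma ex_spectral_raw:
  assumes f: "idem f" and fx: "f \<odot> x = x"
  shows "\<exists>C. orth_idems C \<and> \<Sum>C = f \<and> (\<forall>c\<in>C. \<exists>l. x \<odot> c = l *\<^sub>R c)"
proof -
  let ?R = "powers f x"
  note comm_R = powers_comm[OF f fx, unfolded oper_comm_def, rule_format]
  define P where "P C \<longleftrightarrow> orth_idems C \<and> C \<subseteq> ?R \<and> (\<forall>c\<in>C. \<exists>l. x \<odot> c = l *\<^sub>R c)" for C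
  have "P {}" by (auto simp: P_def orth_idems_def)
  moreover have "card C \<le> DIM('a)" if "P C" for C using that by (simp add: P_def orth_idems_card)
  ultimately have "\<exists>C. P C \<and> (\<forall>D. P D \<longrightarrow> card D \<le> card C)"
    by (rule ex_max_card)
  then obtain C where C: "P C" and max: "\<And>D. P D \<Longrightarrow> card D \<le> card C" by blast
  have oC: "orth_idems C" and CR: "C \<subseteq> ?R" and eC: "\<And>c. c \<in> C \<Longrightarrow> \<exists>l. x \<odot> c = l *\<^sub>R c"
    using C by (auto simp: P_def)
  define g where "g = f - \<Sum>C"
  have gR: "g \<in> ?R" unfolding g_def
    by (intro subspace_diff subspace_sum subspace_powers[OF f fx] f_in[OF f fx]) (use CR in auto)
  have gc: "g \<odot> c = 0" if "c \<in> C" for c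
    using f_mult[OF f fx, of c] that CR orth_idems_mult_sum1[OF oC that]
    comm[of "\<Sum>C" c] by (auto simp: g_def diff_l)
  have gg: "g \<odot> g = g"
  proof -
    have "g \<odot> g = g \<odot> f - (\<Sum>c\<in>C. g \<odot> c)" by (subst (2) g_def) (simp add: diff_r sum_r)
    then show ?thesis using gc f_mult[OF f fx gR] comm[of g f] by simp
  qed
  have "g = 0"
  proof (rule ccontr)
    assume "g \<noteq> 0"
    define W where "W = {y \<in> ?R. g \<odot> y = y}"
    have "subspace W" using subspace_powers[OF f fx] unfolding W_def subspace_def by (auto simp: bilin)
    moreover have "g \<in> W" using gR gg by (simp add: W_def)
    moreover have "x \<odot> y \<in> W" if "y \<in> W" for y
      using that x_mult_in[OF f fx] comm_R[OF gR x_in[OF f fx], of y] by (auto simp: W_def)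
    ultimately obtain y l where y: "y \<in> W" "y \<noteq> 0" "x \<odot> y = l *\<^sub>R y"
      using self_adjoint_eigenvector[OF linear_mult, of W g x] \<open>g \<noteq> 0\<close> inner_mult' by metis
    have yR: "y \<in> ?R" and gy: "g \<odot> y = y" using y by (auto simp: W_def)
    obtain s where s: "y \<odot> y = s *\<^sub>R y" using powers_eigen[OF f fx yR yR y(3)] by blast
    \<comment> \<open>The pairing of y^2 with e is the squared norm of y.\<close>
    have "s \<noteq> 0" using inner_mult_e(1)[of y y] y(2) s by auto
    define c where "c = (1/s) *\<^sub>R y"
    have c: "idem c" using s \<open>s \<noteq> 0\<close> by (simp add: c_def idem_def bilin)
    have c0: "c \<noteq> 0" using y \<open>s \<noteq> 0\<close> by (simp add: c_def)
    have cR: "c \<in> ?R" unfolding c_def by (intro subspace_scale subspace_powers[OF f fx] yR)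
    have gc': "g \<odot> c = c" using gy by (simp add: c_def bilin)
    have cd: "c \<odot> d = 0" if "d \<in> C" for d
    proof -
      have dR: "d \<in> ?R" using that CR by blast
      have "g \<odot> (c \<odot> d) = 0" using comm_R[OF gR cR, of d] gc[OF that] by simp
      moreover have "g \<odot> (d \<odot> c) = d \<odot> c" using comm_R[OF gR dR, of c] gc' by simp
      ultimately show ?thesis by (simp add: comm)
    qed
    have "P (insert c C)"
      using orth_idems_insert[OF oC c c0 cd] C cR y(3) unfolding P_def
      by (auto simp: c_def bilin scaleR_left_commute)
    then have "card (insert c C) \<le> card C" by (rule max)
    then show False using orth_idems_insert(2)[OF oC c c0 cd] orth_idemsD(1)[OF oC] by simp
  qed
  then show ?thesis using oC eC by (auto simp: g_def)
qed

abbreviation prim :: "'a \<Rightarrow> bool" where "prim \<equiv> primitive_idempotent m"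

lemma prim_idem: "prim c \<Longrightarrow> idem c" and prim_nz: "prim c \<Longrightarrow> c \<noteq> 0"
  by (auto simp: primitive_idempotent_def idem_def)

text \<open>Among the families of idempotent eigenvectors with sum f a largest one consists of
  primitives: if a member split as a + b, the two parts could replace it, because they stay
  orthogonal to the other members and inherit the eigenvalue.\<close>

lemma ex_spectral:
  assumes f: "idem f" and fx: "f \<odot> x = x"
  shows "\<exists>C l. orth_idems C \<and> (\<forall>c\<in>C. prim c) \<and> \<Sum>C = f \<and> x = comb l C"
proof -
  define P where "P C \<longleftrightarrow> orth_idems C \<and> \<Sum>C = f \<and> (\<forall>c\<in>C. \<exists>l. x \<odot> c = l *\<^sub>R c)" for C
  obtain C0 where "P C0" using ex_spectral_raw[OF assms] by (auto simp: P_def)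
  moreover have "card C \<le> DIM('a)" if "P C" for C using that by (simp add: P_def orth_idems_card)
  ultimately have "\<exists>C. P C \<and> (\<forall>D. P D \<longrightarrow> card D \<le> card C)"
    by (rule ex_max_card)
  then obtain C where C: "P C" and max: "\<And>D. P D \<Longrightarrow> card D \<le> card C" by blast
  have oC: "orth_idems C" and sC: "\<Sum>C = f" using C by (auto simp: P_def)
  obtain l where l: "\<And>c. c \<in> C \<Longrightarrow> x \<odot> c = l c *\<^sub>R c" using C unfolding P_def by metis
  have x: "x = comb l C"
  proof -
    have "x = x \<odot> \<Sum>C" using fx sC comm by simp
    then show ?thesis using l by (simp add: sum_r)
  qed
  have "prim c" if c: "c \<in> C" for c
  proof (rule ccontr)
    assume "\<not> prim c"
    moreover have ic: "idem c" and "c \<noteq> 0" using orth_idemsD[OF oC] c by auto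
    ultimately obtain a b where ab: "a \<noteq> 0" "idem a" "b \<noteq> 0" "idem b" "c = a + b"
      by (auto simp: primitive_idempotent_def idem_def)
    \<comment> \<open>The square of a + b is a + b + 2 a b, and it equals a + b.\<close>
    have "2 *\<^sub>R (a \<odot> b) = 0"
      using ic ab comm[of b a] by (simp add: idem_def bilin scaleR_2 algebra_simps)
    then have ab0: "a \<odot> b = 0" by simp
    have d: "a \<odot> d = 0 \<and> b \<odot> d = 0" if "d \<in> C" "d \<noteq> c" for d
    proof -
      have di: "idem d" and "inner c d = 0"
        using that c orth_idemsD[OF oC] by (auto intro: inner_zero_if_mult_zero)
      \<comment> \<open>Two nonnegative pairings with sum 0 vanish separately, and for idempotents
        orthogonality gives product 0.\<close>
      then have "inner a d + inner b d = 0" using ab by (simp add: inner_add_left)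
      moreover have "inner a d \<ge> 0" "inner b d \<ge> 0" using idem_inner_nonneg di ab by auto
      ultimately have "inner a d = 0" "inner b d = 0" by auto
      then show ?thesis using idem_orth di ab by blast
    qed
    define D where "D = insert a (insert b (C - {c}))"
    have o1: "orth_idems (C - {c})" using oC by (auto simp: orth_idems_def)
    note o2 = orth_idems_insert[OF o1 ab(4,3)]
    have o2': "orth_idems (insert b (C - {c}))" "b \<notin> C - {c}" using o2 d by auto
    note o3 = orth_idems_insert[OF o2'(1) ab(2,1)]
    have o3': "orth_idems D" "a \<notin> insert b (C - {c})" using o3 d ab0 unfolding D_def by auto
    have fin: "finite C" using orth_idemsD[OF oC] by blast
    have "\<Sum>D = a + (b + \<Sum>(C - {c}))" unfolding D_def using fin o2'(2) o3'(2) by simp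
    also have "\<dots> = \<Sum>C" using fin c ab(5) by (simp add: sum_diff1)
    finally have sD: "\<Sum>D = f" using sC by simp
    have ca: "c \<odot> a = a" "c \<odot> b = b" using ab ab0 comm[of b a] by (auto simp: bilin idem_def)
    have eig: "x \<odot> a' = l c *\<^sub>R a'" if "c \<odot> a' = a'" "\<And>d. d \<in> C \<Longrightarrow> d \<noteq> c \<Longrightarrow> a' \<odot> d = 0" for a'
    proof -
      have 0: "d \<odot> a' = 0" if "d \<in> C" "d \<noteq> c" for d
        using that \<open>\<And>d. d \<in> C \<Longrightarrow> d \<noteq> c \<Longrightarrow> a' \<odot> d = 0\<close>[of d] comm[of d a'] by simp
      have "x \<odot> a' = (\<Sum>d\<in>C. if d = c then l c *\<^sub>R a' else 0)"
        unfolding x sum_l using that(1) 0 by (intro sum.cong) (auto simp: scale_l)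
      then show ?thesis using c fin by simp
    qed
    have "\<exists>l. x \<odot> d = l *\<^sub>R d" if "d \<in> D" for d
      using that eig[OF ca(1)] eig[OF ca(2)] d l unfolding D_def by auto
    then have "P D" using o3' sD by (simp add: P_def)
    then have "card D \<le> card C" by (rule max)
    moreover have "card D = card C + 1"
      unfolding D_def using fin o2'(2) o3'(2) c by (simp add: card_Diff_singleton Suc_diff_le card_gt_0_iff)
         (metis Suc_pred card_gt_0_iff empty_iff)
    ultimately show False by simp
  qed
  then show ?thesis using oC sC x by blast
qed

text \<open>For each member d of an orthogonal family with sum c the difference c - d is an
  idempotent, so primitivity reduces the family to {c}, and the spectral theorem started at c leaves
  only multiples of c.\<close>

lemma prim_peirce1:
  assumes c: "prim c" and y: "c \<odot> y = y"
  shows "\<exists>l. y = l *\<^sub>R c"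
proof -
  note ic = prim_idem[OF c]
  obtain C l where C: "orth_idems C" "\<Sum>C = c" and yl: "y = comb l C"
    using ex_spectral[OF ic y] by blast
  have "C \<noteq> {}" using C prim_nz[OF c] by auto
  then obtain d where d: "d \<in> C" by blast
  note dd = orth_idemsD[OF C(1)]
  have di: "d \<odot> d = d" "d \<noteq> 0" using dd d by (auto simp: idem_def)
  have dc: "d \<odot> c = d" using orth_idems_mult_sum1[OF C(1) d] C(2) by simp
  then have "(c - d) \<odot> (c - d) = c - d"
    using ic di comm[of c d] by (simp add: bilin idem_def)
  then have "c - d = 0"
    using c di unfolding primitive_idempotent_def by (metis add_diff_cancel diff_add_cancel add.commute)
  then have cd: "c = d" by simp
  have "C = {d}"
  proof -
    have "d' = d" if "d' \<in> C" for d'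
    proof (rule ccontr)
      assume "d' \<noteq> d"
      then have "d' \<odot> d = 0" using dd(4) that d by blast
      moreover have "d' \<odot> c = d'" using orth_idems_mult_sum1[OF C(1) that] C(2) by simp
      ultimately show False using cd dd(2) that by simp
    qed
    then show ?thesis using d by blast
  qed
  then show ?thesis using yl cd by auto
qed

lemma idem_quad_prim:
  assumes "prim c" shows "\<exists>k. 2 *\<^sub>R (c \<odot> (c \<odot> z)) - c \<odot> z = k *\<^sub>R c"
  by (rule prim_peirce1[OF assms idem_quad_in_peirce1[OF prim_idem[OF assms]]])

section \<open>The quadratic representation and its values at primitive idempotents\<close>

abbreviation quad :: "'a \<Rightarrow> 'a \<Rightarrow> 'a" where "quad \<equiv> quadratic_rep m"

lemma quad_eq: "quad x y = 2 *\<^sub>R (x \<odot> (x \<odot> y)) - (x \<odot> x) \<odot> y"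
  by (simp add: quadratic_rep_def)

lemma linear_quad: "linear (quad x)"
  by (rule linearI) (simp_all add: quad_eq bilin scaleR_diff_right scaleR_add_right algebra_simps)

lemmas quad_add = linear_add[OF linear_quad]
lemmas quad_diff = linear_diff[OF linear_quad]
lemmas quad_scale = linear_scale[OF linear_quad]
lemmas quad_sum = linear_sum[OF linear_quad]

lemma quad_scale_left: "quad (k *\<^sub>R x) y = k\<^sup>2 *\<^sub>R quad x y"
  by (simp add: quad_eq bilin scaleR_diff_right power2_eq_square mult_ac)

lemma quad_e: "quad x e = x \<odot> x"
  by (simp add: quad_eq scaleR_2)

lemma quad_e_left [simp]: "quad e x = x"
  by (simp add: quad_eq scaleR_2)

lemma inner_quad: "inner (quad x y) z = inner y (quad x z)"
  by (simp add: quad_eq inner_diff_left inner_diff_right inner_mult')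

text \<open>With \<open>w = l c + b + d\<close> split into its Peirce components, \<open>P(w) c = l\<^sup>2 c + l b + v\<close>, where \<open>v\<close> is
  the component of \<open>b\<^sup>2\<close> in the Peirce space of \<open>c\<close> for the eigenvalue 0. The Jordan identity gives
  \<open>b\<^sup>3 = \<beta> b\<close>, which makes this element a multiple of its own square.\<close>

lemma quad_prim:
  assumes c: "prim c"
  shows "\<exists>k c'. k \<ge> 0 \<and> idem c' \<and> quad w c = k *\<^sub>R c' \<and> (k > 0 \<longrightarrow> inner c' e = inner c e)"
proof -
  note ic = prim_idem[OF c]
  have cc [simp]: "c \<odot> c = c" using ic by (simp add: idem_def)
  obtain l where l: "2 *\<^sub>R (c \<odot> (c \<odot> w)) - c \<odot> w = l *\<^sub>R c"
    using idem_quad_prim[OF c] by blast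
  \<comment> \<open>At the Peirce eigenvalues 0, 1/2, 1 the polynomials 4 (t - t^2) and 1 - 3 t + 2
    t^2 select 1/2 and 0 respectively.\<close>
  define b where "b = 4 *\<^sub>R (c \<odot> w - c \<odot> (c \<odot> w))"
  define d where "d = w - 3 *\<^sub>R (c \<odot> w) + 2 *\<^sub>R (c \<odot> (c \<odot> w))"
  have cb [simp]: "c \<odot> b = (1/2) *\<^sub>R b"
    by (rule euclidean_eqI) (simp add: b_def bilin idem_cubic[OF ic] inner_diff_left inner_add_left)
  have cd [simp]: "c \<odot> d = 0"
    by (rule euclidean_eqI) (simp add: d_def bilin idem_cubic[OF ic] inner_diff_left inner_add_left)
  have w: "w = l *\<^sub>R c + b + d"
    unfolding l[symmetric]
    by (rule euclidean_eqI) (simp add: b_def d_def inner_diff_left inner_add_left)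
  have [simp]: "b \<odot> c = (1/2) *\<^sub>R b" "d \<odot> c = 0" "d \<odot> b = b \<odot> d"
    using comm[of b c] comm[of d c] comm[of d b] by simp_all
  obtain \<beta> where "c \<odot> (b \<odot> b) = \<beta> *\<^sub>R c"
    using prim_peirce1[OF c peirce_hh[OF ic cb cb]] by blast
  then have cbb [simp]: "c \<odot> (b \<odot> b) = \<beta> *\<^sub>R c" "(b \<odot> b) \<odot> c = \<beta> *\<^sub>R c"
    using comm[of c "b \<odot> b"] by simp_all
  have [simp]: "(b \<odot> d) \<odot> c = (1/2) *\<^sub>R (b \<odot> d)"
    using peirce0_comm[OF ic cd, of b] comm[of "b \<odot> d" c] by (simp add: bilin)
  have [simp]: "(d \<odot> d) \<odot> c = 0"
    using peirce0_comm[OF ic cd, of d] comm[of "d \<odot> d" c] by simp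
  \<comment> \<open>The Jordan identity of b applied to c, where b c = b / 2 and b^2 c = \<beta>
    c.\<close>
  have b3: "(b \<odot> b) \<odot> b = \<beta> *\<^sub>R b"
  proof -
    have "(1/2) *\<^sub>R (\<beta> *\<^sub>R b) = (1/2) *\<^sub>R ((b \<odot> b) \<odot> b)"
      using jordan_id[of b c] by (simp add: bilin)
    from arg_cong[OF this, of "\<lambda>v. 2 *\<^sub>R v"] show ?thesis by simp
  qed
  then have b3' [simp]: "b \<odot> (b \<odot> b) = \<beta> *\<^sub>R b" using comm[of b "b \<odot> b"] by simp
  have b4 [simp]: "(b \<odot> b) \<odot> (b \<odot> b) = \<beta> *\<^sub>R (b \<odot> b)"
    using jordan_id[of b b] b3 by (simp add: bilin)
  have nb: "inner (b \<odot> b) c = inner b b / 2"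
    using inner_mult'[of b b c] by simp
  have nc: "inner c c = inner c e" using idem_norm[OF ic] by simp
  have pos: "inner c e > 0" using nc prim_nz[OF c] by (metis inner_gt_zero_iff)
  have \<beta>c: "\<beta> * inner c e = inner b b / 2"
  proof -
    have "inner (b \<odot> b) c = inner ((b \<odot> b) \<odot> c) e" by (simp only: inner_mult_e)
    then show ?thesis using nb by simp
  qed
  have \<beta>: "\<beta> \<ge> 0"
  proof -
    have "0 \<le> \<beta> * inner c e" unfolding \<beta>c by simp
    then show ?thesis using pos by (simp add: zero_le_mult_iff)
  qed
  have be: "inner b e = 0"
  proof -
    have "inner b c = inner b c / 2"
      using inner_mult'[of c b c] by (simp add: inner_commute)
    then have "inner b c = 0" by simp
    moreover have "inner b c = inner b e / 2" using inner_mult_e(1)[of b c] by simp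
    ultimately show ?thesis by simp
  qed
  define v where "v = b \<odot> b - \<beta> *\<^sub>R c"
  define y where "y = l\<^sup>2 *\<^sub>R c + l *\<^sub>R b + v"
  have qy: "quad w c = y"
    unfolding quad_eq y_def v_def w
    by (rule euclidean_eqI) (simp add: bilin inner_add_left inner_diff_left power2_eq_square algebra_simps)
  define k where "k = l\<^sup>2 + \<beta>"
  have k: "k \<ge> 0" using \<beta> by (simp add: k_def)
  have yy: "y \<odot> y = k *\<^sub>R y"
    unfolding y_def v_def k_def
    by (rule euclidean_eqI)
       (simp add: bilin b3 inner_add_left inner_diff_left power2_eq_square algebra_simps)
  have ye: "inner y e = k * inner c e"
  proof -
    have "inner (b \<odot> b) e = 2 * (\<beta> * inner c e)" unfolding \<beta>c by (simp add: inner_mult_e)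
    then show ?thesis by (simp add: y_def v_def k_def inner_add_left inner_diff_left be algebra_simps)
  qed
  show ?thesis
  proof (cases "k = 0")
    case True
    then have "inner y y = 0" using yy inner_mult_e(1)[of y y] by simp
    then have "quad w c = 0 *\<^sub>R c" using qy by simp
    then show ?thesis using ic by blast
  next
    case False
    define c' where "c' = (1/k) *\<^sub>R y"
    have "idem c'" using yy False by (simp add: c'_def idem_def bilin)
    moreover have "quad w c = k *\<^sub>R c'" using qy False by (simp add: c'_def)
    moreover have "inner c' e = inner c e" using ye False by (simp add: c'_def)
    ultimately show ?thesis using k by blast
  qed
qed

section \<open>Frames: orthogonal idempotents with sum e, not necessarily primitive\<close>

definition frame :: "'a set \<Rightarrow> bool" where "frame C \<longleftrightarrow> orth_idems C \<and> \<Sum>C = e"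

lemma frame_orth: "frame C \<Longrightarrow> orth_idems C" by (simp add: frame_def)
lemma frame_fin: "frame C \<Longrightarrow> finite C" using frame_orth orth_idemsD by blast
lemma frame_idem: "frame C \<Longrightarrow> c \<in> C \<Longrightarrow> idem c" using frame_orth orth_idemsD by blast
lemma frame_orth0: "frame C \<Longrightarrow> c \<in> C \<Longrightarrow> d \<in> C \<Longrightarrow> c \<noteq> d \<Longrightarrow> c \<odot> d = 0"
  using frame_orth orth_idemsD by blast
lemma frame_sum: "frame C \<Longrightarrow> \<Sum>C = e" by (simp add: frame_def)

lemma frame_eigen: "frame C \<Longrightarrow> c \<in> C \<Longrightarrow> (comb l C) \<odot> c = l c *\<^sub>R c"
  using orth_idems_mult_sum[of C c l] comm[of c] by (simp add: frame_orth)

lemma frame_mult: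
  assumes "frame C"
  shows "(comb l C) \<odot> (comb k C) = (\<Sum>c\<in>C. (l c * k c) *\<^sub>R c)"
proof -
  have "(comb l C) \<odot> (comb k C) = (\<Sum>c\<in>C. l c *\<^sub>R (c \<odot> (comb k C)))"
    by (simp add: sum_l scale_l)
  also have "\<dots> = (\<Sum>c\<in>C. (l c * k c) *\<^sub>R c)"
    using assms by (intro sum.cong) (simp_all add: orth_idems_mult_sum frame_orth)
  finally show ?thesis .
qed

lemma frame_inner:
  assumes "frame C" "c \<in> C" shows "inner (comb l C) c = l c * inner c e"
proof -
  have "inner (comb l C) c = inner ((comb l C) \<odot> c) e" by (simp add: inner_mult_e)
  then show ?thesis using frame_eigen[OF assms] by simp
qed

lemma complete_system_iff: "complete_system m e C \<longleftrightarrow> frame C \<and> (\<forall>c\<in>C. prim c)"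
  unfolding complete_system_def frame_def orth_idems_def idem_def
  using prim_nz by (auto simp: primitive_idempotent_def)

abbreviation "spectral \<equiv> spectral_decomposition m e"

lemma spectral_iff:
  "spectral x C l \<longleftrightarrow> frame C \<and> (\<forall>c\<in>C. prim c) \<and> x = comb l C"
  by (auto simp: spectral_decomposition_def complete_system_iff)

lemma spectralD:
  assumes "spectral x C l"
  shows "frame C" "c \<in> C \<Longrightarrow> prim c" "x = comb l C"
  using assms by (auto simp: spectral_iff)

lemma ex_frame: "\<exists>C l. spectral x C l"
  using ex_spectral[of e x] unfolding spectral_iff frame_def idem_def by auto

section \<open>Peirce decomposition with respect to a frame\<close>

text \<open>For c different from d this is half of the projection onto the joint Peirce space, since
  (c, d) and (d, c) both occur in the double sums below. For c = d it is the full projection for the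
  eigenvalue 1.\<close>

definition peirce :: "'a \<Rightarrow> 'a \<Rightarrow> 'a \<Rightarrow> 'a"
  where "peirce c d z = 2 *\<^sub>R (c \<odot> (d \<odot> z)) - (if c = d then c \<odot> z else 0)"

lemma peirce_sum:
  assumes "frame C" shows "(\<Sum>c\<in>C. \<Sum>d\<in>C. peirce c d z) = z"
proof -
  have "(\<Sum>c\<in>C. \<Sum>d\<in>C. peirce c d z) = (\<Sum>c\<in>C. 2 *\<^sub>R (c \<odot> (\<Sum>C \<odot> z)) - c \<odot> z)"
    unfolding peirce_def using frame_fin[OF assms]
    by (intro sum.cong refl) (simp add: sum_subtractf sum_l sum_r scaleR_sum_right)
  also have "\<dots> = 2 *\<^sub>R (\<Sum>C \<odot> (\<Sum>C \<odot> z)) - \<Sum>C \<odot> z"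
    by (simp add: sum_subtractf sum_l scaleR_sum_right)
  also have "\<dots> = z" using frame_sum[OF assms] by (simp add: scaleR_2)
  finally show ?thesis .
qed

lemma peirce_mult:
  assumes C: "frame C" and c: "c \<in> C" and d: "d \<in> C" and a: "a \<in> C"
  shows "a \<odot> peirce c d z = (((if a = c then 1 else 0) + (if a = d then 1 else 0)) / 2) *\<^sub>R peirce c d z"
proof (cases "c = d")
  case True
  have p: "peirce c d z = 2 *\<^sub>R (c \<odot> (c \<odot> z)) - c \<odot> z" using True by (simp add: peirce_def)
  have ic: "idem c" using frame_idem[OF C c] .
  show ?thesis
  proof (cases "a = c")
    case True
    then show ?thesis using idem_quad_in_peirce1[OF ic] \<open>c = d\<close> p by simp
  next
    case False
    then have "c \<odot> a = 0" using frame_orth0[OF C c a] by blast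
    then have "(2 *\<^sub>R (c \<odot> (c \<odot> z)) - c \<odot> z) \<odot> a = 0"
      by (rule peirce_10[OF ic idem_quad_in_peirce1[OF ic]])
    then show ?thesis using False \<open>c = d\<close> p comm[of a "peirce c d z"] by simp
  qed
next
  case False
  define y where "y = c \<odot> (d \<odot> z)"
  have p: "peirce c d z = 2 *\<^sub>R y" using False by (simp add: peirce_def y_def)
  have ic: "idem c" and id: "idem d" using frame_idem[OF C] c d by blast+
  have cd: "c \<odot> d = 0" using frame_orth0[OF C c d False] .
  then have dc: "d \<odot> c = 0" using comm[of c d] by simp
  have y': "y = d \<odot> (c \<odot> z)" using orth_idem_comm[OF ic cd] by (simp add: y_def)
  have dy: "d \<odot> y = (1/2) *\<^sub>R y" using orth_idem_half[OF ic id cd] by (simp add: y_def)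
  have cy: "c \<odot> y = (1/2) *\<^sub>R y" using orth_idem_half[OF id ic dc] by (simp add: y')
  consider "a = c" | "a = d" | "a \<noteq> c" "a \<noteq> d" by blast
  then show ?thesis
  proof cases
    case 3
    \<comment> \<open>A third member of the frame is orthogonal to the idempotent c + d, which fixes
      y.\<close>
    have "c \<odot> a = 0" "d \<odot> a = 0" using frame_orth0[OF C] a c d 3 by blast+
    then have t: "(c + d) \<odot> a = 0" by (simp add: bilin)
    have s: "(c + d) \<odot> y = y"
      unfolding add_l cy dy scaleR_add_left[symmetric] by simp
    have "y \<odot> a = 0" by (rule peirce_10[OF orth_idem_add[OF ic id cd] s t])
    then show ?thesis using 3 comm[of a y] by (simp add: p bilin)
  qed (use cy dy False in \<open>simp_all add: p bilin\<close>)
qed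

lemma frame_peirce:
  assumes C: "frame C" and c: "c \<in> C" and d: "d \<in> C"
  shows "(comb l C) \<odot> peirce c d z = ((l c + l d) / 2) *\<^sub>R peirce c d z"
proof -
  have "(comb l C) \<odot> peirce c d z
      = (\<Sum>a\<in>C. (l a * (((if a = c then 1 else 0) + (if a = d then 1 else 0)) / 2)) *\<^sub>R peirce c d z)"
    unfolding sum_l scale_l by (intro sum.cong refl) (simp add: peirce_mult[OF C c d])
  also have "\<dots> = (\<Sum>a\<in>C. (if a = c then l a / 2 else 0) + (if a = d then l a / 2 else 0)) *\<^sub>R peirce c d z"
    unfolding scaleR_sum_left by (intro sum.cong refl arg_cong2[where f=scaleR]) auto
  also have "(\<Sum>a\<in>C. (if a = c then l a / 2 else 0) + (if a = d then l a / 2 else 0)) = (l c + l d) / 2"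
    using frame_fin[OF C] c d by (simp add: sum.distrib add_divide_distrib)
  finally show ?thesis .
qed

lemma quad_peirce:
  assumes C: "frame C" and c: "c \<in> C" and d: "d \<in> C"
  shows "quad (comb l C) (peirce c d z) = (l c * l d) *\<^sub>R peirce c d z"
proof -
  have "quad (comb l C) (peirce c d z)
     = (2 * ((l c + l d) / 2 * ((l c + l d) / 2)) - (l c * l c + l d * l d) / 2) *\<^sub>R peirce c d z"
    unfolding quad_eq frame_mult[OF C] frame_peirce[OF assms] scale_r
    by (simp add: scaleR_diff_left)
  also have "2 * ((l c + l d) / 2 * ((l c + l d) / 2)) - (l c * l c + l d * l d) / 2 = l c * l d"
    by (simp add: field_simps)
  finally show ?thesis .
qed

lemma quad_frame:
  assumes C: "frame C"
  shows "quad (comb l C) z = (\<Sum>c\<in>C. \<Sum>d\<in>C. (l c * l d) *\<^sub>R peirce c d z)"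
proof -
  have "quad (comb l C) z = quad (comb l C) (\<Sum>c\<in>C. \<Sum>d\<in>C. peirce c d z)"
    using peirce_sum[OF C] by simp
  also have "\<dots> = (\<Sum>c\<in>C. \<Sum>d\<in>C. (l c * l d) *\<^sub>R peirce c d z)"
    unfolding quad_sum by (intro sum.cong refl) (simp add: quad_peirce[OF C])
  finally show ?thesis .
qed

text \<open>Both operators are diagonal in the Peirce components of the common frame, and the
  eigenvalues multiply.\<close>

lemma quad_frame_comp:
  assumes C: "frame C"
  shows "quad (comb l C) (quad (comb k C) z) = quad (\<Sum>a\<in>C. (l a * k a) *\<^sub>R a) z"
  unfolding quad_frame[OF C, of k] quad_frame[OF C, of "\<lambda>a. l a * k a"] quad_sum quad_scale
  by (intro sum.cong refl) (simp add: quad_peirce[OF C] mult_ac)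

section \<open>Functional calculus\<close>

definition fc :: "(real \<Rightarrow> real) \<Rightarrow> 'a \<Rightarrow> 'a"
  where "fc \<phi> x = (THE y. \<exists>C l. frame C \<and> x = comb l C \<and> y = (\<Sum>c\<in>C. \<phi> (l c) *\<^sub>R c))"

text \<open>Idempotents of two frames belonging to different eigenvalues of \<open>x\<close> are orthogonal, since
  multiplication by \<open>x\<close> is self-adjoint.\<close>

lemma fc_unique:
  assumes C: "frame C" and D: "frame D"
    and eq: "(comb l C) = comb k D"
  shows "(\<Sum>c\<in>C. \<phi> (l c) *\<^sub>R c) = (\<Sum>d\<in>D. \<phi> (k d) *\<^sub>R d)"
proof -
  have zero: "c \<odot> d = 0" if "c \<in> C" "d \<in> D" "l c \<noteq> k d" for c d
  proof -
    let ?x = "comb l C"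
    have "?x \<odot> c = l c *\<^sub>R c" "?x \<odot> d = k d *\<^sub>R d"
      using frame_eigen[OF C that(1), of l] frame_eigen[OF D that(2), of k] eq by simp_all
    then have "l c * inner c d = k d * inner c d"
      using inner_mult'[of ?x c d] by simp
    then have "inner c d = 0" using that by simp
    then show ?thesis using idem_orth frame_idem C D that by blast
  qed
  have "(\<Sum>c\<in>C. \<phi> (l c) *\<^sub>R c) = (\<Sum>c\<in>C. \<phi> (l c) *\<^sub>R (c \<odot> \<Sum>D))"
    using frame_sum[OF D] by simp
  also have "\<dots> = (\<Sum>c\<in>C. \<Sum>d\<in>D. \<phi> (l c) *\<^sub>R (c \<odot> d))"
    by (simp add: sum_r scaleR_sum_right)
  also have "\<dots> = (\<Sum>c\<in>C. \<Sum>d\<in>D. \<phi> (k d) *\<^sub>R (c \<odot> d))"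
  proof (intro sum.cong refl)
    fix c d assume "c \<in> C" "d \<in> D"
    then show "\<phi> (l c) *\<^sub>R (c \<odot> d) = \<phi> (k d) *\<^sub>R (c \<odot> d)"
      using zero[of c d] by (cases "l c = k d") auto
  qed
  also have "\<dots> = (\<Sum>d\<in>D. \<phi> (k d) *\<^sub>R (\<Sum>C \<odot> d))"
    by (subst sum.swap) (simp add: sum_l scaleR_sum_right)
  also have "\<dots> = (\<Sum>d\<in>D. \<phi> (k d) *\<^sub>R d)"
    using frame_sum[OF C] by simp
  finally show ?thesis .
qed

lemma fc_eq:
  assumes "frame C" shows "fc \<phi> (comb l C) = (\<Sum>c\<in>C. \<phi> (l c) *\<^sub>R c)"
  unfolding fc_def
proof (rule the_equality)
  show "\<exists>C' l'. frame C' \<and> (comb l C) = (\<Sum>c\<in>C'. l' c *\<^sub>R c)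
      \<and> (\<Sum>c\<in>C. \<phi> (l c) *\<^sub>R c) = (\<Sum>c\<in>C'. \<phi> (l' c) *\<^sub>R c)"
    using assms by blast
next
  fix y assume "\<exists>C' l'. frame C' \<and> (comb l C) = (\<Sum>c\<in>C'. l' c *\<^sub>R c)
      \<and> y = (\<Sum>c\<in>C'. \<phi> (l' c) *\<^sub>R c)"
  then obtain C' l' where "frame C'" "(comb l C) = (\<Sum>c\<in>C'. l' c *\<^sub>R c)"
    "y = (\<Sum>c\<in>C'. \<phi> (l' c) *\<^sub>R c)" by blast
  then show "y = (\<Sum>c\<in>C. \<phi> (l c) *\<^sub>R c)" using fc_unique[OF assms, of C' l l' \<phi>] by simp
qed

lemma fc_mult: "fc \<phi> x \<odot> fc \<psi> x = fc (\<lambda>t. \<phi> t * \<psi> t) x"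
proof -
  obtain C l where "spectral x C l" using ex_frame by blast
  note C = spectralD(1,3)[OF this]
  show ?thesis unfolding C(2) fc_eq[OF C(1)] frame_mult[OF C(1)] ..
qed

lemma fc_fc: "fc \<phi> (fc \<psi> x) = fc (\<lambda>t. \<phi> (\<psi> t)) x"
proof -
  obtain C l where "spectral x C l" using ex_frame by blast
  note C = spectralD(1,3)[OF this]
  show ?thesis unfolding C(2) fc_eq[OF C(1)] fc_eq[OF C(1), of _ "\<lambda>c. \<psi> (l c)"] ..
qed

lemma fc_cong:
  assumes "\<And>t. \<phi> t = \<psi> t" shows "fc \<phi> x = fc \<psi> x"
  using assms by (simp add: fc_def)

lemma fc_id: "fc (\<lambda>t. t) x = x"
proof -
  obtain C l where "spectral x C l" using ex_frame by blast
  note C = spectralD(1,3)[OF this]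
  show ?thesis unfolding C(2) fc_eq[OF C(1)] ..
qed

lemma fc_const: "fc (\<lambda>t. r) x = r *\<^sub>R e"
proof -
  obtain C l where "spectral x C l" using ex_frame by blast
  note C = spectralD(1,3)[OF this]
  show ?thesis unfolding C(2) fc_eq[OF C(1)] scaleR_sum_right[symmetric] frame_sum[OF C(1)] ..
qed

lemma fc_scale: "r *\<^sub>R fc \<phi> x = fc (\<lambda>t. r * \<phi> t) x"
proof -
  obtain C l where "spectral x C l" using ex_frame by blast
  note C = spectralD(1,3)[OF this]
  show ?thesis unfolding C(2) fc_eq[OF C(1)] by (simp add: scaleR_sum_right)
qed

lemma fc_of_scale: "fc \<phi> (r *\<^sub>R x) = fc (\<lambda>t. \<phi> (r * t)) x"
  using fc_fc[of \<phi> "\<lambda>t. r * t" x] fc_scale[of r "\<lambda>t. t" x] by (simp add: fc_id)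

lemma quad_fc: "quad (fc \<phi> x) (fc \<psi> x) = fc (\<lambda>t. (\<phi> t)\<^sup>2 * \<psi> t) x"
proof -
  have "quad (fc \<phi> x) (fc \<psi> x) = 2 *\<^sub>R fc (\<lambda>t. (\<phi> t)\<^sup>2 * \<psi> t) x - fc (\<lambda>t. (\<phi> t)\<^sup>2 * \<psi> t) x"
    unfolding quad_eq fc_mult by (simp add: power2_eq_square mult_ac)
  then show ?thesis by (simp add: scaleR_2)
qed

lemma quad_fc_comp: "quad (fc \<phi> x) (quad (fc \<psi> x) z) = quad (fc (\<lambda>t. \<phi> t * \<psi> t) x) z"
proof -
  obtain C l where "spectral x C l" using ex_frame by blast
  note C = spectralD(1,3)[OF this]
  show ?thesis unfolding C(2) fc_eq[OF C(1)] quad_frame_comp[OF C(1)] ..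
qed

text \<open>The numbers \<open>inner c d\<close> are nonnegative weights whose sum over d is
  \<open>inner c e\<close>. They allow two elements to be compared eigenvalue by eigenvalue although
  their frames are unrelated, so Lipschitz bounds of scalar functions carry over to the functional
  calculus.\<close>

lemma frame_dist:
  assumes C: "frame C" and D: "frame D"
  shows "(norm ((comb l C) - (comb k D)))\<^sup>2
    = (\<Sum>c\<in>C. \<Sum>d\<in>D. (l c - k d)\<^sup>2 * inner c d)"
proof -
  let ?x = "comb l C" and ?y = "comb k D"
  have sq: "inner (comb l C) (comb l C) = (\<Sum>c\<in>C. (l c)\<^sup>2 * inner c e)"
    if "frame C" for C l
  proof -
    have "inner (comb l C) (comb l C) = inner (\<Sum>c\<in>C. (l c * l c) *\<^sub>R c) e"
      unfolding frame_mult[OF that, symmetric] inner_mult_e ..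
    then show ?thesis by (simp add: inner_sum_left power2_eq_square)
  qed
  have xx: "inner ?x ?x = (\<Sum>c\<in>C. \<Sum>d\<in>D. (l c)\<^sup>2 * inner c d)"
    unfolding sq[OF C] frame_sum[OF D, symmetric] by (simp add: inner_sum_right sum_distrib_left)
  have yy: "inner ?y ?y = (\<Sum>c\<in>C. \<Sum>d\<in>D. (k d)\<^sup>2 * inner c d)"
    unfolding sq[OF D] frame_sum[OF C, symmetric]
    by (subst sum.swap) (simp add: inner_sum_right sum_distrib_left inner_commute)
  have xy: "inner ?x ?y = (\<Sum>c\<in>C. \<Sum>d\<in>D. l c * k d * inner c d)"
    by (simp add: inner_sum_right inner_sum_left sum_distrib_left mult_ac) (subst sum.swap, simp)
  have "(norm (?x - ?y))\<^sup>2 = inner ?x ?x - 2 * inner ?x ?y + inner ?y ?y"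
    by (simp add: power2_norm_eq_inner inner_diff_left inner_diff_right inner_commute)
  also have "\<dots> = (\<Sum>c\<in>C. \<Sum>d\<in>D. (l c)\<^sup>2 * inner c d - 2 * (l c * k d * inner c d) + (k d)\<^sup>2 * inner c d)"
    unfolding xx yy xy by (simp add: sum.distrib sum_subtractf sum_distrib_left)
  also have "\<dots> = (\<Sum>c\<in>C. \<Sum>d\<in>D. (l c - k d)\<^sup>2 * inner c d)"
    by (intro sum.cong refl) (simp add: power2_eq_square algebra_simps)
  finally show ?thesis .
qed

lemma frame_lipschitz:
  assumes C: "frame C" and D: "frame D" and K: "K \<ge> 0"
    and lip: "\<And>c d. c \<in> C \<Longrightarrow> d \<in> D \<Longrightarrow> \<bar>\<phi> (l c) - \<psi> (k d)\<bar> \<le> K * \<bar>l c - k d\<bar>"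
  shows "norm ((\<Sum>c\<in>C. \<phi> (l c) *\<^sub>R c) - (\<Sum>d\<in>D. \<psi> (k d) *\<^sub>R d))
     \<le> K * norm ((comb l C) - (comb k D))"
proof -
  have "(\<Sum>c\<in>C. \<Sum>d\<in>D. (\<phi> (l c) - \<psi> (k d))\<^sup>2 * inner c d)
     \<le> (\<Sum>c\<in>C. \<Sum>d\<in>D. (K * (l c - k d))\<^sup>2 * inner c d)"
  proof (intro sum_mono mult_right_mono)
    fix c d assume "c \<in> C" "d \<in> D"
    then show "inner c d \<ge> 0" using idem_inner_nonneg frame_idem C D by blast
    have "\<bar>\<phi> (l c) - \<psi> (k d)\<bar> \<le> \<bar>K * (l c - k d)\<bar>"
      using lip[OF \<open>c \<in> C\<close> \<open>d \<in> D\<close>] K by (simp add: abs_mult)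
    then show "(\<phi> (l c) - \<psi> (k d))\<^sup>2 \<le> (K * (l c - k d))\<^sup>2" by (simp add: abs_le_square_iff)
  qed
  also have "\<dots> = K\<^sup>2 * (\<Sum>c\<in>C. \<Sum>d\<in>D. (l c - k d)\<^sup>2 * inner c d)"
    by (simp add: sum_distrib_left power_mult_distrib mult_ac)
  finally have "(norm ((\<Sum>c\<in>C. \<phi> (l c) *\<^sub>R c) - (\<Sum>d\<in>D. \<psi> (k d) *\<^sub>R d)))\<^sup>2
     \<le> (K * norm ((comb l C) - (comb k D)))\<^sup>2"
    unfolding frame_dist[OF C D] power_mult_distrib .
  then show ?thesis by (rule power2_le_imp_le) (use K in simp)
qed

text \<open>Here P(c) d = k c and P(d) c = k' d. Pairing the first with d and the second with c
  gives the same number, so k = k'; pairing both with e then compares the traces.\<close>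

lemma prim_inner_eq:
  assumes c: "prim c" and d: "prim d" and cd: "inner c d \<noteq> 0"
  shows "inner c e = inner d e"
proof -
  have *: "\<exists>k. k * inner c e = inner c d \<and> k * inner c d = 2 * (norm (c \<odot> d))\<^sup>2 - inner c d"
    if "prim c" "prim d" for c d
  proof -
    obtain k where k: "2 *\<^sub>R (c \<odot> (c \<odot> d)) - c \<odot> d = k *\<^sub>R c"
      using idem_quad_prim[OF \<open>prim c\<close>] by blast
    have 1: "inner (c \<odot> (c \<odot> d)) e = inner c d"
      using prim_idem[OF \<open>prim c\<close>] inner_mult_e(1)[of c "c \<odot> d"] inner_mult[of c c d] unfolding idem_def by metis
    have 2: "inner (c \<odot> (c \<odot> d)) d = (norm (c \<odot> d))\<^sup>2"
      by (simp add: inner_mult' power2_norm_eq_inner)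
    have 3: "inner (c \<odot> d) d = inner c d"
      using inner_idem_idem[OF prim_idem[OF \<open>prim d\<close>]] .
    have "inner (k *\<^sub>R c) e = inner c d"
      unfolding k[symmetric] inner_diff_left inner_scaleR_left 1 using inner_mult_e(1)[of c d] by simp
    moreover have "inner (k *\<^sub>R c) d = 2 * (norm (c \<odot> d))\<^sup>2 - inner c d"
      unfolding k[symmetric] inner_diff_left inner_scaleR_left 2 3 by simp
    ultimately show ?thesis by auto
  qed
  obtain k where k: "k * inner c e = inner c d" "k * inner c d = 2 * (norm (c \<odot> d))\<^sup>2 - inner c d"
    using *[OF c d] by blast
  obtain k' where k': "k' * inner d e = inner d c" "k' * inner d c = 2 * (norm (d \<odot> c))\<^sup>2 - inner d c"
    using *[OF d c] by blast
  have "k * inner c d = k' * inner c d"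
    using k(2) k'(2) comm[of d c] inner_commute[of d c] by simp
  then have "k = k'" using cd by simp
  then have "k * inner c e = k * inner d e" using k(1) k'(1) inner_commute[of d c] by simp
  moreover have "k \<noteq> 0" using k(1) cd by auto
  ultimately show ?thesis by simp
qed

end

section \<open>Consequences of simplicity and of the trace normalisation\<close>

lemma subalgebra_locale:
  assumes "euclidean_jordan_algebra UNIV m e" "subspace A"
    "\<And>x y. x \<in> A \<Longrightarrow> y \<in> A \<Longrightarrow> m x y \<in> A" "eA \<in> A" "\<And>x. x \<in> A \<Longrightarrow> m x eA = x"
  shows "euclidean_jordan_algebra A m eA"
proof -
  interpret euclidean_jordan_algebra UNIV m e by fact
  show ?thesis
  proof
    fix x y z :: 'a and k :: real
    show "m (x + y) z = m x z + m y z" by (rule add_left) simp_all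
    show "m (k *\<^sub>R x) y = k *\<^sub>R m x y" by (rule scale_left) simp_all
    show "m x y = m y x" by (rule commute) simp_all
    show "m x (m (m x x) y) = m (m x x) (m x y)" by (rule jordan_identity) simp_all
    show "inner x (m y z) = inner (m x y) z" by (rule inner_assoc) simp_all
  qed (use assms in auto)
qed

locale simple_jordan = jordan m e for m :: "'a::euclidean_space \<Rightarrow> 'a \<Rightarrow> 'a"  (infixl "\<odot>" 70) and e +
  assumes simple: "simple_euclidean_jordan_algebra m e"
    and trace: "\<And>x y. inner x y = jordan_trace m e (m x y)"
begin

text \<open>The type class of Euclidean spaces forces positive dimension.\<close>

lemma e_nz: "e \<noteq> 0"
proof
  assume "e = 0"
  then have "x = 0" for x :: 'a using unit_r[of x] by simp
  moreover obtain b :: 'a where "b \<in> Basis" using nonempty_Basis by blast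
  ultimately show False using nonzero_Basis by blast
qed

text \<open>The primitive idempotents on which \<open>\<nu>\<close> takes a given value and the remaining ones span
  complementary ideals.\<close>

lemma prim_const:
  fixes \<nu> :: "'a \<Rightarrow> real"
  assumes \<nu>: "\<And>c d. prim c \<Longrightarrow> prim d \<Longrightarrow> inner c d \<noteq> 0 \<Longrightarrow> \<nu> c = \<nu> d"
    and c0: "prim c0" and d0: "prim d0"
  shows "\<nu> c0 = \<nu> d0"
proof (rule ccontr)
  assume ne: "\<nu> c0 \<noteq> \<nu> d0"
  define SA where "SA = {c. prim c \<and> \<nu> c = \<nu> c0}"
  define SB where "SB = {c. prim c \<and> \<nu> c \<noteq> \<nu> c0}"
  define A where "A = span SA"
  define B where "B = span SB"
  have sA: "subspace A" and sB: "subspace B" by (simp_all add: A_def B_def)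
  have S0: "c \<odot> d = 0" if "c \<in> SA" "d \<in> SB" for c d
    using that \<nu>[of c d] idem_orth[of c d] prim_idem by (auto simp: SA_def SB_def)
  have AB: "a \<odot> b = 0" if "a \<in> A" "b \<in> B" for a b
  proof -
    have "SB \<subseteq> {b. c \<odot> b = 0}" if "c \<in> SA" for c using S0 that by blast
    moreover have sub: "subspace {b. c \<odot> b = 0}" for c unfolding subspace_def by (auto simp: bilin)
    ultimately have "B \<subseteq> {b. c \<odot> b = 0}" if "c \<in> SA" for c
      using that unfolding B_def by (intro span_minimal) auto
    then have "SA \<subseteq> {a. b \<odot> a = 0}" using \<open>b \<in> B\<close> comm by fastforce
    then have "A \<subseteq> {a. b \<odot> a = 0}" unfolding A_def using sub by (intro span_minimal)
    then show ?thesis using \<open>a \<in> A\<close> comm[of a b] by auto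
  qed
  have BA: "b \<odot> a = 0" if "a \<in> A" "b \<in> B" for a b using AB[OF that] comm[of a b] by simp
  have dec: "\<exists>a\<in>A. \<exists>b\<in>B. x = a + b" for x
  proof -
    obtain C l where "spectral x C l" using ex_frame by blast
    note C = spectralD(1,2)[OF this] and x = spectralD(3)[OF this]
    have "C = (C \<inter> SA) \<union> (C \<inter> SB)" using C(2) by (auto simp: SA_def SB_def)
    then have "x = (\<Sum>c\<in>(C \<inter> SA) \<union> (C \<inter> SB). l c *\<^sub>R c)" using x by simp
    also have "\<dots> = (\<Sum>c\<in>C \<inter> SA. l c *\<^sub>R c) + (\<Sum>c\<in>C \<inter> SB. l c *\<^sub>R c)"
      using frame_fin[OF C(1)] by (intro sum.union_disjoint) (auto simp: SA_def SB_def)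
    finally have "x = (\<Sum>c\<in>C \<inter> SA. l c *\<^sub>R c) + (\<Sum>c\<in>C \<inter> SB. l c *\<^sub>R c)" .
    moreover have "(\<Sum>c\<in>C \<inter> SA. l c *\<^sub>R c) \<in> A" "(\<Sum>c\<in>C \<inter> SB. l c *\<^sub>R c) \<in> B"
      unfolding A_def B_def by (auto intro!: span_sum span_scale intro: span_base)
    ultimately show ?thesis by blast
  qed
  have orth: "inner a b = 0" if "a \<in> A" "b \<in> B" for a b
    using AB[OF that] by (rule inner_zero_if_mult_zero)
  have mA: "x \<odot> y \<in> A" if "x \<in> A" "y \<in> A" for x y
  proof -
    obtain a b where ab: "a \<in> A" "b \<in> B" "x \<odot> y = a + b" using dec by blast
    have "inner (x \<odot> y) b = inner x (y \<odot> b)" using inner_mult[of x y b] by simp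
    then have "inner (a + b) b = 0" using AB[OF that(2) ab(2)] ab(3) by simp
    then have "b = 0" using orth[OF ab(1,2)] by (simp add: inner_add_left)
    then show ?thesis using ab by simp
  qed
  have mB: "x \<odot> y \<in> B" if "x \<in> B" "y \<in> B" for x y
  proof -
    obtain a b where ab: "a \<in> A" "b \<in> B" "x \<odot> y = a + b" using dec by blast
    have "inner (x \<odot> y) a = inner x (y \<odot> a)" using inner_mult[of x y a] by simp
    then have "inner (a + b) a = 0" using BA[OF ab(1) that(2)] ab(3) by simp
    then have "a = 0" using orth[OF ab(1,2)] by (simp add: inner_add_left inner_commute[of b a])
    then show ?thesis using ab by simp
  qed
  obtain eA eB where eAB: "eA \<in> A" "eB \<in> B" "e = eA + eB" using dec by blast
  have uA: "x \<odot> eA = x" if "x \<in> A" for x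
    using AB[OF that eAB(2)] unit_r[of x] unfolding eAB(3) by (simp add: bilin)
  have uB: "x \<odot> eB = x" if "x \<in> B" for x
    using BA[OF eAB(1) that] unit_r[of x] unfolding eAB(3) by (simp add: bilin)
  have lA: "euclidean_jordan_algebra A m eA"
    by (rule subalgebra_locale[OF eja sA mA eAB(1) uA])
  have lB: "euclidean_jordan_algebra B m eB"
    by (rule subalgebra_locale[OF eja sB mB eAB(2) uB])
  have "c0 \<in> A" "d0 \<in> B" using c0 d0 ne by (auto simp: A_def B_def SA_def SB_def intro!: span_base)
  then have dims: "dim A > 0" "dim B > 0"
    using prim_nz[OF c0] prim_nz[OF d0] by (metis dim_eq_0 gr0I singletonD subsetD)+
  define \<phi> where "\<phi> = (\<lambda>x. (x \<odot> eA, x \<odot> eB))"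
  have \<phi>: "\<phi> (a + b) = (a, b)" if "a \<in> A" "b \<in> B" for a b
    unfolding \<phi>_def add_l using uA[OF that(1)] uB[OF that(2)] AB[OF that(1) eAB(2)] BA[OF eAB(1) that(2)]
    by simp
  have "algebra_iso UNIV m (A \<times> B) (\<lambda>(a, b) (a', b'). (m a a', m b b')) \<phi>"
    unfolding algebra_iso_def
  proof (intro conjI ballI)
    show "linear \<phi>" by (rule linearI) (simp_all add: \<phi>_def bilin)
    show "bij_betw \<phi> UNIV (A \<times> B)"
    proof (rule bij_betwI[where g = "\<lambda>(a, b). a + b"])
      show "\<phi> \<in> UNIV \<rightarrow> A \<times> B" using dec \<phi> by (metis (no_types, lifting) Pi_I SigmaI)
      show "(case \<phi> x of (a, b) \<Rightarrow> a + b) = x" for x using dec[of x] \<phi> by auto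
    qed (use \<phi> in auto)
    fix x y
    obtain a b a' b' where *: "a \<in> A" "b \<in> B" "x = a + b" "a' \<in> A" "b' \<in> B" "y = a' + b'"
      using dec by metis
    have "x \<odot> y = a \<odot> a' + b \<odot> b'"
      using AB[OF *(1,5)] BA[OF *(4,2)] unfolding * by (simp add: bilin)
    then show "\<phi> (x \<odot> y) = (case \<phi> x of (a, b) \<Rightarrow> \<lambda>(a', b'). (a \<odot> a', b \<odot> b')) (\<phi> y)"
      using \<phi>[OF mA[OF *(1,4)] mB[OF *(2,5)]] \<phi>[OF *(1,2)] \<phi>[OF *(4,5)] * by simp
  qed
  then show False using simple lA lB dims unfolding simple_euclidean_jordan_algebra_def by blast
qed

text \<open>By \<open>prim_const\<close> all primitive idempotents pair with e to the same \<nu>, so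
  the spectral trace of x is \<open>inner x e / \<nu>\<close>. The normalisation of the scalar
  product at the pair (c, c) then yields \<open>inner c c = 1\<close>.\<close>

lemma prim_trace: assumes c: "prim c" shows "inner c e = 1"
proof -
  define \<nu> where "\<nu> = inner c e"
  have \<nu>: "inner d e = \<nu>" if "prim d" for d
    unfolding \<nu>_def using prim_const[of "\<lambda>c. inner c e", OF prim_inner_eq that c] .
  have pos: "\<nu> > 0" unfolding \<nu>_def using idem_norm[OF prim_idem[OF c]] prim_nz[OF c] by simp
  have sum: "inner x e = \<nu> * (\<Sum>c\<in>C. l c)" if "spectral x C l" for x C l
  proof -
    have C: "frame C" "\<And>c. c \<in> C \<Longrightarrow> prim c" and x: "x = comb l C"
      using that by (auto simp: spectral_iff)
    show ?thesis unfolding x using \<nu> C(2) by (simp add: inner_sum_left sum_distrib_left mult_ac)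
  qed
  have "jordan_trace m e x = inner x e / \<nu>" for x
    unfolding jordan_trace_def
  proof (rule the_equality)
    obtain C l where "spectral x C l" using ex_frame by blast
    then show "\<exists>C eig. spectral x C eig \<and> inner x e / \<nu> = sum eig C"
      using sum pos by (intro exI[of _ C] exI[of _ l]) (auto simp: field_simps)
  qed (use sum pos in \<open>auto simp: field_simps\<close>)
  then have "inner c c = inner (c \<odot> c) e / \<nu>" using trace by metis
  then have "inner c c = \<nu> / \<nu>" using prim_idem[OF c] unfolding idem_def \<nu>_def by simp
  then have "inner c c = 1" using pos by simp
  then show ?thesis using idem_norm[OF prim_idem[OF c]] by simp
qed

lemma jordan_trace_eq: "jordan_trace m e x = inner x e"
  using trace[of x e] by simp

lemma prim_norm: "prim c \<Longrightarrow> norm c = 1"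
  using prim_trace[of c] idem_norm[OF prim_idem, of c] by (simp add: norm_eq_1)

lemma prim_frame_inner:
  assumes "frame C" "c \<in> C" "prim c" shows "inner (comb l C) c = l c"
  using frame_inner[OF assms(1,2)] prim_trace[OF assms(3)] by simp

lemma eigenvalue_bound:
  assumes "frame C" "c \<in> C" "prim c" shows "\<bar>l c\<bar> \<le> norm (comb l C)"
  using Cauchy_Schwarz_ineq2[of "comb l C" c] prim_norm[OF assms(3)]
  by (simp add: prim_frame_inner[OF assms])

lemma jordan_rank_eq: "real (jordan_rank m e) = inner e e"
proof -
  have card: "real (card C) = inner e e" if "complete_system m e C" for C
  proof -
    have C: "frame C" "\<And>c. c \<in> C \<Longrightarrow> prim c" using that by (auto simp: complete_system_iff)
    have "inner e e = inner (\<Sum>C) e" using frame_sum[OF C(1)] by simp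
    also have "\<dots> = (\<Sum>c\<in>C. 1)" unfolding inner_sum_left using C(2) prim_trace by simp
    finally show ?thesis by simp
  qed
  obtain C where C: "complete_system m e C"
    using ex_frame[of e] by (auto simp: spectral_decomposition_def)
  have "jordan_rank m e = card C"
    unfolding jordan_rank_def
  proof (rule the_equality)
    fix r assume "\<exists>C. complete_system m e C \<and> r = card C"
    then show "r = card C" using card C by (metis of_nat_eq_iff)
  qed (use C in blast)
  then show ?thesis using card[OF C] by simp
qed

section \<open>The symmetric cone\<close>

abbreviation cone :: "'a set" where "cone \<equiv> symmetric_cone m"

definition psd :: "'a set" where "psd = range (\<lambda>y. y \<odot> y)"

lemma frame_psd:
  assumes "frame C" "\<And>c. c \<in> C \<Longrightarrow> l c \<ge> 0" shows "(comb l C) \<in> psd"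
proof -
  have "(comb l C) = (\<Sum>c\<in>C. sqrt (l c) *\<^sub>R c) \<odot> (\<Sum>c\<in>C. sqrt (l c) *\<^sub>R c)"
    unfolding frame_mult[OF assms(1)] using assms(2) by simp
  then show ?thesis unfolding psd_def by blast
qed

lemma psd_inner_idem: assumes "x \<in> psd" "idem c" shows "inner x c \<ge> 0"
proof -
  obtain y where "x = y \<odot> y" using assms(1) by (auto simp: psd_def)
  then have "inner x c = inner (c \<odot> y) y" using inner_mult'[of y y c] by (simp add: comm inner_commute)
  then show ?thesis using inner_idem_nonneg[OF assms(2)] by simp
qed

text \<open>Self-duality of the cone of squares: one direction is positivity of multiplication by an
  idempotent, the other tests x against its own frame.\<close>

lemma psd_iff: "x \<in> psd \<longleftrightarrow> (\<forall>c. prim c \<longrightarrow> inner x c \<ge> 0)"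
proof
  assume R: "\<forall>c. prim c \<longrightarrow> inner x c \<ge> 0"
  obtain C l where "spectral x C l" using ex_frame by blast
  note C = spectralD(1,2)[OF this] and x = spectralD(3)[OF this]
  have "l c \<ge> 0" if "c \<in> C" for c
    using R C(2)[OF that] prim_frame_inner[OF C(1) that C(2)[OF that], of l] x by fastforce
  then show "x \<in> psd" unfolding x by (intro frame_psd C)
qed (use psd_inner_idem prim_idem in blast)

lemma psd_scale: "x \<in> psd \<Longrightarrow> r \<ge> 0 \<Longrightarrow> r *\<^sub>R x \<in> psd"
  by (simp add: psd_iff)

lemma idem_psd: "idem c \<Longrightarrow> c \<in> psd" 
  using rangeI[of "\<lambda>y. y \<odot> y" c] by (simp add: psd_def idem_def)

lemma closed_psd: "closed psd"
proof -
  have "psd = (\<Inter>c\<in>Collect prim. {x. inner x c \<ge> 0})" by (auto simp: psd_iff)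
  then show ?thesis by (auto intro!: closed_Collect_le continuous_intros)
qed

text \<open>The weights \<open>inner c p\<close> are nonnegative with sum
  \<open>inner e p = 1\<close>, so pairing with p averages the eigenvalues.\<close>

lemma frame_inner_prim:
  assumes C: "frame C" and p: "prim p" and \<delta>: "\<And>c. c \<in> C \<Longrightarrow> \<delta> \<le> l c"
  shows "\<delta> \<le> inner (comb l C) p"
proof -
  have "\<delta> = \<delta> * inner (\<Sum>C) p"
    using frame_sum[OF C] prim_trace[OF p] by (simp add: inner_commute)
  also have "\<dots> = (\<Sum>c\<in>C. \<delta> * inner c p)" by (simp add: inner_sum_left sum_distrib_left)
  also have "\<dots> \<le> (\<Sum>c\<in>C. l c * inner c p)"
    using idem_inner_nonneg frame_idem[OF C] prim_idem[OF p] \<delta> by (intro sum_mono mult_right_mono) auto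
  finally show ?thesis by (simp add: inner_sum_left)
qed

lemma frame_lower_bound:
  assumes "finite C" "\<And>c. c \<in> C \<Longrightarrow> l c > (0::real)"
  obtains \<delta> where "\<delta> > 0" "\<And>c. c \<in> C \<Longrightarrow> \<delta> \<le> l c"
proof (cases "C = {}")
  case False
  then show ?thesis using assms by (intro that[of "Min (l ` C)"]) auto
qed (use that[of 1] in auto)

text \<open>Primitive idempotents have norm 1, so a perturbation smaller than \<delta> keeps all
  pairings nonnegative; conversely a ball around x contains x - t e for some t > 0, which lowers
  every pairing by t.\<close>

lemma cone_iff_lower: "x \<in> cone \<longleftrightarrow> (\<exists>\<delta>>0. \<forall>c. prim c \<longrightarrow> inner x c \<ge> \<delta>)"
proof
  assume "x \<in> cone"
  then obtain r where r: "r > 0" "ball x r \<subseteq> psd"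
    unfolding symmetric_cone_def psd_def[symmetric] by (auto simp: mem_interior)
  define t where "t = r / 2 / norm e"
  have t: "t > 0" using r e_nz by (simp add: t_def)
  have "x - t *\<^sub>R e \<in> ball x r" using r e_nz by (simp add: dist_norm t_def)
  then have "x - t *\<^sub>R e \<in> psd" using r by blast
  then have "inner x c \<ge> t" if "prim c" for c
    using that prim_trace[OF that] by (auto simp: psd_iff inner_diff_left inner_commute[of e])
  then show "\<exists>\<delta>>0. \<forall>c. prim c \<longrightarrow> inner x c \<ge> \<delta>" using t by blast
next
  assume "\<exists>\<delta>>0. \<forall>c. prim c \<longrightarrow> inner x c \<ge> \<delta>"
  then obtain \<delta> where \<delta>: "\<delta> > 0" "\<And>c. prim c \<Longrightarrow> inner x c \<ge> \<delta>" by blast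
  have "ball x \<delta> \<subseteq> psd"
  proof
    fix y assume "y \<in> ball x \<delta>"
    then have y: "norm (x - y) < \<delta>" by (simp add: dist_norm)
    have "inner y c \<ge> 0" if "prim c" for c
    proof -
      have "inner (x - y) c \<le> norm (x - y)"
        using norm_cauchy_schwarz[of "x - y" c] prim_norm[OF that] by simp
      then show ?thesis using \<delta>(2)[OF that] y by (simp add: inner_diff_left)
    qed
    then show "y \<in> psd" by (simp add: psd_iff)
  qed
  then show "x \<in> cone" unfolding symmetric_cone_def psd_def[symmetric] using \<delta>(1)
    by (auto simp: mem_interior)
qed

lemma cone_frame_iff:
  assumes C: "frame C" "\<And>c. c \<in> C \<Longrightarrow> prim c"
  shows "(comb l C) \<in> cone \<longleftrightarrow> (\<forall>c\<in>C. l c > 0)"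
proof
  assume "(comb l C) \<in> cone"
  then obtain \<delta> where \<delta>: "\<delta> > 0" "\<And>p. prim p \<Longrightarrow> inner (comb l C) p \<ge> \<delta>"
    unfolding cone_iff_lower by blast
  show "\<forall>c\<in>C. l c > 0"
    using \<delta>(2)[OF C(2)] \<delta>(1) prim_frame_inner[OF C(1) _ C(2), of _ l] by fastforce
next
  assume "\<forall>c\<in>C. l c > 0"
  then obtain \<delta> where "\<delta> > 0" "\<And>c. c \<in> C \<Longrightarrow> \<delta> \<le> l c"
    using frame_lower_bound[OF frame_fin[OF C(1)], of l] by blast
  then show "(comb l C) \<in> cone"
    unfolding cone_iff_lower using frame_inner_prim[OF C(1)] by blast
qed

lemma cone_eigenvalue_pos: "spectral x C l \<Longrightarrow> x \<in> cone \<Longrightarrow> c \<in> C \<Longrightarrow> l c > 0"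
  using cone_frame_iff[of C l] by (auto simp: spectral_iff)

lemma open_cone: "open cone" by (simp add: symmetric_cone_def)

lemma cone_psd: "x \<in> cone \<Longrightarrow> x \<in> psd"
  unfolding symmetric_cone_def psd_def using interior_subset by blast

lemma cone_iff: "x \<in> cone \<longleftrightarrow> (\<forall>c. prim c \<longrightarrow> inner x c > 0)"
proof
  assume R: "\<forall>c. prim c \<longrightarrow> inner x c > 0"
  obtain C l where "spectral x C l" using ex_frame by blast
  note C = spectralD(1,2)[OF this] and x = spectralD(3)[OF this]
  have "l c > 0" if "c \<in> C" for c
    using R C(2)[OF that] prim_frame_inner[OF C(1) that C(2)[OF that], of l] x by fastforce
  then show "x \<in> cone" unfolding x using cone_frame_iff[OF C, of l] by blast
qed (auto simp: cone_iff_lower intro: less_le_trans)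

lemma cone_add_psd: "x \<in> cone \<Longrightarrow> y \<in> psd \<Longrightarrow> x + y \<in> cone"
  unfolding cone_iff psd_iff by (auto simp: inner_add_left add_pos_nonneg)

lemma cone_add: "x \<in> cone \<Longrightarrow> y \<in> cone \<Longrightarrow> x + y \<in> cone"
  using cone_add_psd cone_psd by blast

lemma cone_scale: "x \<in> cone \<Longrightarrow> r > 0 \<Longrightarrow> r *\<^sub>R x \<in> cone"
  unfolding cone_iff by simp

lemma e_cone: "e \<in> cone"
  unfolding cone_iff using prim_trace by (simp add: inner_commute)

lemma cone_lower_e: assumes "x \<in> cone" obtains \<delta> where "\<delta> > 0" "x - \<delta> *\<^sub>R e \<in> psd"
proof -
  obtain \<delta> where \<delta>: "\<delta> > 0" "\<And>c. prim c \<Longrightarrow> inner x c \<ge> \<delta>" using assms unfolding cone_iff_lower by blast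
  have "x - \<delta> *\<^sub>R e \<in> psd"
    using \<delta>(2) prim_trace by (simp add: psd_iff inner_diff_left inner_commute[of e])
  then show ?thesis using \<delta>(1) that by blast
qed

lemma psd_inner_psd: assumes "x \<in> psd" "y \<in> psd" shows "inner x y \<ge> 0"
proof -
  obtain C l where "spectral y C l" using ex_frame by blast
  note C = spectralD(1,2)[OF this] and y = spectralD(3)[OF this]
  have "l c \<ge> 0" if "c \<in> C" for c
    using assms(2) C(2)[OF that] prim_frame_inner[OF C(1) that C(2)[OF that], of l] y 
    unfolding psd_iff by fastforce
  then show ?thesis using assms(1) C(2) unfolding y psd_iff
    by (auto simp: inner_sum_right intro!: sum_nonneg)
qed

text \<open>By self-duality and self-adjointness of P(w) only the images of primitive idempotents
  matter, and these are nonnegative multiples of idempotents.\<close>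

lemma quad_psd: assumes "x \<in> psd" shows "quad w x \<in> psd"
proof -
  have "inner (quad w x) c \<ge> 0" if p: "prim c" for c
  proof -
    obtain k c' where "k \<ge> 0" "idem c'" "quad w c = k *\<^sub>R c'" using quad_prim[OF p, of w] by blast
    then have "quad w c \<in> psd" using psd_scale[OF idem_psd] by simp
    then show ?thesis using psd_inner_psd[OF assms] by (simp add: inner_quad)
  qed
  then show ?thesis by (simp add: psd_iff)
qed

lemma cone_square: assumes "w \<in> cone" shows "w \<odot> w \<in> cone"
proof -
  obtain C l where *: "spectral w C l" using ex_frame by blast
  note C = spectralD[OF *] cone_eigenvalue_pos[OF * assms]
  show ?thesis unfolding C(3) frame_mult[OF C(1)]
    using cone_frame_iff[OF C(1,2), of "\<lambda>c. l c * l c"] C(4) by simp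
qed

lemma quad_cone: assumes w: "w \<in> cone" and x: "x \<in> cone" shows "quad w x \<in> cone"
proof -
  obtain \<delta> where \<delta>: "\<delta> > 0" "x - \<delta> *\<^sub>R e \<in> psd" using cone_lower_e[OF x] by blast
  have "quad w x = \<delta> *\<^sub>R (w \<odot> w) + quad w (x - \<delta> *\<^sub>R e)"
    by (simp add: quad_diff quad_scale quad_e)
  then show ?thesis using cone_add_psd[OF cone_scale[OF cone_square[OF w] \<delta>(1)] quad_psd[OF \<delta>(2)]] by simp
qed

lemma fc_cone:
  assumes "x \<in> cone" "\<And>t. t > 0 \<Longrightarrow> \<phi> t > 0" shows "fc \<phi> x \<in> cone"
proof -
  obtain C l where *: "spectral x C l" using ex_frame by blast
  note C = spectralD[OF *] cone_eigenvalue_pos[OF * assms(1)]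
  show ?thesis unfolding C(3) fc_eq[OF C(1)]
    using cone_frame_iff[OF C(1,2), of "\<lambda>c. \<phi> (l c)"] C(4) assms(2) by simp
qed

lemma fc_exp_cone: "fc exp x \<in> cone"
proof -
  obtain C l where "spectral x C l" using ex_frame by blast
  note C = spectralD[OF this]
  show ?thesis unfolding C(3) fc_eq[OF C(1)]
    using cone_frame_iff[OF C(1,2), of "\<lambda>c. exp (l c)"] by simp
qed

lemma fc_cong_cone:
  assumes "x \<in> cone" "\<And>t. t > 0 \<Longrightarrow> \<phi> t = \<psi> t" shows "fc \<phi> x = fc \<psi> x"
proof -
  obtain C l where *: "spectral x C l" using ex_frame by blast
  note C = spectralD[OF *] cone_eigenvalue_pos[OF * assms(1)]
  show ?thesis unfolding C(3) fc_eq[OF C(1)] using C(4) assms(2) by (intro sum.cong) simp_all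
qed

lemma fc_exp_ln: "x \<in> cone \<Longrightarrow> fc exp (fc ln x) = x"
  unfolding fc_fc using fc_cong_cone[of x "\<lambda>t. exp (ln t)" "\<lambda>t. t"] by (simp add: fc_id)

definition jsqrt :: "'a \<Rightarrow> 'a" where "jsqrt = fc sqrt"
definition jinv :: "'a \<Rightarrow> 'a" where "jinv = fc inverse"

lemma jsqrt_cone: "x \<in> cone \<Longrightarrow> jsqrt x \<in> cone" unfolding jsqrt_def by (rule fc_cone) auto
lemma jinv_cone: "x \<in> cone \<Longrightarrow> jinv x \<in> cone" unfolding jinv_def by (rule fc_cone) auto

lemma jsqrt_square: "x \<in> cone \<Longrightarrow> jsqrt x \<odot> jsqrt x = x"
  unfolding jsqrt_def fc_mult using fc_cong_cone[of x "\<lambda>t. sqrt t * sqrt t" "\<lambda>t. t"] by (simp add: fc_id)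

lemma jsqrt_of_square: "x \<in> cone \<Longrightarrow> jsqrt (x \<odot> x) = x"
proof -
  assume x: "x \<in> cone"
  have "x \<odot> x = fc (\<lambda>t. t * t) x" using fc_mult[of "\<lambda>t. t" x "\<lambda>t. t"] by (simp add: fc_id)
  then show ?thesis unfolding jsqrt_def using fc_cong_cone[OF x, of "\<lambda>t. sqrt (t * t)" "\<lambda>t. t"]
    by (simp add: fc_id fc_fc)
qed

lemma quad_jinv:
  assumes "w \<in> cone" shows "quad w (quad (jinv w) z) = z" "quad (jinv w) (quad w z) = z"
proof -
  have "quad w (quad (jinv w) z) = quad (fc (\<lambda>t. t * inverse t) w) z"
    using quad_fc_comp[of "\<lambda>t. t" w inverse z] by (simp add: jinv_def fc_id)
  moreover have "quad (jinv w) (quad w z) = quad (fc (\<lambda>t. inverse t * t) w) z"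
    using quad_fc_comp[of inverse w "\<lambda>t. t" z] by (simp add: jinv_def fc_id)
  moreover have "fc (\<lambda>t. t * inverse t) w = e" "fc (\<lambda>t. inverse t * t) w = e"
    using fc_cong_cone[OF assms, of "\<lambda>t. t * inverse t" "\<lambda>t. 1"]
      fc_cong_cone[OF assms, of "\<lambda>t. inverse t * t" "\<lambda>t. 1"] fc_const[of 1 w] by simp_all
  ultimately show "quad w (quad (jinv w) z) = z" "quad (jinv w) (quad w z) = z" by simp_all
qed

lemma quad_jinv_square: assumes "w \<in> cone" shows "quad (jinv w) (w \<odot> w) = e"
  using quad_jinv(2)[OF assms, of e] by (simp add: quad_e)

lemma quad_cone_iff: assumes "w \<in> cone" shows "quad w x \<in> cone \<longleftrightarrow> x \<in> cone"
  using quad_cone[OF assms] quad_cone[OF jinv_cone[OF assms], of "quad w x"] quad_jinv(2)[OF assms] by auto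

lemma spectral_fc: "spectral x C l \<Longrightarrow> fc \<phi> x = (\<Sum>c\<in>C. \<phi> (l c) *\<^sub>R c)"
  by (auto simp: spectral_iff fc_eq)

lemma inv_sqrt_eq: "inv_sqrt m e x = fc (\<lambda>t. t powr (-1/2)) x"
  unfolding inv_sqrt_def
proof (rule the_equality)
  obtain C l where C: "spectral x C l" using ex_frame by blast
  then have "fc (\<lambda>t. t powr (-1/2)) x = (\<Sum>c\<in>C. (l c powr (-1/2)) *\<^sub>R c)"
    by (rule spectral_fc)
  then show "\<exists>C eig. spectral x C eig \<and>
      fc (\<lambda>t. t powr (-1/2)) x = (\<Sum>c\<in>C. (eig c powr (-1/2)) *\<^sub>R c)"
    using C by blast
next
  fix y assume "\<exists>C eig. spectral x C eig \<and> y = (\<Sum>c\<in>C. (eig c powr (-1/2)) *\<^sub>R c)"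
  then show "y = fc (\<lambda>t. t powr (-1/2)) x"
    using spectral_fc[of x _ _ "\<lambda>t. t powr (-1/2)"] by auto
qed

lemma inv_sqrt_jsqrt: "x \<in> cone \<Longrightarrow> inv_sqrt m e x = jinv (jsqrt x)"
  unfolding inv_sqrt_eq jinv_def jsqrt_def fc_fc
  by (rule fc_cong_cone) (simp_all add: powr_minus powr_half_sqrt[symmetric])

definition jdet :: "'a \<Rightarrow> real" where "jdet x = jordan_det m e x"

lemma jdet_eq: assumes x: "x \<in> cone" shows "jdet x = exp (inner (fc ln x) e)"
proof -
  have *: "(\<Prod>c\<in>C. l c) = exp (inner (fc ln x) e)" if "spectral x C l" for C l
  proof -
    have C: "frame C" "\<And>c. c \<in> C \<Longrightarrow> prim c" and xl: "x = comb l C"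
      using that by (auto simp: spectral_iff)
    have pos: "l c > 0" if "c \<in> C" for c using x cone_frame_iff[OF C] that unfolding xl by blast
    have "inner (fc ln x) e = (\<Sum>c\<in>C. ln (l c))"
      unfolding xl fc_eq[OF C(1)] inner_sum_left using prim_trace C(2) by simp
    then show ?thesis using pos frame_fin[OF C(1)] by (simp add: exp_sum)
  qed
  obtain C l where C: "spectral x C l" using ex_frame by blast
  show ?thesis unfolding jdet_def jordan_det_def
    by (rule the_equality) (use * C in \<open>metis, metis\<close>)
qed

lemma jdet_pos: "x \<in> cone \<Longrightarrow> jdet x > 0" by (simp add: jdet_eq)

lemma ln_jdet: "x \<in> cone \<Longrightarrow> ln (jdet x) = inner (fc ln x) e" by (simp add: jdet_eq)

end

section \<open>Preliminaries on additive functions, linear functionals and difference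
  quotients\<close>

lemma additive_on_pos_linear:
  fixes f :: "real \<Rightarrow> real"
  assumes add: "\<And>s t. s > 0 \<Longrightarrow> t > 0 \<Longrightarrow> f (s + t) = f s + f t"
    and cont: "continuous_on {0<..} f" and t: "t > 0"
  shows "f t = t * f 1"
proof -
  have mult: "f (real (Suc k) * s) = real (Suc k) * f s" if "s > 0" for k s
  proof (induction k)
    case (Suc k)
    have "f (real (Suc (Suc k)) * s) = f (real (Suc k) * s + s)" by (simp add: algebra_simps)
    also have "\<dots> = f (real (Suc k) * s) + f s" using that by (intro add) auto
    finally show ?case using Suc by (simp add: algebra_simps)
  qed simp
  have rat: "f (real (Suc k) / real (Suc n)) = real (Suc k) / real (Suc n) * f 1" for k n
  proof -
    have "real (Suc n) * f (1 / real (Suc n)) = f 1" using mult[of "1 / real (Suc n)" n] by simp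
    then have "f (1 / real (Suc n)) = f 1 / real (Suc n)" by (simp add: field_simps)
    then show ?thesis using mult[of "1 / real (Suc n)" k] by simp
  qed
  \<comment> \<open>Rational approximation from above: the successor keeps the numerator positive,
    as \<open>rat\<close> requires, and costs at most 1 / (n + 1).\<close>
  define r where "r n = real (Suc (nat \<lfloor>t * real (Suc n)\<rfloor>)) / real (Suc n)" for n
  have r: "r \<longlonglongrightarrow> t"
  proof (rule tendsto_sandwich)
    show "eventually (\<lambda>n. t \<le> r n) sequentially"
    proof (intro always_eventually allI)
      fix n
      have "t * real (Suc n) \<le> real (Suc (nat \<lfloor>t * real (Suc n)\<rfloor>))"
        using t by (simp only: of_nat_Suc of_nat_nat zero_le_floor) linarith
      then show "t \<le> r n" by (simp add: r_def field_simps)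
    qed
    show "eventually (\<lambda>n. r n \<le> t + 1 / real (Suc n)) sequentially"
    proof (intro always_eventually allI)
      fix n
      have "real (nat \<lfloor>t * real (Suc n)\<rfloor>) \<le> t * real (Suc n)"
        using t by (simp add: of_nat_nat)
      then have "r n \<le> (t * real (Suc n) + 1) / real (Suc n)"
        unfolding r_def by (intro divide_right_mono) simp_all
      then show "r n \<le> t + 1 / real (Suc n)" by (simp add: add_divide_distrib)
    qed
    show "(\<lambda>n. t + 1 / real (Suc n)) \<longlonglongrightarrow> t"
      using tendsto_add[OF tendsto_const LIMSEQ_inverse_real_of_nat, of t] by (simp add: inverse_eq_divide)
  qed simp
  have "isCont f t" using cont t by (simp add: continuous_on_eq_continuous_at)
  then have "(\<lambda>n. f (r n)) \<longlonglongrightarrow> f t" using r by (rule isCont_tendsto_compose)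
  moreover have "(\<lambda>n. f (r n)) = (\<lambda>n. r n * f 1)" unfolding r_def rat ..
  moreover have "(\<lambda>n. r n * f 1) \<longlonglongrightarrow> t * f 1" by (intro tendsto_mult r tendsto_const)
  ultimately show ?thesis using LIMSEQ_unique by fastforce
qed

lemma linear_functional_inner:
  fixes f :: "'a::euclidean_space \<Rightarrow> real"
  assumes f: "linear f" shows "\<exists>A. \<forall>x. f x = inner A x"
proof (intro exI allI)
  fix x
  have "f x = f (\<Sum>b\<in>Basis. inner x b *\<^sub>R b)" by (simp add: euclidean_representation)
  also have "\<dots> = (\<Sum>b\<in>Basis. inner x b * f b)" by (simp add: linear_sum[OF f] linear_scale[OF f])
  also have "\<dots> = inner (\<Sum>b\<in>Basis. f b *\<^sub>R b) x"
    by (simp add: inner_sum_left mult_ac inner_commute[of x])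
  finally show "f x = inner (\<Sum>b\<in>Basis. f b *\<^sub>R b) x" .
qed

lemma continuous_on_local_lipschitz:
  fixes f :: "'a::metric_space \<Rightarrow> 'b::metric_space"
  assumes "\<And>x. x \<in> S \<Longrightarrow> \<exists>r>0. \<exists>K\<ge>0. \<forall>y\<in>S. dist x y < r \<longrightarrow> dist (f x) (f y) \<le> K * dist x y"
  shows "continuous_on S f"
proof (rule continuous_onI)
  fix \<epsilon> :: real and z assume z: "z \<in> S" and e: "(0::real) < \<epsilon>"
  then obtain r K where r: "r > 0" "K \<ge> 0" and L: "\<And>y. y \<in> S \<Longrightarrow> dist z y < r \<Longrightarrow> dist (f z) (f y) \<le> K * dist z y"
    using assms[OF z] by blast
  define d where "d = min r (\<epsilon> / (K + 1))"
  have "d > 0" using r e by (simp add: d_def)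
  moreover have "dist (f y) (f z) \<le> \<epsilon>" if "y \<in> S" "dist y z < d" for y
  proof -
    have "dist (f z) (f y) \<le> K * dist z y" using L that by (simp add: d_def dist_commute)
    also have "\<dots> \<le> (K + 1) * (\<epsilon> / (K + 1))"
      using that r e by (intro mult_mono) (auto simp: d_def dist_commute)
    finally show ?thesis using r by (simp add: dist_commute)
  qed
  ultimately show "\<exists>d>0. \<forall>y\<in>S. dist y z < d \<longrightarrow> dist (f y) (f z) \<le> \<epsilon>" by blast
qed

lemma has_vector_derivative_quotient:
  assumes "(f has_vector_derivative v) (at (0::real))"
  shows "((\<lambda>t. (1 / t) *\<^sub>R (f t - f 0)) \<longlongrightarrow> v) (at 0)"
proof -
  have "((\<lambda>h. norm (f h - f 0 - h *\<^sub>R v) / norm h) \<longlongrightarrow> 0) (at 0)"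
    using assms by (simp add: has_vector_derivative_def has_derivative_at)
  moreover have "eventually (\<lambda>h. norm (f h - f 0 - h *\<^sub>R v) / norm h = norm ((1 / h) *\<^sub>R (f h - f 0) - v)) (at 0)"
    unfolding eventually_at
  proof (intro exI[of _ 1] conjI ballI impI)
    fix h :: real assume "h \<noteq> 0 \<and> dist h 0 < 1"
    then have "(1 / h) *\<^sub>R (f h - f 0) - v = (1 / h) *\<^sub>R (f h - f 0 - h *\<^sub>R v)"
      by (simp add: scaleR_diff_right)
    then show "norm (f h - f 0 - h *\<^sub>R v) / norm h = norm ((1 / h) *\<^sub>R (f h - f 0) - v)" by simp
  qed simp
  ultimately have "((\<lambda>h. norm ((1 / h) *\<^sub>R (f h - f 0) - v)) \<longlongrightarrow> 0) (at 0)"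
    by (rule Lim_transform_eventually)
  then show ?thesis by (simp add: tendsto_norm_zero_iff Lim_null[of _ v])
qed

section \<open>Continuity of the functional calculus and first-order behaviour at e\<close>

context simple_jordan begin

text \<open>Pairing with the primitive idempotents of a nearby y shows that its eigenvalues stay
  within \<open>norm (x - y)\<close> of the range of the eigenvalues of x. On this enlarged interval
  the derivative is bounded, and \<open>frame_lipschitz\<close> transfers the bound.\<close>

lemma continuous_fc:
  assumes I: "open I" "is_interval I"
    and deriv: "\<And>t. t \<in> I \<Longrightarrow> (\<phi> has_real_derivative \<phi>' t) (at t)" and cont: "continuous_on I \<phi>'"
    and S: "\<And>x C l c. x \<in> S \<Longrightarrow> spectral x C l \<Longrightarrow> c \<in> C \<Longrightarrow> l c \<in> I"
  shows "continuous_on S (fc \<phi>)"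
proof (rule continuous_on_local_lipschitz)
  fix x assume x: "x \<in> S"
  obtain C l where *: "spectral x C l" using ex_frame by blast
  note C = spectralD[OF *]
  have fin: "finite (l ` C)" "l ` C \<noteq> {}" using frame_fin[OF C(1)] frame_sum[OF C(1)] e_nz by auto
  define a b where "a = Min (l ` C)" and "b = Max (l ` C)"
  have l: "a \<le> l c" "l c \<le> b" if "c \<in> C" for c using fin that by (auto simp: a_def b_def)
  have "a \<in> I" "b \<in> I" using Min_in[OF fin] Max_in[OF fin] S[OF x *] by (auto simp: a_def b_def)
  then obtain r1 r2 where r12: "r1 > 0" "cball a r1 \<subseteq> I" "r2 > 0" "cball b r2 \<subseteq> I"
    using I(1) open_contains_cball by metis
  define r where "r = min r1 r2"
  have r: "r > 0" using r12 by (simp add: r_def)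
  have ar: "a - r \<in> I" using r12 by (intro subsetD[OF r12(2)]) (auto simp: r_def dist_real_def)
  have br: "b + r \<in> I" using r12 by (intro subsetD[OF r12(4)]) (auto simp: r_def dist_real_def)
  have J: "{a - r..b + r} \<subseteq> I" by (rule subsetI, rule mem_is_interval_1_I[OF I(2) ar br]) auto
  have "bounded (\<phi>' ` {a - r..b + r})"
    by (intro compact_imp_bounded compact_continuous_image continuous_on_subset[OF cont J]) simp
  then obtain K where K: "K > 0" "\<And>t. t \<in> {a - r..b + r} \<Longrightarrow> \<bar>\<phi>' t\<bar> \<le> K"
    unfolding bounded_pos by auto
  have lip: "\<bar>\<phi> s - \<phi> t\<bar> \<le> K * \<bar>s - t\<bar>" if "s \<in> {a - r..b + r}" "t \<in> {a - r..b + r}" for s t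
  proof -
    have "norm (\<phi> s - \<phi> t) \<le> K * norm (s - t)"
    proof (rule field_differentiable_bound)
      show "(\<phi> has_real_derivative \<phi>' u) (at u within {a - r..b + r})" if "u \<in> {a - r..b + r}" for u
        using deriv[OF subsetD[OF J that]] by (rule has_field_derivative_at_within)
    qed (use that K(2) in auto)
    then show ?thesis by simp
  qed
  have "norm (fc \<phi> x - fc \<phi> y) \<le> K * norm (x - y)" if y: "norm (x - y) < r" for y
  proof -
    obtain D k where "spectral y D k" using ex_frame by blast
    note D = spectralD[OF this]
    have k: "k d \<in> {a - r..b + r}" if d: "d \<in> D" for d
    proof -
      have "a \<le> inner x d" unfolding C(3) by (rule frame_inner_prim[OF C(1) D(2)[OF d] l(1)])
      moreover have "- b \<le> inner (- x) d"
        unfolding C(3) using frame_inner_prim[OF C(1) D(2)[OF d], of "- b" "\<lambda>c. - l c"] l(2)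
        by (simp add: sum_negf)
      moreover have "\<bar>inner (x - y) d\<bar> \<le> norm (x - y)"
        using Cauchy_Schwarz_ineq2[of "x - y" d] prim_norm[OF D(2)[OF d]] by simp
      moreover have "inner y d = k d" unfolding D(3) by (rule prim_frame_inner[OF D(1) d D(2)[OF d]])
      ultimately show ?thesis using y by (simp add: inner_diff_left) arith
    qed
    have "l c \<in> {a - r..b + r}" if "c \<in> C" for c using l[OF that] r by auto
    then show ?thesis unfolding C(3) D(3) fc_eq[OF C(1)] fc_eq[OF D(1)]
      using K(1) k by (intro frame_lipschitz[OF C(1) D(1)] lip) auto
  qed
  then show "\<exists>r>0. \<exists>K\<ge>0. \<forall>y\<in>S. dist x y < r \<longrightarrow> dist (fc \<phi> x) (fc \<phi> y) \<le> K * dist x y"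
    unfolding dist_norm using r K(1) by (intro exI[of _ r] conjI exI[of _ K]) auto
qed

lemma continuous_exp: "continuous_on UNIV (fc exp)"
  by (rule continuous_fc[of UNIV exp exp]) (auto intro: DERIV_exp continuous_intros)

lemma continuous_jsqrt: "continuous_on cone jsqrt"
  unfolding jsqrt_def
  by (rule continuous_fc[of "{0<..}" sqrt "\<lambda>t. inverse (sqrt t) / 2"])
     (auto intro!: continuous_intros DERIV_real_sqrt dest: cone_eigenvalue_pos simp: is_interval_1)

lemma continuous_jinv: "continuous_on cone jinv"
  unfolding jinv_def
  by (rule continuous_fc[of "{0<..}" inverse "\<lambda>t. - (inverse t * inverse t)"])
     (auto intro!: continuous_intros derivative_eq_intros dest: cone_eigenvalue_pos simp: is_interval_1)

text \<open>Every eigenvalue t of k satisfies |ln (1 + t) - t| \<le> 2 t^2. Comparison with the zero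
  element in the same frame, with Lipschitz constant \<open>2 * norm k\<close>, turns this into a
  quadratic error.\<close>

lemma ln_near_e:
  assumes k: "norm k \<le> 1/2"
  shows "e + k \<in> cone" "norm (fc ln (e + k) - k) \<le> 2 * norm k * norm k"
proof -
  obtain C l where "spectral k C l" using ex_frame by blast
  note C = spectralD(1,2)[OF this] and kl = spectralD(3)[OF this]
  have ek: "e + k = (\<Sum>c\<in>C. (1 + l c) *\<^sub>R c)"
    unfolding kl by (simp add: sum.distrib scaleR_add_left frame_sum[OF C(1)])
  have l: "\<bar>l c\<bar> \<le> norm k" if "c \<in> C" for c
    unfolding kl by (rule eigenvalue_bound[OF C(1) that C(2)[OF that]])
  have "1 + l c > 0" if "c \<in> C" for c using l[OF that] k by linarith
  then show "e + k \<in> cone" unfolding ek using cone_frame_iff[OF C, of "\<lambda>c. 1 + l c"] by blast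
  have "norm ((\<Sum>c\<in>C. (ln (1 + l c) - l c) *\<^sub>R c) - (\<Sum>c\<in>C. 0 *\<^sub>R c))
     \<le> 2 * norm k * norm ((comb l C) - (\<Sum>c\<in>C. 0 *\<^sub>R c))"
  proof (rule frame_lipschitz[OF C(1) C(1), where \<phi> = "\<lambda>t. ln (1 + t) - t" and \<psi> = "\<lambda>t. t"])
    fix c d assume c: "c \<in> C"
    have "\<bar>ln (1 + l c) - l c\<bar> \<le> 2 * (l c)\<^sup>2"
      using l[OF c] k by (intro abs_ln_one_plus_x_minus_x_bound) linarith
    also have "\<dots> = 2 * \<bar>l c\<bar> * \<bar>l c\<bar>" by (simp add: power2_eq_square)
    also have "\<dots> \<le> 2 * norm k * \<bar>l c\<bar>" using l[OF c] by (intro mult_right_mono) auto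
    finally show "\<bar>ln (1 + l c) - l c - 0\<bar> \<le> 2 * norm k * \<bar>l c - 0\<bar>" by simp
  qed simp
  moreover have "fc ln (e + k) - k = (\<Sum>c\<in>C. (ln (1 + l c) - l c) *\<^sub>R c)"
    unfolding ek fc_eq[OF C(1)] unfolding kl by (simp add: scaleR_diff_left sum_subtractf)
  ultimately show "norm (fc ln (e + k) - k) \<le> 2 * norm k * norm k" using kl by simp
qed

lemma ln_curve:
  assumes k0: "k 0 = e" and k: "(k has_vector_derivative v) (at (0::real))"
  shows "((\<lambda>t. (1 / t) *\<^sub>R fc ln (k t)) \<longlongrightarrow> v) (at 0)"
    and "eventually (\<lambda>t. k t \<in> cone) (at 0)"
proof -
  have q: "((\<lambda>t. (1 / t) *\<^sub>R (k t - e)) \<longlongrightarrow> v) (at 0)"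
    using has_vector_derivative_quotient[OF k] k0 by simp
  have "(k \<longlongrightarrow> e) (at 0)"
    using has_vector_derivative_continuous[OF k] k0 by (simp add: continuous_at)
  then have z: "((\<lambda>t. k t - e) \<longlongrightarrow> 0) (at 0)" by (simp add: LIM_zero)
  then have n0: "((\<lambda>t. norm (k t - e)) \<longlongrightarrow> 0) (at 0)" by (rule tendsto_norm_zero)
  have ev: "eventually (\<lambda>t. norm (k t - e) \<le> 1/2) (at 0)"
    using order_tendstoD(2)[OF n0, of "1/2"] by (auto elim: eventually_mono)
  then show "eventually (\<lambda>t. k t \<in> cone) (at 0)"
    by (rule eventually_mono) (use ln_near_e(1) in force)
  have lim: "((\<lambda>t. 2 * norm (k t - e) * norm ((1 / t) *\<^sub>R (k t - e))) \<longlongrightarrow> 2 * 0 * norm v) (at 0)"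
    by (intro tendsto_intros n0 q tendsto_norm)
  have "((\<lambda>t. (1 / t) *\<^sub>R fc ln (k t) - (1 / t) *\<^sub>R (k t - e)) \<longlongrightarrow> 0) (at 0)"
  proof (rule Lim_null_comparison)
    show "eventually (\<lambda>t. norm ((1 / t) *\<^sub>R fc ln (k t) - (1 / t) *\<^sub>R (k t - e))
        \<le> 2 * norm (k t - e) * norm ((1 / t) *\<^sub>R (k t - e))) (at 0)"
      using ev
    proof (rule eventually_mono)
      fix t assume t: "norm (k t - e) \<le> 1/2"
      have "norm (fc ln (k t) - (k t - e)) \<le> 2 * norm (k t - e) * norm (k t - e)"
        using ln_near_e(2)[OF t] by simp
      then have "\<bar>1 / t\<bar> * norm (fc ln (k t) - (k t - e)) \<le> \<bar>1 / t\<bar> * (2 * norm (k t - e) * norm (k t - e))"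
        by (intro mult_left_mono) auto
      also have "\<bar>1 / t\<bar> * norm (fc ln (k t) - (k t - e)) = norm ((1 / t) *\<^sub>R fc ln (k t) - (1 / t) *\<^sub>R (k t - e))"
        unfolding scaleR_diff_right[symmetric] norm_scaleR ..
      finally show "norm ((1 / t) *\<^sub>R fc ln (k t) - (1 / t) *\<^sub>R (k t - e))
        \<le> 2 * norm (k t - e) * norm ((1 / t) *\<^sub>R (k t - e))" unfolding norm_scaleR by (simp add: mult_ac)
    qed
    show "((\<lambda>t. 2 * norm (k t - e) * norm ((1 / t) *\<^sub>R (k t - e))) \<longlongrightarrow> 0) (at 0)" using lim by simp
  qed
  from tendsto_add[OF this q] show "((\<lambda>t. (1 / t) *\<^sub>R fc ln (k t)) \<longlongrightarrow> v) (at 0)" by simp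
qed

text \<open>Along the multiples of x the frame is fixed, so only scalar exponentials are
  differentiated.\<close>

lemma exp_curve: "((\<lambda>t. fc exp (t *\<^sub>R x)) has_vector_derivative x) (at 0)"
proof -
  obtain C l where "spectral x C l" using ex_frame by blast
  note C = spectralD(1,2)[OF this] and x = spectralD(3)[OF this]
  have *: "fc exp (t *\<^sub>R x) = (\<Sum>c\<in>C. exp (t * l c) *\<^sub>R c)" for t
    unfolding fc_of_scale unfolding x by (rule fc_eq[OF C(1)])
  show ?thesis unfolding * unfolding x
    by (auto intro!: derivative_eq_intros)
qed

lemma quad_curve:
  assumes u: "(u has_vector_derivative u') (at (0::real))" "u 0 = e"
    and q: "(q has_vector_derivative q') (at (0::real))"
  shows "((\<lambda>t. quad (u t) (q t)) has_vector_derivative (2 *\<^sub>R (u' \<odot> q 0) + q')) (at 0)"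
proof -
  note D = bounded_bilinear.has_vector_derivative[OF bounded_bilinear_mult]
  have "((\<lambda>t. 2 *\<^sub>R (u t \<odot> (u t \<odot> q t)) - (u t \<odot> u t) \<odot> q t) has_vector_derivative
     (2 *\<^sub>R (u 0 \<odot> (u 0 \<odot> q' + u' \<odot> q 0) + u' \<odot> (u 0 \<odot> q 0))
      - ((u 0 \<odot> u 0) \<odot> q' + (u 0 \<odot> u' + u' \<odot> u 0) \<odot> q 0))) (at 0)"
    by (intro has_vector_derivative_diff D u q bounded_linear.has_vector_derivative[OF bounded_linear_scaleR_right])
  moreover have "2 *\<^sub>R (u 0 \<odot> (u 0 \<odot> q' + u' \<odot> q 0) + u' \<odot> (u 0 \<odot> q 0))
      - ((u 0 \<odot> u 0) \<odot> q' + (u 0 \<odot> u' + u' \<odot> u 0) \<odot> q 0) = 2 *\<^sub>R (u' \<odot> q 0) + q'"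
    unfolding u(2) by (simp add: bilin scaleR_2)
  ultimately show ?thesis unfolding quad_eq by simp
qed

section \<open>Logarithmic functions on the cone\<close>

context
  fixes a :: "'a \<Rightarrow> real"
  assumes cont: "continuous_on cone a"
    and a_quad: "\<And>w x. w \<in> cone \<Longrightarrow> x \<in> cone \<Longrightarrow> a (quad w x) = a x + a (w \<odot> w)"
begin

lemma exp_half:
  "fc exp ((s / 2) *\<^sub>R x) \<odot> fc exp ((s / 2) *\<^sub>R x) = fc exp (s *\<^sub>R x)"
  unfolding fc_of_scale fc_mult exp_add[symmetric] by (simp add: field_simps)

lemma a_exp_add: "a (fc exp ((s + t) *\<^sub>R x)) = a (fc exp (s *\<^sub>R x)) + a (fc exp (t *\<^sub>R x))"
proof -
  have "quad (fc exp ((s / 2) *\<^sub>R x)) (fc exp (t *\<^sub>R x)) = fc exp ((s + t) *\<^sub>R x)"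
    unfolding fc_of_scale quad_fc
    by (rule fc_cong) (simp add: power2_eq_square exp_add[symmetric] field_simps)
  then show ?thesis using a_quad[OF fc_exp_cone fc_exp_cone, of "(s / 2) *\<^sub>R x" "t *\<^sub>R x"]
    by (simp add: exp_half)
qed

lemma continuous_a_exp: "continuous_on UNIV (\<lambda>x. a (fc exp x))"
  by (rule continuous_on_compose2[OF cont continuous_exp]) (use fc_exp_cone in auto)

lemma a_exp_scale: "a (fc exp (t *\<^sub>R x)) = t * a (fc exp x)"
proof -
  define f where "f t = a (fc exp (t *\<^sub>R x))" for t
  have add: "f (s + t) = f s + f t" for s t by (simp add: f_def a_exp_add)
  have cf: "continuous_on {0<..} f" unfolding f_def
    by (rule continuous_on_compose2[OF continuous_a_exp]) (auto intro!: continuous_intros)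
  have pos: "f t = t * f 1" if "t > 0" for t
    by (rule additive_on_pos_linear[OF _ cf that]) (rule add)
  have 0: "f 0 = 0" using add[of 0 0] by simp
  have "f t = t * f 1"
  proof (cases "t < 0")
    case True
    then have "f (- t) = - t * f 1" using pos[of "- t"] by linarith
    then show ?thesis using add[of t "- t"] 0 by simp
  next
    case False
    then show ?thesis using pos[of t] 0 by (cases "t = 0") (simp, linarith)
  qed
  then show ?thesis by (simp add: f_def)
qed

text \<open>A derivative of a at e that uses continuity only: homogeneity moves the factor 1 / t
  inside the exponential, where \<open>ln_curve\<close> provides the limit. The result depends on
  the curve only through its tangent.\<close>

lemma a_curve:
  assumes k0: "k 0 = e" and k: "(k has_vector_derivative v) (at (0::real))"
  shows "((\<lambda>t. a (k t) / t) \<longlongrightarrow> a (fc exp v)) (at 0)"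
proof -
  have "((\<lambda>t. a (fc exp ((1 / t) *\<^sub>R fc ln (k t)))) \<longlongrightarrow> a (fc exp v)) (at 0)"
    by (rule isCont_tendsto_compose[OF _ ln_curve(1)[OF assms]])
       (use continuous_a_exp continuous_on_eq_continuous_at in blast)
  moreover have "eventually (\<lambda>t. a (fc exp ((1 / t) *\<^sub>R fc ln (k t))) = a (k t) / t) (at 0)"
    using ln_curve(2)[OF assms] by eventually_elim (simp add: a_exp_scale fc_exp_ln)
  ultimately show ?thesis by (rule Lim_transform_eventually)
qed

lemma a_curve_unique:
  assumes k0: "k 0 = e" and k: "(k has_vector_derivative v) (at (0::real))"
    and r: "\<And>t. a (k t) = t * r"
  shows "a (fc exp v) = r"
proof -
  have "((\<lambda>t. r) \<longlongrightarrow> r) (at (0::real))" by simp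
  moreover have "eventually (\<lambda>t. r = a (k t) / t) (at 0)"
    unfolding eventually_at by (intro exI[of _ 1]) (simp add: r)
  ultimately have "((\<lambda>t. a (k t) / t) \<longlongrightarrow> r) (at 0)" by (rule Lim_transform_eventually)
  with a_curve[OF k0 k] show ?thesis using tendsto_unique[OF trivial_limit_at] by blast
qed

lemma exp0: "fc exp 0 = e"
  using fc_of_scale[of exp 0 0] fc_const[of 1 0] by simp

lemma half_curve: "((\<lambda>t. fc exp ((t / 2) *\<^sub>R x)) has_vector_derivative ((1/2) *\<^sub>R x)) (at 0)"
  using exp_curve[of "(1/2) *\<^sub>R x"] by simp

lemma linear_a_exp: "linear (\<lambda>x. a (fc exp x))"
proof (rule linearI)
  fix x y
  let ?k = "\<lambda>t. quad (fc exp ((t / 2) *\<^sub>R x)) (fc exp (t *\<^sub>R y))"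
  have "(?k has_vector_derivative (2 *\<^sub>R (((1/2) *\<^sub>R x) \<odot> fc exp (0 *\<^sub>R y)) + y)) (at 0)"
    by (rule quad_curve) (simp_all add: half_curve exp_curve exp0)
  then have k: "(?k has_vector_derivative (x + y)) (at 0)" by (simp add: exp0 bilin)
  have "a (?k t) = t * (a (fc exp x) + a (fc exp y))" for t
    by (simp add: a_quad fc_exp_cone exp_half a_exp_scale algebra_simps)
  from a_curve_unique[OF _ k this]
  show "a (fc exp (x + y)) = a (fc exp x) + a (fc exp y)" by (simp add: exp0)
qed (simp add: a_exp_scale)

theorem log_cauchy: "\<exists>\<beta>. \<forall>x\<in>cone. a x = \<beta> * ln (jdet x)"
proof -
  obtain B where B: "\<And>x. a (fc exp x) = inner B x"
    using linear_functional_inner[OF linear_a_exp] by blast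
  \<comment> \<open>The relation says that B has no component in the half Peirce space of c. It
    comes from a curve P(w^-1) P(exp (t x / 2)) w^2 through e: along it a equals t times
    \<open>inner B x\<close> exactly, while its tangent is not x.\<close>
  have cB: "c \<odot> (c \<odot> B) = c \<odot> B" if c: "idem c" for c
  proof -
    define w where "w = e + c"
    have w: "w \<in> cone" unfolding w_def by (intro cone_add_psd e_cone idem_psd c)
    have ww: "w \<odot> w = e + 3 *\<^sub>R c"
      using c by (rule_tac euclidean_eqI) (simp add: w_def bilin idem_def inner_add_left)
    have "inner B x = inner B (x + c \<odot> x - c \<odot> (c \<odot> x))" for x
    proof -
      let ?g = "x + c \<odot> x - c \<odot> (c \<odot> x)"
      let ?k = "\<lambda>t. quad (jinv w) (quad (fc exp ((t / 2) *\<^sub>R x)) (w \<odot> w))"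
      have "quad w ?g = x \<odot> (w \<odot> w)"
        unfolding quad_eq ww unfolding w_def comm[of x]
        using c by (rule_tac euclidean_eqI)
         (simp add: bilin idem_def idem_cubic[OF c] inner_add_left inner_diff_left field_simps)
      then have g: "quad (jinv w) (x \<odot> (w \<odot> w)) = ?g" using quad_jinv(2)[OF w] by metis
      have "((\<lambda>t. quad (fc exp ((t / 2) *\<^sub>R x)) (w \<odot> w)) has_vector_derivative
          (2 *\<^sub>R (((1/2) *\<^sub>R x) \<odot> (w \<odot> w)) + 0)) (at 0)"
        by (rule quad_curve) (simp_all add: half_curve exp0)
      then have "((\<lambda>t. quad (fc exp ((t / 2) *\<^sub>R x)) (w \<odot> w)) has_vector_derivative (x \<odot> (w \<odot> w))) (at 0)"
        by (simp add: bilin)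
      then have k: "(?k has_vector_derivative ?g) (at 0)"
        using bounded_linear.has_vector_derivative[OF _, of "quad (jinv w)"] linear_quad g
        by (metis linear_conv_bounded_linear)
      have "a (?k t) = t * inner B x" for t
      proof -
        have kc: "?k t \<in> cone" by (intro quad_cone jinv_cone fc_exp_cone cone_square w)
        have "a (?k t) + a (w \<odot> w) = a (quad (fc exp ((t / 2) *\<^sub>R x)) (w \<odot> w))"
          using a_quad[OF w kc] quad_jinv(1)[OF w] by simp
        also have "\<dots> = a (w \<odot> w) + t * inner B x"
          using a_quad[OF fc_exp_cone cone_square[OF w]] by (simp add: exp_half a_exp_scale B)
        finally show ?thesis by simp
      qed
      from a_curve_unique[OF _ k this] show ?thesis using quad_jinv_square[OF w] by (simp add: exp0 B)
    qed
    then have "inner B (c \<odot> x) = inner B (c \<odot> (c \<odot> x))" for x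
      by (simp add: inner_add_right inner_diff_right)
    then have "inner (c \<odot> B - c \<odot> (c \<odot> B)) x = 0" for x
      by (simp add: inner_diff_left inner_mult')
    then have "c \<odot> B - c \<odot> (c \<odot> B) = 0" using inner_eq_zero_iff by blast
    then show ?thesis by simp
  qed
  have eig: "c \<odot> B = inner B c *\<^sub>R c" if p: "prim c" for c
  proof -
    obtain \<mu> where \<mu>: "c \<odot> B = \<mu> *\<^sub>R c"
      using prim_peirce1[OF p cB[OF prim_idem[OF p]]] by blast
    have "inner (c \<odot> B) e = inner (\<mu> *\<^sub>R c) e" using \<mu> by simp
    then have "inner c B = \<mu>" unfolding inner_mult_e using prim_trace[OF p] by simp
    then show ?thesis using \<mu> by (simp add: inner_commute)
  qed
  obtain c0 where c0: "prim c0"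
  proof -
    obtain C l where "spectral e C l" using ex_frame by blast
    note C = spectralD[OF this]
    then have "C \<noteq> {}" using e_nz by auto
    then show ?thesis using C(2) that by blast
  qed
  have const: "inner B c = inner B c0" if "prim c" for c
  proof (rule prim_const[of "inner B", OF _ that c0])
    fix c d assume c: "prim c" and d: "prim d" and cd: "inner c d \<noteq> 0"
    have "inner (c \<odot> B) d = inner B c * inner c d" using eig[OF c] by simp
    moreover have "inner (c \<odot> B) d = inner c (d \<odot> B)" using inner_mult[of c B d] comm[of B d] by simp
    moreover have "inner c (d \<odot> B) = inner B d * inner c d" using eig[OF d] by simp
    ultimately show "inner B c = inner B d" using cd by simp
  qed
  have tr: "inner B x = inner B c0 * inner x e" for x
  proof -
    obtain C l where "spectral x C l" using ex_frame by blast
    note C = spectralD[OF this]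
    show ?thesis unfolding C(3) using const C(2) prim_trace
      by (simp add: inner_sum_left inner_sum_right sum_distrib_right[symmetric])
  qed
  have "a x = inner B c0 * ln (jdet x)" if "x \<in> cone" for x
    using B[of "fc ln x"] tr[of "fc ln x"] fc_exp_ln[OF that] ln_jdet[OF that] by simp
  then show ?thesis by blast
qed

end

end

section \<open>Changes of variable in Lebesgue integrals\<close>

abbreviation nn_lborel :: "('b::euclidean_space \<Rightarrow> ennreal) \<Rightarrow> ennreal"  (binder "\<integral>\<^sub>+" 10)
  where "nn_lborel f \<equiv> nn_integral lborel f"

lemma nn_integral_lborel_shift:
  fixes f :: "'a::euclidean_space \<Rightarrow> ennreal"
  assumes [measurable]: "f \<in> borel_measurable borel"
  shows "(\<integral>\<^sub>+x. f (a + x)) = (\<integral>\<^sub>+x. f x)"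
proof -
  have "(\<integral>\<^sub>+x. f x) = (\<integral>\<^sup>+x. f x \<partial>distr lborel borel ((+) a))"
    by (simp add: lborel_distr_plus)
  then show ?thesis by (simp add: nn_integral_distr)
qed

lemma nn_integral_lborel_scale:
  fixes f :: "'a::euclidean_space \<Rightarrow> ennreal"
  assumes [measurable]: "f \<in> borel_measurable borel" and c: "c \<noteq> 0"
  shows "(\<integral>\<^sub>+x. f x) = ennreal (\<bar>c\<bar> ^ DIM('a)) * (\<integral>\<^sub>+x. f (a + c *\<^sub>R x))"
proof -
  have "(\<integral>\<^sub>+x. f x) = (\<integral>\<^sup>+x. f x \<partial>density (distr lborel borel (\<lambda>x. a + c *\<^sub>R x)) (\<lambda>_. \<bar>c\<bar>^DIM('a)))"
    using lborel_affine[OF c, of a] by simp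
  also have "\<dots> = (\<integral>\<^sub>+x. ennreal (\<bar>c\<bar>^DIM('a)) * f (a + c *\<^sub>R x))"
    by (simp add: nn_integral_density nn_integral_distr)
  also have "\<dots> = ennreal (\<bar>c\<bar>^DIM('a)) * (\<integral>\<^sub>+x. f (a + c *\<^sub>R x))"
    by (rule nn_integral_cmult) simp
  finally show ?thesis .
qed

lemma nn_integral_lborel_reflect:
  fixes f :: "'a::euclidean_space \<Rightarrow> ennreal"
  assumes "f \<in> borel_measurable borel"
  shows "(\<integral>\<^sub>+x. f (a - x)) = (\<integral>\<^sub>+x. f x)"
  using nn_integral_lborel_scale[OF assms, of "-1" a] by simp

text \<open>Uniqueness of Haar measure: integrate \<open>f (T x) g (T x + y)\<close> over \<open>x\<close> and \<open>y\<close> in both orders.\<close>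

lemma nn_integral_linear_cross:
  fixes T T' :: "'a::euclidean_space \<Rightarrow> 'a" and f g :: "'a \<Rightarrow> ennreal"
  assumes T: "linear T" and T': "\<And>x. T (T' x) = x"
    and f [measurable]: "f \<in> borel_measurable borel" and g [measurable]: "g \<in> borel_measurable borel"
  shows "(\<integral>\<^sub>+x. f (T x)) * (\<integral>\<^sub>+x. g x) = (\<integral>\<^sub>+x. g (T x)) * (\<integral>\<^sub>+x. f x)"
proof -
  have "T \<in> borel_measurable borel"
    using T by (intro borel_measurable_continuous_onI linear_continuous_on)
      (simp add: linear_conv_bounded_linear)
  note [measurable] = this
  have "(\<integral>\<^sub>+x. f (T x)) * (\<integral>\<^sub>+x. g x)
      = (\<integral>\<^sub>+x. f (T x) * (\<integral>\<^sub>+y. g (T x + y)))"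
    by (simp add: nn_integral_lborel_shift nn_integral_multc)
  also have "\<dots> = (\<integral>\<^sub>+x. (\<integral>\<^sub>+y. f (T x) * g (T x + y)))"
    by (intro nn_integral_cong nn_integral_cmult[symmetric]) measurable
  also have "\<dots> = (\<integral>\<^sub>+y. (\<integral>\<^sub>+x. f (T x) * g (T x + y)))"
    by (rule lborel_pair.Fubini') measurable
  also have "\<dots> = (\<integral>\<^sub>+y. (\<integral>\<^sub>+x. f (T x - y) * g (T x)))"
  proof (rule nn_integral_cong)
    fix y
    \<comment> \<open>Translating x by - T' y removes y from the argument of g and puts it into that
      of f.\<close>
    have "(\<integral>\<^sub>+x. f (T x) * g (T x + y))
        = (\<integral>\<^sub>+x. f (T (- T' y + x)) * g (T (- T' y + x) + y))"
      by (rule nn_integral_lborel_shift[symmetric, of "\<lambda>x. f (T x) * g (T x + y)"]) measurable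
    also have "\<dots> = (\<integral>\<^sub>+x. f (T x - y) * g (T x))"
      using linear_diff[OF T, of _ "T' y"] by (intro nn_integral_cong) (simp add: T')
    finally show "(\<integral>\<^sub>+x. f (T x) * g (T x + y)) = (\<integral>\<^sub>+x. f (T x - y) * g (T x))" .
  qed
  also have "\<dots> = (\<integral>\<^sub>+x. (\<integral>\<^sub>+y. f (T x - y) * g (T x)))"
    by (rule lborel_pair.Fubini') measurable
  also have "\<dots> = (\<integral>\<^sub>+x. g (T x) * (\<integral>\<^sub>+y. f (T x - y)))"
    by (intro nn_integral_cong) (simp add: mult.commute nn_integral_cmult)
  also have "\<dots> = (\<integral>\<^sub>+x. g (T x)) * (\<integral>\<^sub>+x. f x)"
    by (simp add: nn_integral_lborel_reflect nn_integral_multc)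
  finally show ?thesis .
qed

section \<open>Volumes of order intervals and multiplicativity of the determinant\<close>

context simple_jordan begin

abbreviation dimr :: real where "dimr \<equiv> DIM('a) / jordan_rank m e"

definition order_ball :: "'a \<Rightarrow> 'a set" where "order_ball v = {y. y \<in> cone \<and> v - y \<in> cone}"

definition vol :: "'a \<Rightarrow> real" where "vol v = measure lborel (order_ball v)"

lemma open_order_ball: "open (order_ball v)"
proof -
  have "open ((\<lambda>y. v - y) -` cone)" by (intro open_vimage open_cone continuous_intros)
  moreover have "order_ball v = cone \<inter> (\<lambda>y. v - y) -` cone" by (auto simp: order_ball_def)
  ultimately show ?thesis using open_cone by auto
qed

lemma order_ball_meas [measurable]: "order_ball v \<in> sets borel"
  by (simp add: open_order_ball)

lemma cone_meas [measurable]: "cone \<in> sets borel"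
  by (simp add: open_cone)

lemma cone_norm_le: assumes "y \<in> psd" shows "norm y \<le> inner y e"
proof -
  obtain C l where "spectral y C l" using ex_frame by blast
  note C = spectralD(1,2)[OF this] and y = spectralD(3)[OF this]
  have l: "l c \<ge> 0" if "c \<in> C" for c
    using assms C(2)[OF that] prim_frame_inner[OF C(1) that C(2)[OF that], of l] y 
    unfolding psd_iff by fastforce
  have "norm y \<le> (\<Sum>c\<in>C. norm (l c *\<^sub>R c))" unfolding y by (rule norm_sum)
  also have "\<dots> = (\<Sum>c\<in>C. l c)" using l C(2) prim_norm by (intro sum.cong) auto
  also have "\<dots> = inner y e" unfolding y using C(2) prim_trace by (simp add: inner_sum_left)
  finally show ?thesis .
qed

lemma bounded_order_ball: "bounded (order_ball v)"
proof (rule boundedI)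
  fix y assume "y \<in> order_ball v"
  then have y: "y \<in> psd" "v - y \<in> psd" using cone_psd by (auto simp: order_ball_def)
  have "norm y \<le> inner y e" by (rule cone_norm_le[OF y(1)])
  also have "\<dots> \<le> inner v e" using psd_inner_psd[OF y(2) cone_psd[OF e_cone]] by (simp add: inner_diff_left)
  finally show "norm y \<le> inner v e" .
qed

lemma vol_emeasure: "emeasure lborel (order_ball v) = ennreal (vol v)"
  unfolding vol_def using emeasure_bounded_finite[OF bounded_order_ball] 
  by (intro emeasure_eq_ennreal_measure) (auto simp: less_top)

lemma open_emeasure_pos:
  fixes S :: "'b::euclidean_space set"
  assumes "open S" "x \<in> S" shows "emeasure lborel S > 0"
proof -
  obtain r where r: "r > 0" "ball x r \<subseteq> S" using assms open_contains_ball by blast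
  have "0 < emeasure lborel (ball x r)" using r(1) by (simp add: emeasure_ball unit_ball_vol_pos)
  also have "\<dots> \<le> emeasure lborel S" using r(2) assms(1) by (intro emeasure_mono) auto
  finally show ?thesis .
qed

lemma vol_pos: assumes "v \<in> cone" shows "vol v > 0"
proof -
  have "v - (1/2) *\<^sub>R v = (1/2) *\<^sub>R v"
    by (rule euclidean_eqI) (simp add: inner_diff_left)
  then have "(1/2) *\<^sub>R v \<in> order_ball v"
    using cone_scale[OF assms, of "1/2"] by (simp add: order_ball_def)
  from open_emeasure_pos[OF open_order_ball this] show ?thesis by (simp add: vol_emeasure)
qed

lemma nn_integral_quad_order_ball:
  assumes w: "w \<in> cone"
  shows "(\<integral>\<^sub>+x. indicator (order_ball (quad w v)) (quad w x)) = ennreal (vol v)"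
proof -
  have "quad w x \<in> order_ball (quad w v) \<longleftrightarrow> x \<in> order_ball v" for x
    unfolding order_ball_def using quad_cone_iff[OF w, of x] quad_cone_iff[OF w, of "v - x"]
    by (simp add: quad_diff)
  then have "indicator (order_ball (quad w v)) (quad w x) = (indicator (order_ball v) x :: ennreal)" for x
    by (simp add: indicator_def)
  then show ?thesis by (simp add: vol_emeasure)
qed

text \<open>P(w) carries the order interval below v onto the one below P(w) v. With the indicator of
  the latter as reference function, the Jacobian of P(w) appears as a ratio of volumes.\<close>

lemma linear_scaling_nn_integral:
  assumes w: "w \<in> cone" and f: "f \<in> borel_measurable borel"
  shows "ennreal (vol v) * (\<integral>\<^sub>+x. f x) = ennreal (vol (quad w v)) * (\<integral>\<^sub>+x. f (quad w x))"
proof -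
  let ?g = "indicator (order_ball (quad w v)) :: 'a \<Rightarrow> ennreal"
  have "(\<integral>\<^sub>+x. f (quad w x)) * (\<integral>\<^sub>+x. ?g x) = (\<integral>\<^sub>+x. ?g (quad w x)) * (\<integral>\<^sub>+x. f x)"
    by (rule nn_integral_linear_cross[OF linear_quad quad_jinv(1)[OF w] f]) simp
  then show ?thesis unfolding nn_integral_quad_order_ball[OF w] by (simp add: vol_emeasure mult.commute)
qed

text \<open>After division by the square of \<open>vol e\<close> this is the equation of
  \<open>log_cauchy\<close> for the logarithm of \<open>vol v / vol e\<close>.\<close>

lemma vol_quad: assumes w: "w \<in> cone"
  shows "vol (quad w v) * vol e = vol (w \<odot> w) * vol v"
proof -
  have "ennreal (vol e) * (\<integral>\<^sub>+x. indicator (order_ball (quad w v)) x)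
      = ennreal (vol (quad w e)) * (\<integral>\<^sub>+x. indicator (order_ball (quad w v)) (quad w x))"
    by (rule linear_scaling_nn_integral[OF w]) simp
  then have "ennreal (vol e * vol (quad w v)) = ennreal (vol (quad w e) * vol v)"
    by (simp add: nn_integral_quad_order_ball[OF w] vol_emeasure ennreal_mult vol_def)
  moreover have "vol e * vol (quad w v) \<ge> 0" "vol (quad w e) * vol v \<ge> 0" by (simp_all add: vol_def)
  ultimately have "vol e * vol (quad w v) = vol (quad w e) * vol v" by (simp only: ennreal_inj)
  then show ?thesis by (simp add: quad_e mult.commute)
qed

lemma vol_scale: assumes s: "s > 0" shows "vol (s *\<^sub>R v) = s ^ DIM('a) * vol v"
proof -
  let ?g = "indicator (order_ball (s *\<^sub>R v)) :: 'a \<Rightarrow> ennreal"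
  have c: "s *\<^sub>R x \<in> cone \<longleftrightarrow> x \<in> cone" for x
    using s by (simp add: cone_iff zero_less_mult_iff)
  have "s *\<^sub>R x \<in> order_ball (s *\<^sub>R v) \<longleftrightarrow> x \<in> order_ball v" for x
    using c[of x] c[of "v - x"] by (simp add: order_ball_def scaleR_diff_right)
  then have "?g (0 + s *\<^sub>R x) = indicator (order_ball v) x" for x by (simp add: indicator_def)
  then have "(\<integral>\<^sub>+x. ?g x) = ennreal (\<bar>s\<bar> ^ DIM('a)) * ennreal (vol v)"
    using nn_integral_lborel_scale[of ?g s 0] s by (simp add: vol_emeasure)
  then have "ennreal (vol (s *\<^sub>R v)) = ennreal (s ^ DIM('a) * vol v)"
    using s by (simp add: vol_emeasure ennreal_mult vol_def)
  moreover have "vol (s *\<^sub>R v) \<ge> 0" "s ^ DIM('a) * vol v \<ge> 0" using s by (simp_all add: vol_def)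
  ultimately show ?thesis by (simp only: ennreal_inj)
qed

lemma vol_mono: assumes "y - x \<in> psd" shows "vol x \<le> vol y"
proof -
  have "order_ball x \<subseteq> order_ball y"
  proof
    fix z assume "z \<in> order_ball x"
    then have z: "z \<in> cone" "x - z \<in> cone" by (auto simp: order_ball_def)
    have "(x - z) + (y - x) \<in> cone" by (rule cone_add_psd[OF z(2) assms])
    then show "z \<in> order_ball y" using z(1) by (simp add: order_ball_def)
  qed
  then have "ennreal (vol x) \<le> ennreal (vol y)"
    unfolding vol_emeasure[symmetric] by (intro emeasure_mono) auto
  then show ?thesis by (simp add: vol_def)
qed

text \<open>Near x the sandwich (1 - s) x \<le> y \<le> (1 + s) x holds in the order of the cone,
  with s proportional to \<open>norm (y - x)\<close>; monotonicity and scaling of the volume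
  finish.\<close>

lemma continuous_vol: "continuous_on cone vol"
proof -
  have "(vol \<longlongrightarrow> vol x) (at x)" if x: "x \<in> cone" for x
  proof -
    obtain \<delta> where \<delta>: "\<delta> > 0" "\<And>p. prim p \<Longrightarrow> inner x p \<ge> \<delta>" using x unfolding cone_iff_lower by blast
    define s where "s y = norm (y - x) / \<delta>" for y
    have sx: "s y *\<^sub>R x + (y - x) \<in> psd" "s y *\<^sub>R x - (y - x) \<in> psd" for y
    proof -
      have "\<bar>inner (y - x) p\<bar> \<le> s y * inner x p" if "prim p" for p
      proof -
        have "\<bar>inner (y - x) p\<bar> \<le> s y * \<delta>"
          using Cauchy_Schwarz_ineq2[of "y - x" p] prim_norm[OF that] \<delta>(1) by (simp add: s_def)
        also have "\<dots> \<le> s y * inner x p" using \<delta> that by (intro mult_left_mono) (auto simp: s_def)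
        finally show ?thesis .
      qed
      then show "s y *\<^sub>R x + (y - x) \<in> psd" "s y *\<^sub>R x - (y - x) \<in> psd"
        unfolding psd_iff by (fastforce simp: inner_add_left inner_diff_left abs_le_iff)+
    qed
    have "((\<lambda>y. norm (y - x) / \<delta>) \<longlongrightarrow> norm (x - x) / \<delta>) (at x)"
      by (intro tendsto_intros) (use \<delta>(1) in simp)
    then have s0: "(s \<longlongrightarrow> 0) (at x)" by (simp add: s_def[abs_def])
    show ?thesis
    proof (rule tendsto_sandwich)
      have "eventually (\<lambda>y. s y < 1) (at x)" using order_tendstoD(2)[OF s0, of 1] by simp
      then show "eventually (\<lambda>y. (1 - s y) ^ DIM('a) * vol x \<le> vol y) (at x)"
      proof (rule eventually_mono)
        fix y assume "s y < 1"
        moreover have "vol ((1 - s y) *\<^sub>R x) \<le> vol y"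
          by (rule vol_mono) (use sx(1)[of y] in \<open>simp add: algebra_simps\<close>)
        ultimately show "(1 - s y) ^ DIM('a) * vol x \<le> vol y" by (simp add: vol_scale)
      qed
      have "vol y \<le> (1 + s y) ^ DIM('a) * vol x" for y
      proof -
        have "vol y \<le> vol ((1 + s y) *\<^sub>R x)"
          by (rule vol_mono) (use sx(2)[of y] in \<open>simp add: algebra_simps\<close>)
        moreover have "s y \<ge> 0" using \<delta>(1) by (simp add: s_def)
        ultimately show ?thesis by (simp add: vol_scale)
      qed
      then show "eventually (\<lambda>y. vol y \<le> (1 + s y) ^ DIM('a) * vol x) (at x)" by simp
      have "((\<lambda>y. (1 - s y) ^ DIM('a) * vol x) \<longlongrightarrow> (1 - 0) ^ DIM('a) * vol x) (at x)"
        "((\<lambda>y. (1 + s y) ^ DIM('a) * vol x) \<longlongrightarrow> (1 + 0) ^ DIM('a) * vol x) (at x)"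
        by (intro tendsto_intros s0)+
      then show "((\<lambda>y. (1 - s y) ^ DIM('a) * vol x) \<longlongrightarrow> vol x) (at x)"
        "((\<lambda>y. (1 + s y) ^ DIM('a) * vol x) \<longlongrightarrow> vol x) (at x)" by simp_all
    qed
  qed
  then show ?thesis by (simp add: continuous_on_eq_continuous_at[OF open_cone] isCont_def)
qed

lemma rank_pos: "real (jordan_rank m e) > 0"
  unfolding jordan_rank_eq using e_nz by simp

lemma rank_nz [simp]: "jordan_rank m e \<noteq> 0" using rank_pos by simp

lemma dimr_pos: "dimr > 0" using rank_pos by simp

lemma fc_scalar: "fc \<phi> (s *\<^sub>R e) = \<phi> s *\<^sub>R e"
  using fc_fc[of \<phi> "\<lambda>t. s" e] fc_const[of s e] fc_const[of "\<phi> s" e] by simp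

lemma ln_jdet_scalar: "s > 0 \<Longrightarrow> ln (jdet (s *\<^sub>R e)) = ln s * jordan_rank m e"
  using ln_jdet[OF cone_scale[OF e_cone]] by (simp add: fc_scalar jordan_rank_eq)

lemma jdet_e: "jdet e = 1"
  using jdet_eq[OF e_cone] fc_scalar[of ln 1] by simp

lemma vol_jdet: assumes x: "x \<in> cone" shows "vol x = vol e * jdet x powr dimr"
proof -
  have ve: "vol e > 0" by (rule vol_pos[OF e_cone])
  have "\<exists>\<beta>. \<forall>x\<in>cone. ln (vol x / vol e) = \<beta> * ln (jdet x)"
  proof (rule log_cauchy)
    show "continuous_on cone (\<lambda>x. ln (vol x / vol e))"
      using ve vol_pos by (intro continuous_intros continuous_vol) (auto dest: vol_pos)
    fix w x assume w: "w \<in> cone" and x: "x \<in> cone"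
    have eq: "vol (quad w x) / vol e = (vol x / vol e) * (vol (w \<odot> w) / vol e)"
      using vol_quad[OF w, of x] ve by (simp add: field_simps)
    show "ln (vol (quad w x) / vol e) = ln (vol x / vol e) + ln (vol (w \<odot> w) / vol e)"
      unfolding eq using vol_pos[OF x] vol_pos[OF cone_square[OF w]] ve by (intro ln_mult_pos) auto
  qed
  then obtain \<beta> where \<beta>: "\<And>x. x \<in> cone \<Longrightarrow> ln (vol x / vol e) = \<beta> * ln (jdet x)" by blast
  \<comment> \<open>The exponent is read off at 2 e, where the volume grows by 2^dim and the
    determinant by 2^r.\<close>
  have "real DIM('a) * ln 2 = \<beta> * (ln 2 * jordan_rank m e)"
    using \<beta>[OF cone_scale[OF e_cone, of 2]] ve by (simp add: vol_scale ln_jdet_scalar ln_realpow)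
  then have "real DIM('a) = \<beta> * jordan_rank m e" by simp
  then have \<beta>': "\<beta> = dimr" using rank_pos by (simp add: field_simps)
  have "vol x / vol e = exp (\<beta> * ln (jdet x))"
    using \<beta>[OF x] vol_pos[OF x] ve by (metis exp_ln divide_pos_pos)
  also have "\<dots> = jdet x powr dimr" using jdet_pos[OF x] by (simp add: powr_def \<beta>')
  finally show ?thesis using ve by (simp add: field_simps)
qed

lemma jdet_quad: assumes w: "w \<in> cone" and x: "x \<in> cone"
  shows "jdet (quad w x) = jdet x * jdet (w \<odot> w)"
proof -
  have ve: "vol e > 0" by (rule vol_pos[OF e_cone])
  note q = quad_cone[OF w x] and ww = cone_square[OF w]
  have "jdet (quad w x) powr dimr = jdet x powr dimr * jdet (w \<odot> w) powr dimr"
    using vol_quad[OF w, of x] ve unfolding vol_jdet[OF q] vol_jdet[OF x] vol_jdet[OF ww]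
    by (simp add: field_simps)
  also have "\<dots> = (jdet x * jdet (w \<odot> w)) powr dimr"
    using jdet_pos[OF x] jdet_pos[OF ww] by (simp add: powr_mult)
  finally have "(jdet (quad w x) powr dimr) powr (1 / dimr) = ((jdet x * jdet (w \<odot> w)) powr dimr) powr (1 / dimr)"
    by simp
  then show ?thesis using jdet_pos[OF x] jdet_pos[OF ww] jdet_pos[OF q] dimr_pos by (simp add: powr_powr)
qed

lemma continuous_jdet: "continuous_on cone jdet"
proof -
  have ve: "vol e > 0" by (rule vol_pos[OF e_cone])
  have "continuous_on cone (\<lambda>x. (vol x / vol e) powr (1 / dimr))"
    using ve vol_pos by (intro continuous_intros continuous_vol) (auto simp: less_imp_neq[symmetric])
  moreover have "(vol x / vol e) powr (1 / dimr) = jdet x" if "x \<in> cone" for x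
    using that ve dimr_pos jdet_pos[OF that] by (simp add: vol_jdet powr_powr)
  ultimately show ?thesis using continuous_on_cong by fastforce
qed

lemma nn_integral_quad:
  assumes w: "w \<in> cone" and f: "f \<in> borel_measurable borel"
  shows "(\<integral>\<^sub>+x. f x) = ennreal (jdet (w \<odot> w) powr dimr) * (\<integral>\<^sub>+x. f (quad w x))"
proof -
  have ve: "vol e > 0" by (rule vol_pos[OF e_cone])
  have "ennreal (vol e) * (\<integral>\<^sub>+x. f x)
     = ennreal (vol e) * (ennreal (jdet (w \<odot> w) powr dimr) * (\<integral>\<^sub>+x. f (quad w x)))"
    using linear_scaling_nn_integral[OF w f, of e] ve
    by (simp add: quad_e vol_jdet[OF cone_square[OF w]] ennreal_mult mult.assoc)
  then show ?thesis using ve by (simp add: ennreal_mult_cancel_left)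
qed

section \<open>The determinant along a line\<close>

text \<open>The cases c = 0 and c = e are separate because a frame does not contain 0.\<close>

lemma fc_two:
  assumes c: "idem c" shows "fc \<phi> (\<alpha> *\<^sub>R c + \<beta> *\<^sub>R (e - c)) = \<phi> \<alpha> *\<^sub>R c + \<phi> \<beta> *\<^sub>R (e - c)"
proof -
  consider "c = 0" | "c = e" | "c \<noteq> 0" "e - c \<noteq> 0" by fastforce
  then show ?thesis
  proof cases
    case 3
    have cc: "c \<odot> c = c" using c by (simp add: idem_def)
    have ne: "c \<noteq> e - c"
    proof
      assume "c = e - c"
      then have "c \<odot> c = c \<odot> (e - c)" by simp
      then show False using cc 3 by (simp add: bilin)
    qed
    have fr: "frame {c, e - c}"
      unfolding frame_def orth_idems_def using c idem_compl[OF c] 3 ne cc by (auto simp: bilin)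
    have "fc \<phi> (\<Sum>d\<in>{c, e - c}. (if d = c then \<alpha> else \<beta>) *\<^sub>R d) = (\<Sum>d\<in>{c, e - c}. \<phi> (if d = c then \<alpha> else \<beta>) *\<^sub>R d)"
      by (rule fc_eq[OF fr])
    then show ?thesis using ne by auto
  qed (simp_all add: fc_scalar)
qed

lemma cone_inner_pos: assumes "x \<in> cone" "y \<in> psd" "inner y e > 0" shows "inner x y > 0"
proof -
  obtain \<delta> where \<delta>: "\<delta> > 0" "x - \<delta> *\<^sub>R e \<in> psd" using cone_lower_e[OF assms(1)] by blast
  have "0 \<le> inner (x - \<delta> *\<^sub>R e) y" by (rule psd_inner_psd[OF \<delta>(2) assms(2)])
  then have "inner x y \<ge> \<delta> * inner y e" by (simp add: inner_diff_left inner_commute[of y e])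
  moreover have "\<delta> * inner y e > 0" using \<delta>(1) assms(3) by simp
  ultimately show ?thesis by linarith
qed

text \<open>Idempotence and trace 1 are what \<open>quad_prim\<close> guarantees for a transported
  primitive idempotent. The element is (1 + t) c + (e - c), so the logarithm of its determinant is
  ln (1 + t) times the trace of c.\<close>

lemma jdet_line_e:
  assumes c: "idem c" and tr: "inner c e = 1"
  shows "e + t *\<^sub>R c \<in> cone \<longleftrightarrow> 1 + t > 0" and "1 + t > 0 \<Longrightarrow> jdet (e + t *\<^sub>R c) = 1 + t"
proof -
  show iff: "e + t *\<^sub>R c \<in> cone \<longleftrightarrow> 1 + t > 0"
  proof
    assume "e + t *\<^sub>R c \<in> cone"
    from cone_inner_pos[OF this idem_psd[OF c]] tr show "1 + t > 0"
      using idem_norm[OF c] by (simp add: inner_add_left inner_commute[of e c])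
  next
    assume t: "1 + t > 0"
    show "e + t *\<^sub>R c \<in> cone" unfolding cone_iff
    proof (intro allI impI)
      fix p assume p: "prim p"
      have 0: "inner c p \<ge> 0" using idem_inner_nonneg c prim_idem[OF p] by blast
      have "inner (e - c) p \<ge> 0" using idem_inner_nonneg idem_compl[OF c] prim_idem[OF p] by blast
      then have 1: "inner c p \<le> 1" using prim_trace[OF p] by (simp add: inner_diff_left inner_commute[of e p])
      have "1 + t * inner c p > 0"
      proof (cases "t \<ge> 0")
        case True
        then show ?thesis using 0 by (simp add: add_pos_nonneg)
      next
        case False
        then have "t * inner c p \<ge> t" using 1 by simp
        then show ?thesis using t by linarith
      qed
      then show "inner (e + t *\<^sub>R c) p > 0" using prim_trace[OF p] by (simp add: inner_add_left inner_commute[of e p])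
    qed
  qed
  assume t: "1 + t > 0"
  have eq: "e + t *\<^sub>R c = (1 + t) *\<^sub>R c + 1 *\<^sub>R (e - c)" by (simp add: scaleR_add_left)
  have "fc ln (e + t *\<^sub>R c) = ln (1 + t) *\<^sub>R c" unfolding eq fc_two[OF c] by simp
  then show "jdet (e + t *\<^sub>R c) = 1 + t" using jdet_eq iff t tr by simp
qed

text \<open>With w^2 = z, the operator P(w^-1) moves the line to one through e whose direction
  P(w^-1) c is a multiple of an idempotent of trace 1; \<mu> is that multiple.\<close>

lemma jdet_line:
  assumes z: "z \<in> cone" and c: "prim c"
  obtains \<mu> where "\<mu> > 0" "\<And>s. z + s *\<^sub>R c \<in> cone \<longleftrightarrow> 1 + s * \<mu> > 0"
    "\<And>s. 1 + s * \<mu> > 0 \<Longrightarrow> jdet (z + s *\<^sub>R c) = jdet z * (1 + s * \<mu>)"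
proof -
  define w where "w = jsqrt z"
  have w: "w \<in> cone" and ww: "w \<odot> w = z" using jsqrt_cone[OF z] jsqrt_square[OF z] by (simp_all add: w_def)
  obtain k c' where k: "k \<ge> 0" and c': "idem c'" and q: "quad (jinv w) c = k *\<^sub>R c'"
    and tr: "k > 0 \<longrightarrow> inner c' e = inner c e" using quad_prim[OF c, of "jinv w"] by blast
  have cq: "c = k *\<^sub>R quad w c'" using quad_jinv(1)[OF w, of c] q by (simp add: quad_scale)
  then have "k \<noteq> 0" using prim_nz[OF c] by auto
  then have kp: "k > 0" using k by simp
  have tr1: "inner c' e = 1" using tr kp prim_trace[OF c] by simp
  have zs: "z + s *\<^sub>R c = quad w (e + (s * k) *\<^sub>R c')" for s
  proof -
    have "quad w (e + (s * k) *\<^sub>R c') = z + s *\<^sub>R (k *\<^sub>R quad w c')"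
      by (simp add: quad_add quad_scale quad_e ww)
    then show ?thesis using cq by simp
  qed
  have 1: "z + s *\<^sub>R c \<in> cone \<longleftrightarrow> 1 + s * k > 0" for s
    unfolding zs quad_cone_iff[OF w] by (rule jdet_line_e(1)[OF c' tr1])
  have "jdet (z + s *\<^sub>R c) = jdet z * (1 + s * k)" if "1 + s * k > 0" for s
    unfolding zs using jdet_line_e[OF c' tr1, of "s * k"] that jdet_quad[OF w, of "e + (s * k) *\<^sub>R c'"] ww by simp
  with 1 kp that show ?thesis by blast
qed

section \<open>Integrability of the Wishart kernel\<close>

lemma ex_prim: obtains c where "prim c"
proof -
  obtain C l where "spectral e C l" using ex_frame by blast
  note C = spectralD[OF this]
  then have "C \<noteq> {}" using e_nz by auto
  then show ?thesis using C(2) that by blast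
qed

text \<open>The Wishart density without its constant, with \<kappa> = p - dim / r; the bound p > dim
  / r - 1 becomes \<kappa> > -1.\<close>

definition kernel :: "real \<Rightarrow> 'a \<Rightarrow> 'a \<Rightarrow> real"
  where "kernel \<kappa> \<alpha> y = jdet y powr \<kappa> * exp (- inner \<alpha> y) * indicator cone y"

lemma kernel_meas [measurable]: "kernel \<kappa> \<alpha> \<in> borel_measurable borel"
proof -
  have "continuous_on cone (\<lambda>y. jdet y powr \<kappa> * exp (- inner \<alpha> y))"
    using jdet_pos by (intro continuous_intros continuous_jdet) (auto dest: jdet_pos)
  then have "(\<lambda>y. indicator cone y *\<^sub>R (jdet y powr \<kappa> * exp (- inner \<alpha> y))) \<in> borel_measurable borel"
    by (intro borel_measurable_continuous_on_indicator) simp_all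
  moreover have "kernel \<kappa> \<alpha> = (\<lambda>y. indicator cone y *\<^sub>R (jdet y powr \<kappa> * exp (- inner \<alpha> y)))"
    by (auto simp: kernel_def)
  ultimately show ?thesis by simp
qed

abbreviation mass :: "real \<Rightarrow> 'a \<Rightarrow> ennreal"
  where "mass \<kappa> \<alpha> \<equiv> (\<integral>\<^sub>+y. ennreal (kernel \<kappa> \<alpha> y))"

lemma kernel_nonneg: "kernel \<kappa> \<alpha> y \<ge> 0" by (simp add: kernel_def)

text \<open>The translates of this open set by nonnegative integer multiples of \<open>c\<close> are disjoint.\<close>

definition edge :: "'a \<Rightarrow> 'a set" where "edge c = {z. z \<in> cone \<and> z - c \<notin> psd}"

lemma open_edge: "open (edge c)"
proof -
  have "open ((\<lambda>z. z - c) -` (- psd))"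
    by (intro open_vimage continuous_intros) (simp add: closed_psd open_Compl)
  moreover have "edge c = cone \<inter> (\<lambda>z. z - c) -` (- psd)" by (auto simp: edge_def)
  ultimately show ?thesis using open_cone by auto
qed

lemma edge_meas [measurable]: "edge c \<in> sets borel" by (simp add: open_edge)

lemma edge_pos: assumes c: "prim c" shows "emeasure lborel (edge c) > 0"
proof -
  have "e - (1/2) *\<^sub>R c \<in> cone"
    using jdet_line_e(1)[OF prim_idem[OF c] prim_trace[OF c], of "-1/2"] by simp
  moreover have "inner (e - (1/2) *\<^sub>R c - c) c < 0"
    using prim_trace[OF c] idem_norm[OF prim_idem[OF c]] by (simp add: inner_diff_left inner_commute[of e c])
  then have "e - (1/2) *\<^sub>R c - c \<notin> psd" using c by (auto simp: psd_iff not_le)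
  ultimately have "e - (1/2) *\<^sub>R c \<in> edge c" by (simp add: edge_def)
  then show ?thesis by (rule open_emeasure_pos[OF open_edge])
qed

lemma nn_integral_edge_top:
  assumes c: "prim c" and inf: "\<And>z. z \<in> edge c \<Longrightarrow> F z = (\<infinity>::ennreal)"
    and F [measurable]: "F \<in> borel_measurable borel"
  shows "(\<integral>\<^sub>+z. F z) = \<infinity>"
proof -
  have "(\<integral>\<^sub>+z. \<infinity> * indicator (edge c) z) \<le> (\<integral>\<^sub>+z. F z)"
    by (intro nn_integral_mono) (auto simp: indicator_def inf)
  moreover have "(\<integral>\<^sub>+z. \<infinity> * indicator (edge c) z) = \<infinity> * emeasure lborel (edge c)"
    by (rule nn_integral_cmult_indicator) simp
  moreover have "emeasure lborel (edge c) \<noteq> 0" using edge_pos[OF c] by auto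
  ultimately show ?thesis by (simp add: ennreal_top_mult top_unique)
qed

text \<open>If z - c is not a square, it lies outside the cone, so 1 - \<mu> \<le> 0: the
  determinant vanishes before more than c has been subtracted from z.\<close>

lemma kernel_line:
  assumes z: "z \<in> cone" and c: "prim c"
  obtains \<mu> where "\<mu> > 0" "z - c \<notin> psd \<Longrightarrow> \<mu> \<ge> 1"
    "\<And>s. 1 + s * \<mu> > 0 \<Longrightarrow> kernel \<kappa> \<alpha> (z + s *\<^sub>R c)
      = jdet z powr \<kappa> * exp (- inner \<alpha> z) * ((1 + s * \<mu>) powr \<kappa> * exp (- (s * inner \<alpha> c)))"
proof -
  obtain \<mu> where \<mu>: "\<mu> > 0" "\<And>s. z + s *\<^sub>R c \<in> cone \<longleftrightarrow> 1 + s * \<mu> > 0"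
    "\<And>s. 1 + s * \<mu> > 0 \<Longrightarrow> jdet (z + s *\<^sub>R c) = jdet z * (1 + s * \<mu>)"
    using jdet_line[OF z c] by blast
  have "\<mu> \<ge> 1" if "z - c \<notin> psd" using \<mu>(2)[of "-1"] that cone_psd[of "z - c"] by auto
  moreover have "kernel \<kappa> \<alpha> (z + s *\<^sub>R c)
      = jdet z powr \<kappa> * exp (- inner \<alpha> z) * ((1 + s * \<mu>) powr \<kappa> * exp (- (s * inner \<alpha> c)))"
    if p: "1 + s * \<mu> > 0" for s
    using \<mu>(2)[of s] \<mu>(3)[OF p] p jdet_pos[OF z]
    by (simp add: kernel_def powr_mult inner_add_right exp_add[symmetric] mult_ac)
  ultimately show ?thesis using that \<mu>(1) by blast
qed

text \<open>Averaging the kernel over the shifts by - t c with t in [0, 1] preserves its mass. For z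
  in \<open>edge c\<close> the determinant at z - t c is proportional to 1 - t \<mu> and reaches 0
  at some t \<le> 1, where a power \<kappa> \<le> -1 is not integrable.\<close>

lemma kernel_exponent:
  assumes fin: "mass \<kappa> \<alpha> < \<infinity>"
  shows "\<kappa> > -1"
proof (rule ccontr)
  assume "\<not> \<kappa> > -1"
  then have \<kappa>: "\<kappa> \<le> -1" by simp
  obtain c where c: "prim c" by (rule ex_prim)
  define F where "F z = (\<integral>\<^sup>+t. ennreal (kernel \<kappa> \<alpha> (z - t *\<^sub>R c)) * indicator {0..1} t \<partial>(lborel :: real measure))" for z
  have [measurable]: "F \<in> borel_measurable borel" unfolding F_def by measurable
  have "F z = \<infinity>" if z: "z \<in> edge c" for z
  proof (rule ccontr)
    assume "F z \<noteq> \<infinity>"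
    then obtain r where r: "r \<ge> 0" "F z = ennreal r" by (cases "F z") auto
    have zc: "z \<in> cone" "z - c \<notin> psd" using z by (auto simp: edge_def)
    obtain \<mu> where \<mu>: "\<mu> > 0" "z - c \<notin> psd \<Longrightarrow> \<mu> \<ge> 1"
      "\<And>s. 1 + s * \<mu> > 0 \<Longrightarrow> kernel \<kappa> \<alpha> (z + s *\<^sub>R c)
        = jdet z powr \<kappa> * exp (- inner \<alpha> z) * ((1 + s * \<mu>) powr \<kappa> * exp (- (s * inner \<alpha> c)))"
      using kernel_line[OF zc(1) c] by blast
    note \<mu>1 = \<mu>(2)[OF zc(2)]
    define K where "K = jdet z powr \<kappa> * exp (- inner \<alpha> z) * exp (- \<bar>inner \<alpha> c\<bar>)"
    have K: "K > 0" using jdet_pos[OF zc(1)] by (simp add: K_def)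
    \<comment> \<open>Chosen so that the integral of K / (1 - t \<mu>) over [0, T], which is (K /
      \<mu>) ln (1 / \<epsilon>), equals r + 1 and exceeds the supposed value r.\<close>
    define \<epsilon> where "\<epsilon> = exp (- ((r + 1) * \<mu> / K))"
    have e0: "\<epsilon> > 0" by (simp add: \<epsilon>_def)
    have "(r + 1) * \<mu> / K \<ge> 0" using r(1) \<mu>(1) K by (intro divide_nonneg_pos mult_nonneg_nonneg) auto
    then have e1: "\<epsilon> \<le> 1" by (simp add: \<epsilon>_def)
    define T where "T = (1 - \<epsilon>) / \<mu>"
    have T: "0 \<le> T" "T \<le> 1" using e0 e1 \<mu>1 \<mu>(1) by (auto simp: T_def field_simps)
    have tb: "\<epsilon> \<le> 1 - t * \<mu>" "1 - t * \<mu> \<le> 1" if "0 \<le> t" "t \<le> T" for t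
    proof -
      have "t * \<mu> \<le> T * \<mu>" using that \<mu>(1) by (intro mult_right_mono) auto
      then show "\<epsilon> \<le> 1 - t * \<mu>" using \<mu>(1) by (simp add: T_def)
      show "1 - t * \<mu> \<le> 1" using that \<mu>(1) by simp
    qed
    define g where "g t = K / (1 - t * \<mu>)" for t
    have "(\<integral>\<^sub>+t. ennreal (g t) * indicator {0..T} t)
        = ennreal ((\<lambda>t. - (K / \<mu>) * ln (1 - t * \<mu>)) T - (\<lambda>t. - (K / \<mu>) * ln (1 - t * \<mu>)) 0)"
    proof (rule nn_integral_FTC_Icc)
      show "g \<in> borel_measurable borel" unfolding g_def by measurable
      show "0 \<le> g t" if "t \<in> {0..T}" for t
        unfolding g_def using tb[of t] that K e0 by auto
      show "((\<lambda>t. - (K / \<mu>) * ln (1 - t * \<mu>)) has_real_derivative g t) (at t)" if "t \<in> {0..T}" for t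
        using tb[of t] that e0 \<mu>(1) unfolding g_def
        by (auto intro!: derivative_eq_intros simp: field_simps)
    qed (use T in auto)
    also have "(\<lambda>t. - (K / \<mu>) * ln (1 - t * \<mu>)) T - (\<lambda>t. - (K / \<mu>) * ln (1 - t * \<mu>)) 0 = r + 1"
      using \<mu>(1) K by (simp add: T_def \<epsilon>_def)
    finally have *: "(\<integral>\<^sub>+t. ennreal (g t) * indicator {0..T} t) = ennreal (r + 1)" .
    have "(\<integral>\<^sub>+t. ennreal (g t) * indicator {0..T} t) \<le> F z"
      unfolding F_def
    proof (intro nn_integral_mono)
      fix t :: real
      show "ennreal (g t) * indicator {0..T} t \<le> ennreal (kernel \<kappa> \<alpha> (z - t *\<^sub>R c)) * indicator {0..1} t"
      proof (cases "t \<in> {0..T}")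
        case True
        note t = tb[of t]
        have p: "1 + (- t) * \<mu> > 0" using t(1) e0 True by auto
        have "(1 - t * \<mu>) powr (-1) \<le> (1 - t * \<mu>) powr \<kappa>"
          using t True p \<kappa> by (intro powr_mono') auto
        then have 1: "1 / (1 - t * \<mu>) \<le> (1 - t * \<mu>) powr \<kappa>" using p by (simp add: powr_minus_divide)
        have "- \<bar>inner \<alpha> c\<bar> \<le> t * inner \<alpha> c"
        proof -
          have "\<bar>t * inner \<alpha> c\<bar> \<le> 1 * \<bar>inner \<alpha> c\<bar>"
            unfolding abs_mult using True T by (intro mult_right_mono) auto
          then show ?thesis by linarith
        qed
        then have 2: "exp (- \<bar>inner \<alpha> c\<bar>) \<le> exp (t * inner \<alpha> c)" by simp
        have "g t = jdet z powr \<kappa> * exp (- inner \<alpha> z) * (1 / (1 - t * \<mu>) * exp (- \<bar>inner \<alpha> c\<bar>))"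
          by (simp add: g_def K_def)
        also have "\<dots> \<le> jdet z powr \<kappa> * exp (- inner \<alpha> z) * ((1 - t * \<mu>) powr \<kappa> * exp (t * inner \<alpha> c))"
          using 1 2 p by (intro mult_left_mono mult_mono) auto
        also have "\<dots> = kernel \<kappa> \<alpha> (z - t *\<^sub>R c)" using \<mu>(3)[OF p] by simp
        finally have "ennreal (g t) \<le> ennreal (kernel \<kappa> \<alpha> (z - t *\<^sub>R c))" by (rule ennreal_leI)
        then show ?thesis using True T by simp
      qed simp
    qed
    then show False using * r by (simp add: ennreal_le_iff)
  qed
  then have "(\<integral>\<^sub>+z. F z) = \<infinity>" by (intro nn_integral_edge_top[OF c]) simp_all
  moreover have "(\<integral>\<^sub>+z. F z)
     = (\<integral>\<^sup>+t. (\<integral>\<^sub>+z. ennreal (kernel \<kappa> \<alpha> (z - t *\<^sub>R c)) * indicator {0..1} t) \<partial>(lborel :: real measure))"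
    unfolding F_def by (rule lborel_pair.Fubini') measurable
  moreover have "\<dots> = (\<integral>\<^sup>+t. mass \<kappa> \<alpha> * indicator {0..1} t \<partial>(lborel :: real measure))"
  proof (rule nn_integral_cong)
    fix t :: real
    have "(\<integral>\<^sub>+z. ennreal (kernel \<kappa> \<alpha> (z - t *\<^sub>R c))) = mass \<kappa> \<alpha>"
      using nn_integral_lborel_shift[of "\<lambda>z. ennreal (kernel \<kappa> \<alpha> z)" "- (t *\<^sub>R c)"] by simp
    then show "(\<integral>\<^sub>+z. ennreal (kernel \<kappa> \<alpha> (z - t *\<^sub>R c)) * indicator {0..1} t)
        = mass \<kappa> \<alpha> * indicator {0..1} t"
      by (simp add: nn_integral_multc)
  qed
  moreover have "\<dots> = mass \<kappa> \<alpha> * emeasure lborel {0..1::real}"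
    by (rule nn_integral_cmult_indicator) simp
  ultimately show False using fin by simp
qed

text \<open>If \<alpha> pairs nonpositively with a primitive c, the exponential does not decay along
  z + n c, and the power \<kappa> \<ge> -1 of a linear function of n dominates a multiple of the
  harmonic series. Disjointness of the translates of \<open>edge c\<close> bounds the integrated
  series by the mass.\<close>

lemma kernel_parameter:
  assumes fin: "mass \<kappa> \<alpha> < \<infinity>" and \<kappa>: "\<kappa> \<ge> -1"
  shows "\<alpha> \<in> cone"
proof (rule ccontr)
  assume "\<alpha> \<notin> cone"
  then obtain c where c: "prim c" and \<alpha>c: "inner \<alpha> c \<le> 0" by (auto simp: cone_iff not_less)
  define k where "k n y = ennreal (kernel \<kappa> \<alpha> y) * indicator (edge c) (y - real n *\<^sub>R c)" for n y
  define S where "S n = {y. y - real n *\<^sub>R c \<in> edge c}" for n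
  have k_S: "k n y = ennreal (kernel \<kappa> \<alpha> y) * indicator (S n) y" for n y
    by (simp add: k_def S_def indicator_def)
  have [measurable]: "k n \<in> borel_measurable borel" for n unfolding k_def by measurable
  define F where "F z = (\<Sum>n. k n (z + real n *\<^sub>R c))" for z
  have [measurable]: "F \<in> borel_measurable borel" unfolding F_def by measurable
  have disj: "disjoint_family S"
  proof -
    have "False" if y: "y \<in> S i" "y \<in> S j" and ij: "i < j" for i j y
    proof -
      have "y - real j *\<^sub>R c \<in> cone" using y(2) by (simp add: S_def edge_def)
      \<comment> \<open>The decomposition y - (i + 1) c = (y - j c) + (j - i - 1) c would put the
        left side among the squares, against membership in \<open>S i\<close>.\<close>
      moreover have "real (j - Suc i) *\<^sub>R c \<in> psd" by (intro psd_scale idem_psd prim_idem c) simp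
      ultimately have "y - real j *\<^sub>R c + real (j - Suc i) *\<^sub>R c \<in> psd" using cone_add_psd cone_psd by blast
      moreover have "y - real j *\<^sub>R c + real (j - Suc i) *\<^sub>R c = y - real i *\<^sub>R c - c"
        using ij by (simp add: of_nat_diff algebra_simps)
      ultimately show False using y(1) by (simp add: S_def edge_def)
    qed
    then show ?thesis unfolding disjoint_family_on_def by (metis disjoint_iff linorder_neqE_nat)
  qed
  have "F z = \<infinity>" if z: "z \<in> edge c" for z
  proof -
    have zc: "z \<in> cone" using z by (auto simp: edge_def)
    obtain \<mu> where \<mu>: "\<mu> > 0"
      "\<And>s. 1 + s * \<mu> > 0 \<Longrightarrow> kernel \<kappa> \<alpha> (z + s *\<^sub>R c)
        = jdet z powr \<kappa> * exp (- inner \<alpha> z) * ((1 + s * \<mu>) powr \<kappa> * exp (- (s * inner \<alpha> c)))"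
      using kernel_line[OF zc c] by blast
    define K where "K = jdet z powr \<kappa> * exp (- inner \<alpha> z)"
    have K: "K > 0" using jdet_pos[OF zc] by (simp add: K_def)
    define h where "h n = kernel \<kappa> \<alpha> (z + real n *\<^sub>R c)" for n
    have h0: "h n \<ge> 0" for n by (simp add: h_def kernel_nonneg)
    have h: "h n \<ge> K / (1 + \<mu>) * inverse (real (Suc n))" for n
    proof -
      have p: "1 + real n * \<mu> \<ge> 1" using \<mu>(1) by simp
      have "1 + real n * \<mu> \<le> (1 + \<mu>) * real (Suc n)" using \<mu>(1) by (simp add: algebra_simps)
      then have "1 / ((1 + \<mu>) * real (Suc n)) \<le> 1 / (1 + real n * \<mu>)"
        using p by (intro divide_left_mono) auto
      also have "1 / (1 + real n * \<mu>) = (1 + real n * \<mu>) powr (-1)" using p by (simp add: powr_minus_divide)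
      also have "\<dots> \<le> (1 + real n * \<mu>) powr \<kappa>" using p \<kappa> by (intro powr_mono) auto
      finally have 1: "1 / ((1 + \<mu>) * real (Suc n)) \<le> (1 + real n * \<mu>) powr \<kappa>" .
      have "real n * inner \<alpha> c \<le> 0" using \<alpha>c by (simp add: mult_nonneg_nonpos)
      then have 2: "1 \<le> exp (- (real n * inner \<alpha> c))" by simp
      have "K / (1 + \<mu>) * inverse (real (Suc n)) = K * (1 / ((1 + \<mu>) * real (Suc n)) * 1)"
        by (simp add: divide_inverse)
      also have "\<dots> \<le> K * ((1 + real n * \<mu>) powr \<kappa> * exp (- (real n * inner \<alpha> c)))"
        using 1 2 K by (intro mult_left_mono mult_mono) auto
      also have "\<dots> = h n" using \<mu>(2)[of "real n"] p by (simp add: h_def K_def)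
      finally show ?thesis .
    qed
    have ns: "\<not> summable h"
    proof
      assume "summable h"
      then have "summable (\<lambda>n. K / (1 + \<mu>) * inverse (real (Suc n)))"
        by (rule summable_comparison_test') (use h K \<mu>(1) in auto)
      then have "summable (\<lambda>n. inverse (real (Suc n)))"
        using K \<mu>(1) by (subst (asm) summable_cmult_iff) auto
      then show False using not_summable_harmonic[where 'a=real] summable_Suc_iff[of "\<lambda>n. inverse (real n)"]
        by simp
    qed
    have "(\<Sum>n. ennreal (h n)) = \<infinity>"
    proof (rule ccontr)
      assume "(\<Sum>n. ennreal (h n)) \<noteq> \<infinity>"
      then have "(\<Sum>n. ennreal (h n)) \<noteq> top" by simp
      with summable_suminf_not_top[of h, OF h0] show False using ns by blast
    qed
    moreover have "F z = (\<Sum>n. ennreal (h n))" using z by (simp add: F_def k_def h_def)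
    ultimately show ?thesis by simp
  qed
  then have "(\<integral>\<^sub>+z. F z) = \<infinity>" by (intro nn_integral_edge_top[OF c]) simp_all
  moreover have "(\<integral>\<^sub>+z. F z) = (\<Sum>n. \<integral>\<^sub>+z. k n (z + real n *\<^sub>R c))"
    unfolding F_def by (rule nn_integral_suminf) measurable
  moreover have "\<dots> = (\<Sum>n. \<integral>\<^sub>+z. k n z)"
  proof (rule suminf_cong)
    fix n
    show "(\<integral>\<^sub>+z. k n (z + real n *\<^sub>R c)) = (\<integral>\<^sub>+z. k n z)"
      using nn_integral_lborel_shift[of "k n" "real n *\<^sub>R c"] by (simp add: add.commute)
  qed
  moreover have "\<dots> = (\<integral>\<^sub>+z. (\<Sum>n. k n z))"
    by (rule nn_integral_suminf[symmetric]) measurable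
  moreover have "\<dots> \<le> mass \<kappa> \<alpha>"
  proof (rule nn_integral_mono)
    fix y
    have "(\<Sum>n. k n y) = ennreal (kernel \<kappa> \<alpha> y) * indicator (\<Union>n. S n) y"
      unfolding k_S by (simp add: suminf_indicator[OF disj])
    also have "\<dots> \<le> ennreal (kernel \<kappa> \<alpha> y)" by (simp add: indicator_def)
    finally show "(\<Sum>n. k n y) \<le> ennreal (kernel \<kappa> \<alpha> y)" .
  qed
  ultimately show False using fin by (simp add: top_unique)
qed

text \<open>Substitution by P(w), where w is the inverse square root of \<alpha>: since P(w)
  \<alpha> = e, self-adjointness turns the pairing with \<alpha> into the pairing with e. The kernel
  contributes the exponent - \<kappa> and the Jacobian contributes - dim / r.\<close>

lemma kernel_integral:
  assumes \<alpha>: "\<alpha> \<in> cone"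
  shows "mass \<kappa> \<alpha>
    = ennreal (jdet \<alpha> powr (- (\<kappa> + dimr))) * mass \<kappa> e"
proof -
  define s where "s = jsqrt \<alpha>"
  define w where "w = jinv s"
  have s: "s \<in> cone" and ss: "s \<odot> s = \<alpha>" using jsqrt_cone[OF \<alpha>] jsqrt_square[OF \<alpha>] by (simp_all add: s_def)
  have w: "w \<in> cone" using jinv_cone[OF s] by (simp add: w_def)
  have qe: "quad w \<alpha> = e" using quad_jinv_square[OF s] ss by (simp add: w_def)
  have "jdet (quad w \<alpha>) = jdet \<alpha> * jdet (w \<odot> w)" by (rule jdet_quad[OF w \<alpha>])
  then have d: "jdet (w \<odot> w) = 1 / jdet \<alpha>" using qe jdet_e jdet_pos[OF \<alpha>] by (simp add: field_simps)
  have dp: "jdet \<alpha> > 0" by (rule jdet_pos[OF \<alpha>])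
  have k: "kernel \<kappa> \<alpha> (quad w x) = jdet \<alpha> powr (- \<kappa>) * kernel \<kappa> e x" for x
  proof (cases "x \<in> cone")
    case True
    then have "jdet (quad w x) = jdet x / jdet \<alpha>" using jdet_quad[OF w True] d by simp
    moreover have "inner \<alpha> (quad w x) = inner e x" using inner_quad[of w \<alpha> x] qe by simp
    ultimately show ?thesis using True quad_cone_iff[OF w, of x] dp jdet_pos[OF True]
      by (simp add: kernel_def powr_divide powr_minus_divide)
  qed (simp add: kernel_def quad_cone_iff[OF w])
  have "mass \<kappa> \<alpha>
     = ennreal (jdet (w \<odot> w) powr dimr) * (\<integral>\<^sub>+x. ennreal (kernel \<kappa> \<alpha> (quad w x)))"
    by (rule nn_integral_quad[OF w, of "\<lambda>y. ennreal (kernel \<kappa> \<alpha> y)"]) measurable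
  also have "(\<integral>\<^sub>+x. ennreal (kernel \<kappa> \<alpha> (quad w x)))
     = ennreal (jdet \<alpha> powr (- \<kappa>)) * mass \<kappa> e"
    unfolding k by (subst nn_integral_cmult[symmetric]) (auto simp: ennreal_mult kernel_nonneg)
  also have "ennreal (jdet (w \<odot> w) powr dimr) * (ennreal (jdet \<alpha> powr (- \<kappa>)) * mass \<kappa> e)
     = ennreal (jdet (w \<odot> w) powr dimr * jdet \<alpha> powr (- \<kappa>)) * mass \<kappa> e"
    by (simp add: ennreal_mult mult.assoc)
  also have "jdet (w \<odot> w) powr dimr * jdet \<alpha> powr (- \<kappa>) = jdet \<alpha> powr (- (\<kappa> + dimr))"
  proof -
    have "jdet (w \<odot> w) powr dimr = jdet \<alpha> powr (- dimr)"
      using dp unfolding d by (simp add: powr_divide powr_minus_divide)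
    then have "jdet (w \<odot> w) powr dimr * jdet \<alpha> powr (- \<kappa>) = jdet \<alpha> powr (- dimr + - \<kappa>)"
      by (simp only: powr_add)
    also have "- dimr + - \<kappa> = - (\<kappa> + dimr)" by simp
    finally show "jdet (w \<odot> w) powr dimr * jdet \<alpha> powr (- \<kappa>) = jdet \<alpha> powr (- (\<kappa> + dimr))" .
  qed
  finally show ?thesis .
qed

section \<open>The Olkin--Baker functional equation\<close>

text \<open>Additivity makes \<Delta> p - \<Delta> q depend on p - q only, which extends \<Delta> to
  the whole space; continuity along rays makes the extension homogeneous.\<close>

lemma additive_cone:
  assumes cont: "continuous_on cone \<Delta>"
    and add: "\<And>x y. x \<in> cone \<Longrightarrow> y \<in> cone \<Longrightarrow> \<Delta> (x + y) = \<Delta> x + (\<Delta> y :: real)"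
  shows "\<exists>A. \<forall>x\<in>cone. \<Delta> x = inner A x"
proof -
  have hom: "\<Delta> (t *\<^sub>R x) = t * \<Delta> x" if x: "x \<in> cone" and t: "t > 0" for x t
  proof -
    have "\<Delta> (t *\<^sub>R x) = t * \<Delta> (1 *\<^sub>R x)"
    proof (rule additive_on_pos_linear[of "\<lambda>t. \<Delta> (t *\<^sub>R x)", OF _ _ t])
      show "continuous_on {0<..} (\<lambda>t. \<Delta> (t *\<^sub>R x))"
        by (rule continuous_on_compose2[OF cont]) (auto intro!: continuous_intros cone_scale x)
    qed (simp add: scaleR_add_left add cone_scale x)
    then show ?thesis by simp
  qed
  \<comment> \<open>A primitive idempotent pairs with x to at least - \<open>norm x\<close>, so
    adding (\<open>norm x\<close> + 1) e leads into the cone.\<close>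
  define P Q where "P x = x + (norm x + 1) *\<^sub>R e" and "Q x = (norm x + 1) *\<^sub>R e" for x
  have PQ: "P x \<in> cone" "Q x \<in> cone" "x = P x - Q x" for x
  proof -
    show "P x \<in> cone" unfolding cone_iff
    proof (intro allI impI)
      fix p assume p: "prim p"
      have "\<bar>inner x p\<bar> \<le> norm x" using Cauchy_Schwarz_ineq2[of x p] prim_norm[OF p] by simp
      then show "inner (P x) p > 0"
        using prim_trace[OF p] by (simp add: P_def inner_add_left inner_commute[of e p])
    qed
    show "Q x \<in> cone" unfolding Q_def by (intro cone_scale e_cone) (simp add: add_nonneg_pos)
  qed (simp add: P_def Q_def)
  define G where "G x = \<Delta> (P x) - \<Delta> (Q x)" for x
  have G: "G x = \<Delta> p - \<Delta> q" if "p \<in> cone" "q \<in> cone" "x = p - q" for x p q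
  proof -
    have "p = x + q" using that(3) by simp
    then have "p + Q x = q + P x" by (simp add: P_def Q_def)
    then have "\<Delta> p + \<Delta> (Q x) = \<Delta> q + \<Delta> (P x)" using add[OF that(1) PQ(2)] add[OF that(2) PQ(1)] by metis
    then show ?thesis by (simp add: G_def)
  qed
  have lin: "linear G"
  proof (rule linearI)
    fix x y
    have "x + y = (P x + P y) - (Q x + Q y)" using PQ(3)[of x] PQ(3)[of y] by (simp add: algebra_simps)
    then have "G (x + y) = \<Delta> (P x + P y) - \<Delta> (Q x + Q y)" by (intro G cone_add PQ)
    then show "G (x + y) = G x + G y" by (simp add: add PQ G_def)
  next
    fix r :: real and x
    consider "r = 0" | "r > 0" | "r < 0" by linarith
    then show "G (r *\<^sub>R x) = r *\<^sub>R G x"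
    proof cases
      case 1
      then show ?thesis using G[OF e_cone e_cone, of 0] by simp
    next
      case 2
      have "r *\<^sub>R x = r *\<^sub>R P x - r *\<^sub>R Q x" using PQ(3)[of x] by (metis scaleR_diff_right)
      then have "G (r *\<^sub>R x) = \<Delta> (r *\<^sub>R P x) - \<Delta> (r *\<^sub>R Q x)" by (intro G cone_scale PQ 2)
      then show ?thesis using 2 by (simp add: hom PQ G_def algebra_simps)
    next
      case 3
      then have r: "- r > 0" by simp
      have "r *\<^sub>R x = (- r) *\<^sub>R Q x - (- r) *\<^sub>R P x"
        using arg_cong[OF PQ(3)[of x], of "\<lambda>z. r *\<^sub>R z"] by (simp add: scaleR_diff_right)
      then have "G (r *\<^sub>R x) = \<Delta> ((- r) *\<^sub>R Q x) - \<Delta> ((- r) *\<^sub>R P x)" by (intro G cone_scale PQ r)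
      then show ?thesis unfolding hom[OF PQ(1) r] hom[OF PQ(2) r] by (simp add: G_def algebra_simps)
    qed
  qed
  obtain A where A: "\<And>x. G x = inner A x" using linear_functional_inner[OF lin] by blast
  have "\<Delta> x = inner A x" if x: "x \<in> cone" for x
  proof -
    have "G x = \<Delta> (x + e) - \<Delta> e" by (rule G) (use cone_add[OF x e_cone] e_cone in simp_all)
    then show ?thesis using add[OF x e_cone] A[of x] by simp
  qed
  then show ?thesis by blast
qed

text \<open>The sum p x + q y depends on x + y only, so the increments p (x + h) - p x and q (y + h)
  - q y agree and depend on h alone. They form one additive function, hence the common linear
  part.\<close>

lemma pexider_cone:
  fixes p q :: "'a \<Rightarrow> real"
  assumes cont: "continuous_on cone p"
    and pq: "\<And>x y x' y'. \<lbrakk>x \<in> cone; y \<in> cone; x' \<in> cone; y' \<in> cone; x + y = x' + y'\<rbrakk>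
      \<Longrightarrow> p x + q y = p x' + q y'"
  shows "\<exists>A \<alpha> \<beta>. \<forall>x\<in>cone. p x = inner A x + \<alpha> \<and> q x = inner A x + \<beta>"
proof -
  define \<Delta> where "\<Delta> h = p (e + h) - p e" for h
  have pp: "p (x + h) - p x = q (y + h) - q y" if "x \<in> cone" "y \<in> cone" "h \<in> cone" for x y h
    using pq[of "x + h" y x "y + h"] that cone_add by (auto simp: algebra_simps)
  have dp: "p (x + h) = p x + \<Delta> h" if "x \<in> cone" "h \<in> cone" for x h
    using pp[OF that(1) e_cone that(2)] pp[OF e_cone e_cone that(2)] by (simp add: \<Delta>_def)
  have dq: "q (x + h) = q x + \<Delta> h" if "x \<in> cone" "h \<in> cone" for x h
    using pp[OF e_cone that] by (simp add: \<Delta>_def)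
  have "continuous_on cone \<Delta>" unfolding \<Delta>_def
    by (intro continuous_intros continuous_on_compose2[OF cont]) (use cone_add e_cone in auto)
  moreover have "\<Delta> (x + y) = \<Delta> x + \<Delta> y" if "x \<in> cone" "y \<in> cone" for x y
  proof -
    have "p (e + (x + y)) = p (e + x) + \<Delta> y"
      using dp[OF cone_add[OF e_cone that(1)] that(2)] by (simp only: add.assoc)
    then show ?thesis unfolding \<Delta>_def[of "x + y"] \<Delta>_def[of x] by linarith
  qed
  ultimately have "\<exists>A. \<forall>x\<in>cone. \<Delta> x = inner A x"
    by (rule additive_cone)
  then obtain A where A: "\<And>x. x \<in> cone \<Longrightarrow> \<Delta> x = inner A x" by blast
  have "p x = inner A x + (p e - inner A e)" if x: "x \<in> cone" for x
    using dp[OF x e_cone] dp[OF e_cone x] A[OF x] A[OF e_cone] by (simp add: add.commute)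
  moreover have "q x = inner A x + (q e - inner A e)" if x: "x \<in> cone" for x
    using dq[OF x e_cone] dq[OF e_cone x] A[OF x] A[OF e_cone] by (simp add: add.commute)
  ultimately show ?thesis by blast
qed

lemma homogeneous_cross_log:
  fixes a b :: "'a \<Rightarrow> real"
  assumes ca: "continuous_on cone a" and cb: "continuous_on cone b"
    and hom: "\<And>s x. s > 0 \<Longrightarrow> x \<in> cone \<Longrightarrow> a (s *\<^sub>R x) = a x + \<alpha> s"
    and cross: "\<And>u u' w w'. \<lbrakk>u \<in> order_ball e; u' \<in> order_ball e; w \<in> cone; w' \<in> cone\<rbrakk> \<Longrightarrow>
      (a (quad w u) + b (quad w (e - u))) + (a (quad w' u') + b (quad w' (e - u')))
      = (a (quad w u') + b (quad w (e - u'))) + (a (quad w' u) + b (quad w' (e - u)))"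
  shows "\<exists>\<kappa> C. \<forall>x\<in>cone. a x = \<kappa> * ln (jdet x) + C"
proof -
  have "a (quad w z) - a z = a (w \<odot> w) - a e" if w: "w \<in> cone" and z: "z \<in> cone" for w z
  proof -
    \<comment> \<open>A reference point of the order interval; any other would serve. By the cross
      identity with w' = e, the value \<psi> is the same at every point of the interval.\<close>
    define u0 where "u0 = (1/2) *\<^sub>R e"
    have "e - u0 = u0" unfolding u0_def by (rule euclidean_eqI) (simp add: inner_diff_left)
    then have u0: "u0 \<in> order_ball e" using cone_scale[OF e_cone, of "1/2"] by (simp add: order_ball_def u0_def)
    define \<psi> where "\<psi> = (a (quad w u0) + b (quad w (e - u0))) - (a u0 + b (e - u0))"
    have \<psi>: "\<psi> = a (quad w z) - a z + (b (w \<odot> w) - b e)" if z: "z \<in> cone" for z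
    proof -
      \<comment> \<open>The bound on \<epsilon> keeps \<epsilon> times each pairing of z with a
        primitive idempotent below 1.\<close>
      have small: "\<epsilon> *\<^sub>R z \<in> order_ball e" if \<epsilon>: "0 < \<epsilon>" "\<epsilon> < 1 / (norm z + 1)" for \<epsilon>
      proof -
        have "e - \<epsilon> *\<^sub>R z \<in> cone" unfolding cone_iff
        proof (intro allI impI)
          fix p assume p: "prim p"
          have "inner z p \<le> norm z" using norm_cauchy_schwarz[of z p] prim_norm[OF p] by simp
          then have "\<epsilon> * inner z p \<le> \<epsilon> * (norm z + 1)" using \<epsilon> by (intro mult_left_mono) auto
          also have "\<dots> < 1 / (norm z + 1) * (norm z + 1)"
            using \<epsilon> by (intro mult_strict_right_mono) (auto simp: add_nonneg_pos)
          also have "\<dots> = 1" using norm_ge_zero[of z] by (simp add: add_nonneg_eq_0_iff)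
          finally show "inner (e - \<epsilon> *\<^sub>R z) p > 0" using prim_trace[OF p] by (simp add: inner_diff_left inner_commute[of e p])
        qed
        then show ?thesis using cone_scale[OF z \<epsilon>(1)] by (simp add: order_ball_def)
      qed
      \<comment> \<open>The constants \<alpha> \<epsilon> from z and from P(w) z cancel, so the part
        in a does not involve \<epsilon>.\<close>
      have eq: "\<psi> = a (quad w z) - a z + (b (w \<odot> w - \<epsilon> *\<^sub>R quad w z) - b (e - \<epsilon> *\<^sub>R z))"
        if \<epsilon>: "0 < \<epsilon>" "\<epsilon> < 1 / (norm z + 1)" for \<epsilon>
      proof -
        have "\<psi> = (a (quad w (\<epsilon> *\<^sub>R z)) + b (quad w (e - \<epsilon> *\<^sub>R z))) - (a (\<epsilon> *\<^sub>R z) + b (e - \<epsilon> *\<^sub>R z))"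
          using cross[OF u0 small[OF \<epsilon>] w e_cone] by (simp add: \<psi>_def)
        then show ?thesis using hom[OF \<epsilon>(1) z] hom[OF \<epsilon>(1) quad_cone[OF w z]]
          by (simp add: quad_scale quad_diff quad_e)
      qed
      have isb: "isCont b x" if "x \<in> cone" for x
        using cb open_cone that by (simp add: continuous_on_eq_continuous_at)
      have "((\<lambda>\<epsilon>. a (quad w z) - a z + (b (w \<odot> w - \<epsilon> *\<^sub>R quad w z) - b (e - \<epsilon> *\<^sub>R z)))
         \<longlongrightarrow> a (quad w z) - a z + (b (w \<odot> w) - b e)) (at_right 0)"
      proof (intro tendsto_intros)
        have "((\<lambda>\<epsilon>. w \<odot> w - \<epsilon> *\<^sub>R quad w z) \<longlongrightarrow> w \<odot> w - 0 *\<^sub>R quad w z) (at_right 0)"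
          by (intro tendsto_intros)
        then show "((\<lambda>\<epsilon>. b (w \<odot> w - \<epsilon> *\<^sub>R quad w z)) \<longlongrightarrow> b (w \<odot> w)) (at_right 0)"
          using isCont_tendsto_compose[OF isb[OF cone_square[OF w]]] by simp
        have "((\<lambda>\<epsilon>. e - \<epsilon> *\<^sub>R z) \<longlongrightarrow> e - 0 *\<^sub>R z) (at_right 0)"
          by (intro tendsto_intros)
        then show "((\<lambda>\<epsilon>. b (e - \<epsilon> *\<^sub>R z)) \<longlongrightarrow> b e) (at_right 0)"
          using isCont_tendsto_compose[OF isb[OF e_cone]] by simp
      qed
      moreover have "eventually (\<lambda>\<epsilon>. a (quad w z) - a z + (b (w \<odot> w - \<epsilon> *\<^sub>R quad w z) - b (e - \<epsilon> *\<^sub>R z)) = \<psi>) (at_right 0)"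
        unfolding eventually_at_right_field
        by (intro exI[of _ "1 / (norm z + 1)"]) (auto simp: eq add_nonneg_pos)
      ultimately have "((\<lambda>\<epsilon>. \<psi>) \<longlongrightarrow> a (quad w z) - a z + (b (w \<odot> w) - b e)) (at_right (0::real))"
        by (rule Lim_transform_eventually)
      then show ?thesis using tendsto_unique[OF trivial_limit_at_right_real tendsto_const] by blast
    qed
    \<comment> \<open>Between the instances at z and at e, both \<psi> and the terms in b
      cancel.\<close>
    show ?thesis using \<psi>[OF z] \<psi>[OF e_cone] by (simp add: quad_e)
  qed
  note step = this
  have "\<exists>\<beta>. \<forall>x\<in>cone. a x - a e = \<beta> * ln (jdet x)"
  proof (rule log_cauchy)
    show "continuous_on cone (\<lambda>x. a x - a e)" by (intro continuous_intros ca)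
    show "a (quad w x) - a e = a x - a e + (a (w \<odot> w) - a e)" if "w \<in> cone" "x \<in> cone" for w x
      using step[OF that] by simp
  qed
  then obtain \<kappa> where "\<And>x. x \<in> cone \<Longrightarrow> a x - a e = \<kappa> * ln (jdet x)" by blast
  then have "a x = \<kappa> * ln (jdet x) + a e" if "x \<in> cone" for x using that by (simp add: diff_eq_eq)
  then show ?thesis by blast
qed

theorem olkin_baker:
  fixes a b :: "'a \<Rightarrow> real"
  assumes ca: "continuous_on cone a" and cb: "continuous_on cone b"
    and cross: "\<And>u u' w w'. \<lbrakk>u \<in> order_ball e; u' \<in> order_ball e; w \<in> cone; w' \<in> cone\<rbrakk> \<Longrightarrow>
      (a (quad w u) + b (quad w (e - u))) + (a (quad w' u') + b (quad w' (e - u')))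
      = (a (quad w u') + b (quad w (e - u'))) + (a (quad w' u) + b (quad w' (e - u)))"
  shows "\<exists>A \<kappa>1 \<kappa>2 C1 C2. \<forall>x\<in>cone. a x = inner A x + \<kappa>1 * ln (jdet x) + C1
    \<and> b x = inner A x + \<kappa>2 * ln (jdet x) + C2"
proof -
  have ex: "\<exists>A \<alpha> \<beta>. \<forall>x\<in>cone. a (s *\<^sub>R x) - a x = inner A x + \<alpha> \<and> b (s *\<^sub>R x) - b x = inner A x + \<beta>"
    if s: "s > 0" for s
  proof (rule pexider_cone)
    show "continuous_on cone (\<lambda>x. a (s *\<^sub>R x) - a x)"
      by (intro continuous_intros continuous_on_compose2[OF ca]) (use cone_scale s ca in auto)
    fix x y x' y' assume c: "x \<in> cone" "y \<in> cone" "x' \<in> cone" "y' \<in> cone" and xy: "x + y = x' + y'"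
    define w where "w = jsqrt (x + y)"
    have v: "x + y \<in> cone" by (rule cone_add[OF c(1,2)])
    have w: "w \<in> cone" and ww: "w \<odot> w = x + y" using jsqrt_cone[OF v] jsqrt_square[OF v] by (simp_all add: w_def)
    define u where "u = quad (jinv w) x"
    define u' where "u' = quad (jinv w) x'"
    have qu: "quad w u = x" "quad w u' = x'" by (simp_all add: u_def u'_def quad_jinv(1)[OF w])
    have ww': "w \<odot> w = x' + y'" using ww xy by simp
    have quc: "quad w (e - u) = y" "quad w (e - u') = y'"
      unfolding quad_diff quad_e qu by (simp add: ww) (simp add: ww')
    have ub: "u \<in> order_ball e" "u' \<in> order_ball e"
      unfolding order_ball_def using c qu quc quad_cone_iff[OF w] by (metis mem_Collect_eq)+
    define w' where "w' = sqrt s *\<^sub>R w"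
    have w': "w' \<in> cone" unfolding w'_def by (rule cone_scale[OF w]) (use s in simp)
    have q': "quad w' z = s *\<^sub>R quad w z" for z unfolding w'_def quad_scale_left using s by simp
    show "a (s *\<^sub>R x) - a x + (b (s *\<^sub>R y) - b y) = a (s *\<^sub>R x') - a x' + (b (s *\<^sub>R y') - b y')"
      using cross[OF ub w w'] unfolding q' qu quc by simp
  qed
  then obtain A \<alpha> \<beta> where sc: "\<And>s x. s > 0 \<Longrightarrow> x \<in> cone \<Longrightarrow> a (s *\<^sub>R x) - a x = inner (A s) x + \<alpha> s"
    "\<And>s x. s > 0 \<Longrightarrow> x \<in> cone \<Longrightarrow> b (s *\<^sub>R x) - b x = inner (A s) x + \<beta> s"
    by metis
  have Amult: "inner (A (s * t)) x = t * inner (A s) x + inner (A t) x"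
    if st: "s > 0" "t > 0" and x: "x \<in> cone" for s t x
  proof -
    \<comment> \<open>Scaling by s t in two stages. Subtracting the instance at x from the one at 2
      x afterwards removes the constants.\<close>
    have *: "inner (A (s * t)) x + \<alpha> (s * t) = t * inner (A s) x + \<alpha> s + (inner (A t) x + \<alpha> t)" if x: "x \<in> cone" for x
      using sc(1)[OF mult_pos_pos[OF st] x] sc(1)[OF st(1) cone_scale[OF x st(2)]] sc(1)[OF st(2) x] by simp
    show ?thesis using *[OF x] *[OF cone_scale[OF x, of 2]] by simp
  qed
  define L where "L = A 2"
  \<comment> \<open>Exchanging the factors of 2 s gives 2 A(s) + A(2) = s A(2) + A(s).\<close>
  have AL: "inner (A s) x = (s - 1) * inner L x" if "s > 0" "x \<in> cone" for s x
    using Amult[of s 2 x] Amult[of 2 s x] that by (simp add: L_def mult.commute algebra_simps)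
  define a0 where "a0 x = a x - inner L x" for x
  define b0 where "b0 x = b x - inner L x" for x
  have cont: "continuous_on cone a0" "continuous_on cone b0"
    unfolding a0_def b0_def by (intro continuous_intros ca cb)+
  have ha: "a0 (s *\<^sub>R x) = a0 x + \<alpha> s" if "s > 0" "x \<in> cone" for s x
    using sc(1)[OF that] AL[OF that] by (simp add: a0_def algebra_simps)
  have hb: "b0 (s *\<^sub>R x) = b0 x + \<beta> s" if "s > 0" "x \<in> cone" for s x
    using sc(2)[OF that] AL[OF that] by (simp add: b0_def algebra_simps)
  \<comment> \<open>The corrections at u and at e - u add up to the pairing of L with w^2, which
    depends on w only and cancels in the cross identity.\<close>
  have split: "a0 (quad w u) + b0 (quad w (e - u)) = a (quad w u) + b (quad w (e - u)) - inner L (w \<odot> w)" for w u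
    by (simp add: a0_def b0_def quad_diff quad_e inner_diff_right)
  have "\<exists>\<kappa> C. \<forall>x\<in>cone. a0 x = \<kappa> * ln (jdet x) + C"
  proof (rule homogeneous_cross_log[OF cont ha])
    fix u u' w w' assume "u \<in> order_ball e" "u' \<in> order_ball e" "w \<in> cone" "w' \<in> cone"
    from cross[OF this] show "(a0 (quad w u) + b0 (quad w (e - u))) + (a0 (quad w' u') + b0 (quad w' (e - u')))
      = (a0 (quad w u') + b0 (quad w (e - u'))) + (a0 (quad w' u) + b0 (quad w' (e - u)))"
      unfolding split by simp
  qed
  moreover have "\<exists>\<kappa> C. \<forall>x\<in>cone. b0 x = \<kappa> * ln (jdet x) + C"
  proof (rule homogeneous_cross_log[OF cont(2,1) hb])
    fix u u' w w' assume u: "u \<in> order_ball e" "u' \<in> order_ball e" and w: "w \<in> cone" "w' \<in> cone"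
    \<comment> \<open>Reflection of the order interval exchanges the roles of a and b.\<close>
    have "e - u \<in> order_ball e" "e - u' \<in> order_ball e" using u by (auto simp: order_ball_def)
    from cross[OF this w]
    show "(b0 (quad w u) + a0 (quad w (e - u))) + (b0 (quad w' u') + a0 (quad w' (e - u')))
      = (b0 (quad w u') + a0 (quad w (e - u'))) + (b0 (quad w' u) + a0 (quad w' (e - u)))"
      using split[of w "e - u"] split[of w' "e - u"] split[of w "e - u'"] split[of w' "e - u'"] by simp
  qed
  ultimately obtain \<kappa>1 C1 \<kappa>2 C2 where
    "\<forall>x\<in>cone. a0 x = \<kappa>1 * ln (jdet x) + C1" "\<forall>x\<in>cone. b0 x = \<kappa>2 * ln (jdet x) + C2" by blast
  then have "\<forall>x\<in>cone. a x = inner L x + \<kappa>1 * ln (jdet x) + C1 \<and> b x = inner L x + \<kappa>2 * ln (jdet x) + C2"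
    by (simp add: a0_def b0_def algebra_simps)
  then show ?thesis by blast
qed

section \<open>The joint density of U and V\<close>

definition uv_density :: "('a \<Rightarrow> real) \<Rightarrow> ('a \<Rightarrow> real) \<Rightarrow> 'a \<Rightarrow> 'a \<Rightarrow> real"
  where "uv_density f g u v = jdet v powr dimr * f (quad (jsqrt v) u) * g (quad (jsqrt v) (e - u))"

lemma continuous_quad:
  assumes "continuous_on S h" "continuous_on S k" shows "continuous_on S (\<lambda>p. quad (h p) (k p))"
  unfolding quad_eq by (intro continuous_intros assms)

lemma uv_density_pos:
  assumes "\<And>x. x \<in> cone \<Longrightarrow> f x > 0" "\<And>x. x \<in> cone \<Longrightarrow> g x > 0" "u \<in> order_ball e" "v \<in> cone"
  shows "uv_density f g u v > 0"
  using assms jdet_pos[of v] quad_cone[OF jsqrt_cone[OF assms(4)]]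
  by (simp add: uv_density_def order_ball_def)

lemma continuous_uv_density:
  assumes f: "continuous_on cone f" and g: "continuous_on cone g"
  shows "continuous_on (order_ball e \<times> cone) (\<lambda>p. uv_density f g (fst p) (snd p))"
proof -
  let ?S = "order_ball e \<times> cone"
  have s: "continuous_on ?S (\<lambda>p. jsqrt (snd p))"
    by (rule continuous_on_compose2[OF continuous_jsqrt]) (auto intro!: continuous_intros)
  have d: "continuous_on ?S (\<lambda>p. jdet (snd p))"
    by (rule continuous_on_compose2[OF continuous_jdet]) (auto intro!: continuous_intros)
  have "continuous_on ?S (\<lambda>p. f (quad (jsqrt (snd p)) (fst p)))"
    by (rule continuous_on_compose2[OF f continuous_quad[OF s]])
      (auto intro!: continuous_intros quad_cone jsqrt_cone simp: order_ball_def)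
  moreover have "continuous_on ?S (\<lambda>p. g (quad (jsqrt (snd p)) (e - fst p)))"
    by (rule continuous_on_compose2[OF g continuous_quad[OF s]])
      (auto intro!: continuous_intros quad_cone jsqrt_cone simp: order_ball_def)
  moreover have "continuous_on ?S (\<lambda>p. jdet (snd p) powr dimr)"
    by (intro continuous_intros d) (auto dest: jdet_pos)
  ultimately show ?thesis unfolding uv_density_def by (intro continuous_on_mult)
qed

lemma distributed_distr_borel:
  assumes "distributed M lborel X p" shows "distr M borel X = density lborel p"
proof -
  have "distr M borel X = distr M lborel X" by (rule distr_cong) simp_all
  then show ?thesis using distributed_distr_eq_density[OF assms] by simp
qed

context
  fixes M :: "'w measure" and X Y :: "'w \<Rightarrow> 'a" and f g :: "'a \<Rightarrow> real"
  assumes M: "prob_space M"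
    and XY: "\<And>\<omega>. \<omega> \<in> space M \<Longrightarrow> X \<omega> \<in> cone" "\<And>\<omega>. \<omega> \<in> space M \<Longrightarrow> Y \<omega> \<in> cone"
    and indep: "prob_space.indep_var M borel X borel Y"
    and dX: "distributed M lborel X (\<lambda>x. ennreal (f x * indicator cone x))"
    and dY: "distributed M lborel Y (\<lambda>x. ennreal (g x * indicator cone x))"
    and pos: "\<And>x. x \<in> cone \<Longrightarrow> f x > 0" "\<And>x. x \<in> cone \<Longrightarrow> g x > 0"
begin

interpretation prob_space M by (rule M)

definition uv_event :: "'a set \<Rightarrow> 'a set \<Rightarrow> 'w set"
  where "uv_event A B = {\<omega> \<in> space M. quad (inv_sqrt m e (X \<omega> + Y \<omega>)) (X \<omega>) \<in> A \<and> X \<omega> + Y \<omega> \<in> B}"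

text \<open>For open sets measurability is topological: P(v^(-1/2)) x is continuous in (x, v) over
  B, so the preimage S of A is open. The integral arises from v = x + y at fixed x and, after
  exchanging the order, from x = P(w) u at fixed v.\<close>

lemma uv_probability:
  assumes A: "open A" "A \<subseteq> order_ball e" and B: "open B" "B \<subseteq> cone"
  shows "emeasure M (uv_event A B)
    = (\<integral>\<^sub>+v. (\<integral>\<^sub>+u. ennreal (uv_density f g u v) * indicator A u * indicator B v))"
proof -
  define fX where "fX x = ennreal (f x * indicator cone x)" for x
  define gY where "gY x = ennreal (g x * indicator cone x)" for x
  have [measurable]: "fX \<in> borel_measurable borel" "gY \<in> borel_measurable borel"
    using distributed_borel_measurable[OF dX] distributed_borel_measurable[OF dY]
    unfolding fX_def gY_def by simp_all
  have [measurable]: "X \<in> borel_measurable M" "Y \<in> borel_measurable M"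
    using distributed_measurable[OF dX] distributed_measurable[OF dY] by simp_all
  define S where "S = (UNIV \<times> B) \<inter> (\<lambda>p. quad (jinv (jsqrt (snd p))) (fst p)) -` A"
  have "open S" unfolding S_def
  proof (rule continuous_open_preimage)
    have "continuous_on (UNIV \<times> B) (\<lambda>p::'a \<times> 'a. jsqrt (snd p))"
      by (rule continuous_on_compose2[OF continuous_jsqrt]) (use B in \<open>auto intro!: continuous_intros\<close>)
    then have "continuous_on (UNIV \<times> B) (\<lambda>p::'a \<times> 'a. jinv (jsqrt (snd p)))"
      by (rule continuous_on_compose2[OF continuous_jinv]) (use B jsqrt_cone in auto)
    then show "continuous_on (UNIV \<times> B) (\<lambda>p::'a \<times> 'a. quad (jinv (jsqrt (snd p))) (fst p))"
      by (rule continuous_quad) (intro continuous_intros)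
  qed (use A B in \<open>auto intro: open_Times\<close>)
  then have [measurable]: "S \<in> sets (borel \<Otimes>\<^sub>M borel)" unfolding borel_prod by simp
  define h :: "'a \<times> 'a \<Rightarrow> ennreal" where "h p = indicator S (fst p, fst p + snd p)" for p
  have hm [measurable]: "h \<in> borel_measurable (borel \<Otimes>\<^sub>M borel)" unfolding h_def by measurable
  have ev: "uv_event A B = {\<omega> \<in> space M. (X \<omega>, X \<omega> + Y \<omega>) \<in> S}"
    using inv_sqrt_jsqrt[OF cone_add[OF XY]] by (auto simp: S_def uv_event_def)
  have "emeasure M {\<omega> \<in> space M. (X \<omega>, X \<omega> + Y \<omega>) \<in> S} = (\<integral>\<^sup>+\<omega>. indicator {\<omega> \<in> space M. (X \<omega>, X \<omega> + Y \<omega>) \<in> S} \<omega> \<partial>M)"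
    by (rule nn_integral_indicator[symmetric]) measurable
  also have "\<dots> = (\<integral>\<^sup>+\<omega>. h (X \<omega>, Y \<omega>) \<partial>M)"
    by (intro nn_integral_cong) (simp add: h_def indicator_def)
  also have "\<dots> = (\<integral>\<^sup>+p. h p \<partial>distr M (borel \<Otimes>\<^sub>M borel) (\<lambda>\<omega>. (X \<omega>, Y \<omega>)))"
    by (rule nn_integral_distr[symmetric]) measurable
  also have "distr M (borel \<Otimes>\<^sub>M borel) (\<lambda>\<omega>. (X \<omega>, Y \<omega>)) = distr M borel X \<Otimes>\<^sub>M distr M borel Y"
    using indep unfolding indep_var_distribution_eq by simp
  also have "(\<integral>\<^sup>+p. h p \<partial>(distr M borel X \<Otimes>\<^sub>M distr M borel Y))
     = (\<integral>\<^sup>+x. \<integral>\<^sup>+y. h (x, y) \<partial>distr M borel Y \<partial>distr M borel X)"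
  proof (rule sigma_finite_measure.nn_integral_fst[symmetric])
    show "sigma_finite_measure (distr M borel Y)"
      by (intro prob_space_imp_sigma_finite prob_space_distr) measurable
    show "h \<in> borel_measurable (distr M borel X \<Otimes>\<^sub>M distr M borel Y)" using hm by simp
  qed
  also have "\<dots> = (\<integral>\<^sub>+x. fX x * (\<integral>\<^sub>+y. gY y * h (x, y)))"
    unfolding distributed_distr_borel[OF dX] distributed_distr_borel[OF dY] fX_def[symmetric] gY_def[symmetric]
    by (simp add: nn_integral_density)
  also have "\<dots> = (\<integral>\<^sub>+x. (\<integral>\<^sub>+v. fX x * (gY (v - x) * indicator S (x, v))))"
  proof (rule nn_integral_cong)
    fix x
    have "(\<integral>\<^sub>+y. gY y * h (x, y)) = (\<integral>\<^sub>+v. gY (v - x) * indicator S (x, v))"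
      using nn_integral_lborel_shift[of "\<lambda>v. gY (v - x) * indicator S (x, v)" x] by (simp add: h_def)
    then show "fX x * (\<integral>\<^sub>+y. gY y * h (x, y)) = (\<integral>\<^sub>+v. fX x * (gY (v - x) * indicator S (x, v)))"
      by (simp add: nn_integral_cmult)
  qed
  also have "\<dots> = (\<integral>\<^sub>+v. (\<integral>\<^sub>+x. fX x * (gY (v - x) * indicator S (x, v))))"
    by (rule lborel_pair.Fubini') measurable
  also have "\<dots> = (\<integral>\<^sub>+v. (\<integral>\<^sub>+u. ennreal (uv_density f g u v) * indicator A u * indicator B v))"
  proof (rule nn_integral_cong)
    fix v
    show "(\<integral>\<^sub>+x. fX x * (gY (v - x) * indicator S (x, v)))
       = (\<integral>\<^sub>+u. ennreal (uv_density f g u v) * indicator A u * indicator B v)"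
    proof (cases "v \<in> B")
      case False
      then have "indicator S (x, v) = (0::ennreal)" for x by (simp add: S_def)
      then show ?thesis using False by simp
    next
      case True
      then have v: "v \<in> cone" using B by blast
      define w where "w = jsqrt v"
      have w: "w \<in> cone" and ww: "w \<odot> w = v" using jsqrt_cone[OF v] jsqrt_square[OF v] by (simp_all add: w_def)
      have "(\<integral>\<^sub>+x. fX x * (gY (v - x) * indicator S (x, v)))
        = ennreal (jdet (w \<odot> w) powr dimr) * (\<integral>\<^sub>+u. fX (quad w u) * (gY (v - quad w u) * indicator S (quad w u, v)))"
        by (rule nn_integral_quad[OF w, of "\<lambda>x. fX x * (gY (v - x) * indicator S (x, v))"]) measurable
      also have "\<dots> = (\<integral>\<^sub>+u. ennreal (jdet v powr dimr) * (fX (quad w u) * (gY (v - quad w u) * indicator S (quad w u, v))))"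
      proof -
        have [measurable]: "quad w \<in> borel_measurable borel"
          by (intro borel_measurable_continuous_onI continuous_quad continuous_intros)
        show ?thesis unfolding ww by (rule nn_integral_cmult[symmetric]) measurable
      qed
      also have "\<dots> = (\<integral>\<^sub>+u. ennreal (uv_density f g u v) * indicator A u * indicator B v)"
      proof (rule nn_integral_cong)
        fix u
        have "indicator S (quad w u, v) = (indicator A u :: ennreal)"
          using True quad_jinv(2)[OF w] by (simp add: S_def w_def indicator_def)
        moreover have "ennreal (jdet v powr dimr) * (fX (quad w u) * gY (v - quad w u)) = ennreal (uv_density f g u v)" if "u \<in> A"
        proof -
          have c: "quad w u \<in> cone" "quad w (e - u) \<in> cone"
            using that A by (auto simp: order_ball_def intro!: quad_cone w)
          have "v - quad w u = quad w (e - u)" by (simp add: quad_diff quad_e ww)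
          then show ?thesis using c pos(1)[OF c(1)] pos(2)[OF c(2)]
            by (simp add: fX_def gY_def uv_density_def w_def ennreal_mult mult.assoc)
        qed
        ultimately show "ennreal (jdet v powr dimr) * (fX (quad w u) * (gY (v - quad w u) * indicator S (quad w u, v)))
           = ennreal (uv_density f g u v) * indicator A u * indicator B v"
          using True by (cases "u \<in> A") (simp_all add: mult.assoc)
      qed
      finally show ?thesis .
    qed
  qed
  finally show ?thesis unfolding ev .
qed

text \<open>Continuity of the density lets its value at a point be recovered from probabilities of
  small products of balls.\<close>

lemma uv_average:
  assumes cont: "continuous_on cone f" "continuous_on cone g"
    and u: "u \<in> order_ball e" and v: "v \<in> cone"
  shows "((\<lambda>\<delta>. prob (uv_event (ball u \<delta>) (ball v \<delta>)) / (measure lborel (ball (0::'a) \<delta>))\<^sup>2)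
    \<longlongrightarrow> uv_density f g u v) (at_right 0)"
proof (rule tendstoI)
  fix \<epsilon> :: real assume \<epsilon>: "\<epsilon> > 0"
  let ?F = "uv_density f g" and ?S = "order_ball e \<times> cone"
  \<comment> \<open>Halving the minimum keeps the lower bound of the density nonnegative, so that it
    can be integrated in \<open>ennreal\<close>.\<close>
  define r where "r = min \<epsilon> (?F u v) / 2"
  have F0: "?F u v > 0" by (rule uv_density_pos[OF pos u v])
  then have r: "r > 0" "r < \<epsilon>" "?F u v - r \<ge> 0" using \<epsilon> by (auto simp: r_def)
  have "open (?S \<inter> (\<lambda>p. ?F (fst p) (snd p)) -` {?F u v - r<..<?F u v + r})"
    by (intro continuous_open_preimage continuous_uv_density cont open_Times open_order_ball open_cone) simp
  moreover have "(u, v) \<in> ?S \<inter> (\<lambda>p. ?F (fst p) (snd p)) -` {?F u v - r<..<?F u v + r}"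
    using u v r by simp
  ultimately have "\<exists>A B. open A \<and> open B \<and> (u, v) \<in> A \<times> B
      \<and> A \<times> B \<subseteq> ?S \<inter> (\<lambda>p. ?F (fst p) (snd p)) -` {?F u v - r<..<?F u v + r}"
    unfolding open_prod_def by blast
  then obtain A B where AB: "open A" "open B" "u \<in> A" "v \<in> B"
    "A \<times> B \<subseteq> ?S \<inter> (\<lambda>p. ?F (fst p) (snd p)) -` {?F u v - r<..<?F u v + r}" by blast
  obtain d1 d2 where d: "d1 > 0" "ball u d1 \<subseteq> A" "d2 > 0" "ball v d2 \<subseteq> B"
    using AB open_contains_ball by metis
  have bound: "dist (prob (uv_event (ball u \<delta>) (ball v \<delta>)) / (measure lborel (ball (0::'a) \<delta>))\<^sup>2) (?F u v) < \<epsilon>"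
    if \<delta>: "0 < \<delta>" "\<delta> < min d1 d2" for \<delta>
  proof -
    let ?G = "prob (uv_event (ball u \<delta>) (ball v \<delta>))"
    define L where "L = measure lborel (ball (0::'a) \<delta>)"
    have L: "L > 0" using \<delta>(1) by (simp add: L_def content_ball unit_ball_vol_pos)
    have bL: "emeasure lborel (ball x \<delta>) = ennreal L" for x :: 'a
      using \<delta>(1) by (simp add: emeasure_ball L_def content_ball)
    have [measurable]: "ball x \<delta> \<in> sets borel" for x :: 'a by simp
    have F: "x \<in> order_ball e" "y \<in> cone" "?F u v - r \<le> ?F x y" "?F x y \<le> ?F u v + r"
      if "x \<in> ball u \<delta>" "y \<in> ball v \<delta>" for x y
    proof -
      have "(x, y) \<in> A \<times> B" using that \<delta>(2) d by auto
      then show "x \<in> order_ball e" "y \<in> cone" "?F u v - r \<le> ?F x y" "?F x y \<le> ?F u v + r"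
        using AB(5) by auto
    qed
    have const: "(\<integral>\<^sub>+b. (\<integral>\<^sub>+a. ennreal c * indicator (ball u \<delta>) a * indicator (ball v \<delta>) b)) = ennreal (c * L\<^sup>2)"
      if "c \<ge> 0" for c
    proof -
      have 1: "(\<integral>\<^sub>+a. ennreal c * indicator (ball u \<delta>) a * indicator (ball v \<delta>) b)
        = ennreal c * ennreal L * indicator (ball v \<delta>) b" for b
        by (subst nn_integral_multc, measurable) (simp add: nn_integral_cmult_indicator bL)
      show ?thesis unfolding 1 using that L
        by (subst nn_integral_cmult_indicator) (simp_all add: bL ennreal_mult power2_eq_square mult.assoc)
    qed
    have "u \<in> ball u \<delta>" "v \<in> ball v \<delta>" using \<delta>(1) by simp_all
    then have sub: "ball u \<delta> \<subseteq> order_ball e" "ball v \<delta> \<subseteq> cone" using F by blast+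
    have G: "ennreal ?G = (\<integral>\<^sub>+b. (\<integral>\<^sub>+a. ennreal (?F a b) * indicator (ball u \<delta>) a * indicator (ball v \<delta>) b))"
      using uv_probability[OF open_ball sub(1) open_ball sub(2)] by (simp add: emeasure_eq_measure)
    define hi lo where "hi = ?F u v + r" and "lo = ?F u v - r"
    have hl: "hi \<ge> 0" "lo \<ge> 0" using F0 r by (simp_all add: hi_def lo_def)
    note F = F[folded hi_def lo_def]
    have "ennreal ?G \<le> ennreal (hi * L\<^sup>2)"
      unfolding G using hl F by (subst const[symmetric]) (auto simp: indicator_def intro!: nn_integral_mono ennreal_leI)
    then have up: "?G / L\<^sup>2 \<le> hi" using L hl by (simp add: ennreal_le_iff divide_le_eq)
    have "ennreal (lo * L\<^sup>2) \<le> ennreal ?G"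
      unfolding G using hl F by (subst const[symmetric]) (auto simp: indicator_def intro!: nn_integral_mono ennreal_leI)
    then have "lo \<le> ?G / L\<^sup>2" using L by (simp add: ennreal_le_iff le_divide_eq)
    then show ?thesis using up r(2) unfolding L_def[symmetric] dist_real_def hi_def lo_def by linarith
  qed
  show "\<forall>\<^sub>F \<delta> in at_right 0. dist (prob (uv_event (ball u \<delta>) (ball v \<delta>)) / (measure lborel (ball (0::'a) \<delta>))\<^sup>2) (?F u v) < \<epsilon>"
    unfolding eventually_at_right_field using d bound by (intro exI[of _ "min d1 d2"]) auto
qed

text \<open>By independence the joint density factorises; averaging over small balls gives the multiplicative
  cross identity without determining the marginal densities.\<close>

lemma uv_density_cross:
  assumes cont: "continuous_on cone f" "continuous_on cone g"
    and UV: "indep_var borel (\<lambda>\<omega>. quad (inv_sqrt m e (X \<omega> + Y \<omega>)) (X \<omega>)) borel (\<lambda>\<omega>. X \<omega> + Y \<omega>)"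
    and u: "u \<in> order_ball e" "u' \<in> order_ball e" and v: "v \<in> cone" "v' \<in> cone"
  shows "uv_density f g u v * uv_density f g u' v' = uv_density f g u v' * uv_density f g u' v"
proof -
  let ?q = "\<lambda>u v \<delta>. prob (uv_event (ball u \<delta>) (ball v \<delta>)) / (measure lborel (ball (0::'a) \<delta>))\<^sup>2"
  have "uv_event A B = (\<lambda>\<omega>. (quad (inv_sqrt m e (X \<omega> + Y \<omega>)) (X \<omega>), X \<omega> + Y \<omega>)) -` (A \<times> B) \<inter> space M" for A B
    by (auto simp: uv_event_def)
  then have fac: "?q u v \<delta> * ?q u' v' \<delta> = ?q u v' \<delta> * ?q u' v \<delta>" for \<delta>
    by (simp add: indep_varD[OF UV] mult_ac)
  have "((\<lambda>\<delta>. ?q u v \<delta> * ?q u' v' \<delta>) \<longlongrightarrow> uv_density f g u v * uv_density f g u' v') (at_right 0)"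
    by (intro tendsto_mult uv_average cont u v)
  moreover have "((\<lambda>\<delta>. ?q u v \<delta> * ?q u' v' \<delta>) \<longlongrightarrow> uv_density f g u v' * uv_density f g u' v) (at_right 0)"
    unfolding fac by (intro tendsto_mult uv_average cont u v)
  ultimately show ?thesis by (rule tendsto_unique[OF trivial_limit_at_right_real])
qed

end

text \<open>Total mass 1 determines C, because \<open>kernel_integral\<close> reduces the mass to
  the Gamma integral. It also makes that integral finite, so it agrees with the Bochner integral in
  \<open>cone_gamma\<close>.\<close>

lemma wishart_eq:
  assumes \<alpha>: "\<alpha> \<in> cone" and C: "C > 0"
    and one: "(\<integral>\<^sub>+y. ennreal (C * kernel \<kappa> \<alpha> y)) = 1"
  shows "density lborel (\<lambda>y. ennreal (C * kernel \<kappa> \<alpha> y)) = wishart m e (\<kappa> + dimr) \<alpha>"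
proof -
  define p where "p = \<kappa> + dimr"
  define D where "D = jdet \<alpha> powr p"
  have D: "D > 0" using jdet_pos[OF \<alpha>] by (simp add: D_def)
  define I where "I = mass \<kappa> e"
  have "(\<integral>\<^sub>+y. ennreal (C * kernel \<kappa> \<alpha> y)) = ennreal C * mass \<kappa> \<alpha>"
    using C by (subst nn_integral_cmult[symmetric]) (auto simp: ennreal_mult kernel_nonneg)
  also have "\<dots> = ennreal C * (ennreal (1 / D) * I)"
    unfolding kernel_integral[OF \<alpha>] I_def D_def p_def powr_minus_divide ..
  finally have eq: "ennreal C * (ennreal (1 / D) * I) = 1" using one by simp
  have "I \<noteq> \<infinity>"
    using eq C D by (auto simp: ennreal_mult_top ennreal_mult_eq_top_iff)
  then obtain \<Gamma> where \<Gamma>: "I = ennreal \<Gamma>" "\<Gamma> \<ge> 0" by (cases I) auto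
  have nn: "C \<ge> 0" "1 / D \<ge> 0" using C D by auto
  have "ennreal (C * (1 / D * \<Gamma>)) = ennreal 1"
    using eq unfolding \<Gamma>(1) by (simp only: ennreal_mult'[OF nn(1)] ennreal_mult'[OF nn(2)] ennreal_1)
  then have "C * (1 / D * \<Gamma>) = 1" using C D \<Gamma>(2) by (subst (asm) ennreal_inj) auto
  then have CD: "C = D / \<Gamma>" using D by (auto simp: field_simps)
  have "cone_gamma m e p = (\<integral>y. kernel \<kappa> e y \<partial>lborel)"
    unfolding cone_gamma_def set_lebesgue_integral_def p_def
    by (intro Bochner_Integration.integral_cong)
       (auto simp: kernel_def jdet_def jordan_trace_eq inner_commute mult.commute)
  also have "\<dots> = enn2real I"
    unfolding I_def by (rule integral_eq_nn_integral) (auto simp: kernel_nonneg)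
  finally have "cone_gamma m e p = \<Gamma>" using \<Gamma> by simp
  then have "C * kernel \<kappa> \<alpha> y = jordan_det m e \<alpha> powr p / cone_gamma m e p *
      jordan_det m e y powr (p - dimr) * exp (- inner \<alpha> y) * indicator cone y" for y
    unfolding CD D_def kernel_def jdet_def by (simp add: p_def)
  then show ?thesis unfolding wishart_def p_def[symmetric] by simp
qed

end

theorem theorem4p1:
  fixes m :: "'a::euclidean_space \<Rightarrow> 'a \<Rightarrow> 'a" and e :: 'a
    and M :: "'w measure" and X Y :: "'w \<Rightarrow> 'a" and f g :: "'a \<Rightarrow> real"
  assumes "simple_euclidean_jordan_algebra m e"
    and "\<And>x y. inner x y = jordan_trace m e (m x y)"
    and "non_octonion m"
    and "jordan_rank m e > 2"
    and "prob_space M"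
    and "\<And>\<omega>. \<omega> \<in> space M \<Longrightarrow> X \<omega> \<in> symmetric_cone m"
    and "\<And>\<omega>. \<omega> \<in> space M \<Longrightarrow> Y \<omega> \<in> symmetric_cone m"
    and "prob_space.indep_var M borel X borel Y"
    and "distributed M lborel X (\<lambda>x. ennreal (f x * indicator (symmetric_cone m) x))"
    and "continuous_on (symmetric_cone m) f" and "\<And>x. x \<in> symmetric_cone m \<Longrightarrow> f x > 0"
    and "distributed M lborel Y (\<lambda>x. ennreal (g x * indicator (symmetric_cone m) x))"
    and "continuous_on (symmetric_cone m) g" and "\<And>x. x \<in> symmetric_cone m \<Longrightarrow> g x > 0"
    and "prob_space.indep_var M
           borel (\<lambda>\<omega>. quadratic_rep m (inv_sqrt m e (X \<omega> + Y \<omega>)) (X \<omega>))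
           borel (\<lambda>\<omega>. X \<omega> + Y \<omega>)"
  shows "\<exists>a\<in>symmetric_cone m. \<exists>p1 p2 :: real.
    p1 > DIM('a) / jordan_rank m e - 1 \<and> p2 > DIM('a) / jordan_rank m e - 1 \<and>
    distr M borel X = wishart m e p1 a \<and> distr M borel Y = wishart m e p2 a"
proof -
  interpret prob_space M by fact
  interpret simple_jordan m e
  proof (intro simple_jordan.intro jordan.intro simple_jordan_axioms.intro)
    show "euclidean_jordan_algebra UNIV m e" using assms(1) by (simp add: simple_euclidean_jordan_algebra_def)
  qed (rule assms(1,2))+
  have cross: "uv_density f g u v * uv_density f g u' v' = uv_density f g u v' * uv_density f g u' v"
    if "u \<in> order_ball e" "u' \<in> order_ball e" "v \<in> cone" "v' \<in> cone" for u u' v v'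
    using uv_density_cross[OF assms(5-9,12,11,14,10,13,15), of u u' v v'] that by simp
  have "\<exists>A \<kappa>1 \<kappa>2 C1 C2. \<forall>x\<in>cone. ln (f x) = inner A x + \<kappa>1 * ln (jdet x) + C1
      \<and> ln (g x) = inner A x + \<kappa>2 * ln (jdet x) + C2"
  proof (rule olkin_baker)
    show "continuous_on cone (\<lambda>x. ln (f x))" "continuous_on cone (\<lambda>x. ln (g x))"
      using assms(11,14) by (auto intro!: continuous_intros assms(10,13) dest: assms(11) assms(14))
    fix u u' w w'
    assume u: "u \<in> order_ball e" "u' \<in> order_ball e" and w: "w \<in> cone" "w' \<in> cone"
    have d: "jdet (m w w) powr dimr > 0" if "w \<in> cone" for w using jdet_pos[OF cone_square[OF that]] by simp
    \<comment> \<open>At v = w^2 the logarithm of the joint density is a Jacobian term in w alone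
      plus the Olkin-Baker expression.\<close>
    have ln: "ln (uv_density f g u (m w w)) = ln (jdet (m w w) powr dimr) + (ln (f (quad w u)) + ln (g (quad w (e - u))))"
      if u: "u \<in> order_ball e" and w: "w \<in> cone" for u w
    proof -
      have c: "quad w u \<in> cone" "quad w (e - u) \<in> cone" using u by (auto simp: order_ball_def intro!: quad_cone w)
      have "uv_density f g u (m w w) = jdet (m w w) powr dimr * (f (quad w u) * g (quad w (e - u)))"
        by (simp add: uv_density_def jsqrt_of_square[OF w])
      then show ?thesis using d[OF w] assms(11)[OF c(1)] assms(14)[OF c(2)] by (simp add: ln_mult_pos)
    qed
    have p: "uv_density f g u (m w w) > 0" if "u \<in> order_ball e" "w \<in> cone" for u w
      using uv_density_pos[OF assms(11,14) that(1) cone_square[OF that(2)]] .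
    have "ln (uv_density f g u (m w w) * uv_density f g u' (m w' w'))
       = ln (uv_density f g u (m w' w') * uv_density f g u' (m w w))"
      using cross[OF u cone_square[OF w(1)] cone_square[OF w(2)]] by simp
    then have "ln (uv_density f g u (m w w)) + ln (uv_density f g u' (m w' w'))
       = ln (uv_density f g u (m w' w')) + ln (uv_density f g u' (m w w))"
      using p u w by (simp add: ln_mult_pos)
    then show "(ln (f (quad w u)) + ln (g (quad w (e - u)))) + (ln (f (quad w' u')) + ln (g (quad w' (e - u'))))
      = (ln (f (quad w u')) + ln (g (quad w (e - u')))) + (ln (f (quad w' u)) + ln (g (quad w' (e - u))))"
      unfolding ln[OF u(1) w(1)] ln[OF u(1) w(2)] ln[OF u(2) w(1)] ln[OF u(2) w(2)] by simp
  qed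
  then obtain A \<kappa>1 \<kappa>2 C1 C2 where sol: "\<And>x. x \<in> cone \<Longrightarrow> ln (f x) = inner A x + \<kappa>1 * ln (jdet x) + C1"
    "\<And>x. x \<in> cone \<Longrightarrow> ln (g x) = inner A x + \<kappa>2 * ln (jdet x) + C2" by blast
  \<comment> \<open>The linear part A is common to both logarithms, hence a single parameter; the
    sign matches the factor exp (- \<open>inner \<alpha> x\<close>) of the kernel.\<close>
  define \<alpha> where "\<alpha> = - A"
  have ident: "\<kappa> > -1 \<and> \<alpha> \<in> cone \<and> distr M borel Z = wishart m e (\<kappa> + dimr) \<alpha>"
    if dZ: "distributed M lborel Z (\<lambda>x. ennreal (h x * indicator cone x))"
      and hp: "\<And>x. x \<in> cone \<Longrightarrow> h x > 0"
      and hl: "\<And>x. x \<in> cone \<Longrightarrow> ln (h x) = inner A x + \<kappa> * ln (jdet x) + C" for Z h \<kappa> C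
  proof -
    have h: "h x * indicator cone x = exp C * kernel \<kappa> \<alpha> x" for x
    proof (cases "x \<in> cone")
      case True
      then have "h x = exp (inner A x + \<kappa> * ln (jdet x) + C)" using hp hl by (metis exp_ln)
      then show ?thesis using True jdet_pos[OF True]
        by (simp add: kernel_def \<alpha>_def exp_add powr_def mult_ac)
    qed (simp add: kernel_def)
    have distr: "distr M borel Z = density lborel (\<lambda>x. ennreal (exp C * kernel \<kappa> \<alpha> x))"
      using distributed_distr_borel[OF dZ] unfolding h .
    have Z: "Z \<in> measurable M borel" using distributed_measurable[OF dZ] by simp
    have "emeasure (distr M borel Z) UNIV = 1"
      using prob_space.emeasure_space_1[OF prob_space_distr[OF Z]] by simp
    then have one: "(\<integral>\<^sub>+x. ennreal (exp C * kernel \<kappa> \<alpha> x)) = 1"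
      unfolding distr by (simp add: emeasure_density)
    have "(\<integral>\<^sub>+x. ennreal (exp C * kernel \<kappa> \<alpha> x)) = ennreal (exp C) * mass \<kappa> \<alpha>"
      by (subst nn_integral_cmult[symmetric]) (auto simp: ennreal_mult kernel_nonneg)
    then have "mass \<kappa> \<alpha> \<noteq> top"
      using one by (auto simp: ennreal_mult_top ennreal_mult_eq_top_iff)
    then have fin: "mass \<kappa> \<alpha> < \<infinity>" by (simp add: less_top)
    have \<kappa>: "\<kappa> > -1" by (rule kernel_exponent[OF fin])
    have \<alpha>: "\<alpha> \<in> cone" by (rule kernel_parameter[OF fin]) (use \<kappa> in simp)
    show ?thesis using \<kappa> \<alpha> distr wishart_eq[OF \<alpha> exp_gt_zero one] by simp
  qed
  note X = ident[OF assms(9) assms(11) sol(1)] and Y = ident[OF assms(12) assms(14) sol(2)]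
  show ?thesis
    using X Y by (intro bexI[of _ \<alpha>] exI[of _ "\<kappa>1 + dimr"] exI[of _ "\<kappa>2 + dimr"]) simp_all
qed

end
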